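(* Let $\lambda_0\in\mathbb R$, $s_0\in(0,1]$, assume $\dim\ker(N_{s_0}-s_0^2\lambda_0)=1$, let $\mathbf u_{s_0}$ span this kernel, and let $q=\operatorname{Tr}_{s_0}\mathbf u_{s_0}$. Then: (1) If $\mathfrak m_{\lambda_0}\neq0$, then there exists a $C^2$ curve $\lambda(s)$ near $s_0$, with $\lambda(s_0)=\lambda_0$ and $s^2\lambda(s)\in\operatorname{Spec}(N_s)$, such that $$\lambda'(s_0)=-\frac{\mathfrak m_{s_0}(q)}{\mathfrak m_{\lambda_0}(q)}.$$ (2) If $\mathfrak m_{s_0}\neq0$, then there exists a $C^2$ curve $s(\lambda)$ near $\lambda_0$, with $s(\lambda_0)=s_0$ and $s(\lambda)^2\lambda\in\operatorname{Spec}(N_{s(\lambda)})$, such that $$\dot s(\lambda_0)=-\frac{\mathfrak m_{\lambda_0}(q)}{\mathfrak m_{s_0}(q)}.$$ Moreover, $\dot s(\lambda_0)=0$ if and only if $\mathfrak m_{\lambda_0}(q)=0$, and in this case $$\ddot s(\lambda_0)=-\frac{\mathfrak m^{(2)}_{\lambda_0}(q)}{\mathfrak m_{s_0}(q)}.$$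
   Context: $\ell>0$ and $g,h$ are real-valued $C^2$ functions on $[0,\ell]$ (when $s>1$ occurs, taken to be defined and $C^2$ on $[0,\ell']$ for some $\ell'>\ell$). Put $L_+^s=-\partial_{xx}-s^2g(sx)$, $L_-^s=-\partial_{xx}-s^2h(sx)$ and $N_s=\begin{pmatrix}0&-L_-^s\\L_+^s&0\end{pmatrix}$ in $L^2(0,\ell)^2$ with domain $\operatorname{dom}(N_s)=(H^2(0,\ell)\cap H^1_0(0,\ell))^2$. Let $B_s(x)=s^2B(sx)$ with $B(x)=\begin{pmatrix}0&h(x)\\-g(x)&0\end{pmatrix}$, so $\partial_sB_s=2sB(sx)+s^2xB'(sx)$; $S=\begin{pmatrix}0&1\\1&0\end{pmatrix}$; $\langle\cdot,\cdot\rangle$ is the $L^2$ inner product; functions are real-valued. For $\mathbf u=(u,v)^\top$, $$\operatorname{Tr}_s\mathbf u=\big(u(0),v(0),u(\ell),v(\ell),-\tfrac1su'(0),\tfrac1sv'(0),\tfrac1su'(\ell),-\tfrac1sv'(\ell)\big)^\top,$$ which is injective on solutions of $N_s\mathbf u=s^2\lambda\mathbf u$. The (Maslov) crossing forms at $(\lambda_0,s_0)$ in the $s$- and $\lambda$-directions, and the second order crossing form in the $\lambda$-direction, are the following quadratic forms on $\operatorname{Tr}_{s_0}\ker(N_{s_0}-s_0^2\lambda_0)$, with $q=\operatorname{Tr}_{s_0}\mathbf u_{s_0}$: $$\mathfrak m_{s_0}(q)=\tfrac1{s_0}\langle(\partial_sB_{s_0}-2s_0\lambda_0)\mathbf u_{s_0},S\mathbf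 u_{s_0}\rangle,\qquad \mathfrak m_{\lambda_0}(q)=-s_0\langle\mathbf u_{s_0},S\mathbf u_{s_0}\rangle,$$ and, when $\mathfrak m_{\lambda_0}=0$, $$\mathfrak m^{(2)}_{\lambda_0}(q)=-2s_0^3\langle\mathbf v_{s_0},S\mathbf u_{s_0}\rangle,$$ where $\mathbf v_{s_0}\in\operatorname{dom}(N_{s_0})$ is any solution of $(N_{s_0}-s_0^2\lambda_0)\mathbf v_{s_0}=\mathbf u_{s_0}$ (it exists, and the value does not depend on the choice). *)

theory Defs
  imports "HOL-Analysis.Analysis" "HOL-Library.Function_Algebras"
begin

text \<open>
  Functions on an interval as a real vector space, so that \<open>fun_space.dim\<close> and \<open>fun_space.span\<close>
  are available for spaces of functions.
\<close>

interpretation fun_space: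
  vector_space "\<lambda>(c::real) (f :: real \<Rightarrow> real^2) (x::real). c *\<^sub>R f x"
  by unfold_locales (auto simp: fun_eq_iff algebra_simps)

text \<open>Derivatives are taken within \<open>S\<close>, hence are one-sided at endpoints belonging to \<open>S\<close>.\<close>

definition C2_on :: "real set \<Rightarrow> (real \<Rightarrow> real) \<Rightarrow> bool" where
  "C2_on S f \<longleftrightarrow> (\<exists>f' f''.
     (\<forall>x\<in>S. (f has_real_derivative f' x) (at x within S)) \<and>
     (\<forall>x\<in>S. (f' has_real_derivative f'' x) (at x within S)) \<and>
     continuous_on S f'')"

section \<open>Function spaces on \<open>(0, ell)\<close>\<close>

text \<open>Elements of \<open>L2 ell\<close> are representatives; equality in the Lebesgue space is
  almost everywhere equality.\<close>

definition L2 :: "real \<Rightarrow> (real \<Rightarrow> 'a::euclidean_space) set" where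
  "L2 ell = {f. f \<in> borel_measurable (lebesgue_on {0<..<ell}) \<and>
                integrable (lebesgue_on {0<..<ell}) (\<lambda>x. (norm (f x))\<^sup>2)}"

definition inner_L2 :: "real \<Rightarrow> (real \<Rightarrow> 'a::euclidean_space) \<Rightarrow> (real \<Rightarrow> 'a) \<Rightarrow> real" where
  "inner_L2 ell f k = integral\<^sup>L (lebesgue_on {0<..<ell}) (\<lambda>x. f x \<bullet> k x)"

definition norm_L2 :: "real \<Rightarrow> (real \<Rightarrow> 'a::euclidean_space) \<Rightarrow> real" where
  "norm_L2 ell f = sqrt (inner_L2 ell f f)"

definition test_functions :: "real \<Rightarrow> (real \<Rightarrow> real) set" where
  "test_functions ell = {\<phi>. (\<forall>n x. (deriv ^^ n) \<phi> field_differentiable at x) \<and>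
     compact (closure {x. \<phi> x \<noteq> 0}) \<and> closure {x. \<phi> x \<noteq> 0} \<subseteq> {0<..<ell}}"

definition has_weak_deriv :: "real \<Rightarrow> (real \<Rightarrow> real) \<Rightarrow> (real \<Rightarrow> real) \<Rightarrow> bool" where
  "has_weak_deriv ell f f' \<longleftrightarrow>
     (\<forall>\<phi>\<in>test_functions ell. inner_L2 ell f (deriv \<phi>) = - inner_L2 ell f' \<phi>)"

text \<open>Some square integrable weak derivative; it is unique up to null sets.\<close>

definition wderiv :: "real \<Rightarrow> (real \<Rightarrow> real) \<Rightarrow> real \<Rightarrow> real" where
  "wderiv ell f = (SOME f'. f' \<in> L2 ell \<and> has_weak_deriv ell f f')"

definition H1 :: "real \<Rightarrow> (real \<Rightarrow> real) set" where
  "H1 ell = {f \<in> L2 ell. \<exists>f'\<in>L2 ell. has_weak_deriv ell f f'}"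

definition H2 :: "real \<Rightarrow> (real \<Rightarrow> real) set" where
  "H2 ell = {f \<in> H1 ell. \<exists>f'\<in>H1 ell. has_weak_deriv ell f f'}"

definition H10 :: "real \<Rightarrow> (real \<Rightarrow> real) set" where
  "H10 ell = {f \<in> H1 ell. \<exists>\<phi>. (\<forall>n. \<phi> n \<in> test_functions ell) \<and>
     (\<lambda>n. norm_L2 ell (\<lambda>x. \<phi> n x - f x)) \<longlonglongrightarrow> 0 \<and>
     (\<lambda>n. norm_L2 ell (\<lambda>x. deriv (\<phi> n) x - wderiv ell f x)) \<longlonglongrightarrow> 0}"

section \<open>The operators \<open>N\<^sub>s\<close>\<close>

text \<open>
  An element of the domain is represented by its unique continuous representative on \<open>[0, ell]\<close>,
  extended by \<open>0\<close> to the real line. Thus equality in the domain is equality of functions,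
  the domain is a linear subspace, and boundary values make sense.
\<close>

definition dom_N :: "real \<Rightarrow> (real \<Rightarrow> real^2) set" where
  "dom_N ell = {u. (\<forall>i. (\<lambda>x. u x $ i) \<in> H2 ell \<inter> H10 ell) \<and>
     continuous_on {0..ell} u \<and> (\<forall>x. x \<notin> {0..ell} \<longrightarrow> u x = 0)}"

text \<open>Both \<open>L\<^sub>+\<^sup>s\<close> (for \<open>p = g\<close>) and \<open>L\<^sub>-\<^sup>s\<close> (for \<open>p = h\<close>).\<close>

definition schroed :: "(real \<Rightarrow> real) \<Rightarrow> real \<Rightarrow> real \<Rightarrow> (real \<Rightarrow> real) \<Rightarrow> real \<Rightarrow> real" where
  "schroed p ell s f x = - wderiv ell (wderiv ell f) x - s\<^sup>2 * p (s * x) * f x"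

definition N_op ::
  "(real \<Rightarrow> real) \<Rightarrow> (real \<Rightarrow> real) \<Rightarrow> real \<Rightarrow> real \<Rightarrow> (real \<Rightarrow> real^2) \<Rightarrow> real \<Rightarrow> real^2" where
  "N_op g h ell s u x =
     vector [- schroed h ell s (\<lambda>y. u y $ 2) x, schroed g ell s (\<lambda>y. u y $ 1) x]"

definition solves_N ::
  "(real \<Rightarrow> real) \<Rightarrow> (real \<Rightarrow> real) \<Rightarrow> real \<Rightarrow> real \<Rightarrow> real \<Rightarrow> (real \<Rightarrow> real^2) \<Rightarrow> (real \<Rightarrow> real^2) \<Rightarrow> bool"
where \<comment> \<open>\<open>u\<close> lies in the domain and \<open>(N\<^sub>s - mu) u = f\<close>\<close>
  "solves_N g h ell s mu u f \<longleftrightarrow> u \<in> dom_N ell \<and>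
     (AE x in lebesgue_on {0<..<ell}. N_op g h ell s u x - mu *\<^sub>R u x = f x)"

definition ker_N ::
  "(real \<Rightarrow> real) \<Rightarrow> (real \<Rightarrow> real) \<Rightarrow> real \<Rightarrow> real \<Rightarrow> real \<Rightarrow> (real \<Rightarrow> real^2) set" where
  "ker_N g h ell s mu = {u. solves_N g h ell s mu u (\<lambda>x. 0)}"

text \<open>
  The real points of the spectrum: \<open>mu\<close> is in the resolvent set iff \<open>N\<^sub>s - mu\<close> is a bijection
  from the domain onto \<open>L\<^sup>2\<close> with bounded inverse. As \<open>N\<^sub>s\<close> has real coefficients, for
  real \<open>mu\<close> it makes no difference whether the underlying Hilbert space is real or complex.
\<close>

definition resolvent_N ::
  "(real \<Rightarrow> real) \<Rightarrow> (real \<Rightarrow> real) \<Rightarrow> real \<Rightarrow> real \<Rightarrow> real set" where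
  "resolvent_N g h ell s = {mu.
     (\<forall>f\<in>L2 ell. \<exists>!u. solves_N g h ell s mu u f) \<and>
     (\<exists>C. \<forall>f\<in>L2 ell. \<forall>u. solves_N g h ell s mu u f \<longrightarrow> norm_L2 ell u \<le> C * norm_L2 ell f)}"

definition Spec_N ::
  "(real \<Rightarrow> real) \<Rightarrow> (real \<Rightarrow> real) \<Rightarrow> real \<Rightarrow> real \<Rightarrow> real set" where
  "Spec_N g h ell s = - resolvent_N g h ell s"

section \<open>Crossing forms\<close>

definition B_mat :: "(real \<Rightarrow> real) \<Rightarrow> (real \<Rightarrow> real) \<Rightarrow> real \<Rightarrow> real^2^2" where
  "B_mat g h x = vector [vector [0, h x], vector [- g x, 0]]"

definition Bs_mat :: "(real \<Rightarrow> real) \<Rightarrow> (real \<Rightarrow> real) \<Rightarrow> real \<Rightarrow> real \<Rightarrow> real^2^2" where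
  "Bs_mat g h s x = s\<^sup>2 *\<^sub>R B_mat g h (s * x)"

definition dBs_mat :: "(real \<Rightarrow> real) \<Rightarrow> (real \<Rightarrow> real) \<Rightarrow> real \<Rightarrow> real \<Rightarrow> real^2^2" where
  "dBs_mat g h s x = vector_derivative (\<lambda>r. Bs_mat g h r x) (at s)"

definition S_mat :: "real^2^2" where
  "S_mat = vector [vector [0, 1], vector [1, 0]]"

definition Tr :: "real \<Rightarrow> real \<Rightarrow> (real \<Rightarrow> real^2) \<Rightarrow> real^8" where
  "Tr ell s u = (let du = (\<lambda>a. vector_derivative u (at a within {0..ell})) in
     vector [u 0 $ 1, u 0 $ 2, u ell $ 1, u ell $ 2,
             - (1/s) * du 0 $ 1, (1/s) * du 0 $ 2, (1/s) * du ell $ 1, - (1/s) * du ell $ 2])"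

text \<open>
  The forms live on \<open>Tr ell s ` ker_N g h ell s (s\<^sup>2 * lam)\<close>. The trace is injective on the
  kernel, so \<open>kernel_of_trace\<close> recovers the element of the kernel from its trace.
\<close>

definition kernel_of_trace ::
  "(real \<Rightarrow> real) \<Rightarrow> (real \<Rightarrow> real) \<Rightarrow> real \<Rightarrow> real \<Rightarrow> real \<Rightarrow> real^8 \<Rightarrow> real \<Rightarrow> real^2" where
  "kernel_of_trace g h ell lam s = inv_into (ker_N g h ell s (s\<^sup>2 * lam)) (Tr ell s)"

definition m_s ::
  "(real \<Rightarrow> real) \<Rightarrow> (real \<Rightarrow> real) \<Rightarrow> real \<Rightarrow> real \<Rightarrow> real \<Rightarrow> real^8 \<Rightarrow> real" where
  "m_s g h ell lam s q = (let u = kernel_of_trace g h ell lam s q in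
     (1/s) * inner_L2 ell (\<lambda>x. dBs_mat g h s x *v u x - (2 * s * lam) *\<^sub>R u x) (\<lambda>x. S_mat *v u x))"

definition m_lam ::
  "(real \<Rightarrow> real) \<Rightarrow> (real \<Rightarrow> real) \<Rightarrow> real \<Rightarrow> real \<Rightarrow> real \<Rightarrow> real^8 \<Rightarrow> real" where
  "m_lam g h ell lam s q = (let u = kernel_of_trace g h ell lam s q in
     - s * inner_L2 ell u (\<lambda>x. S_mat *v u x))"

text \<open>Meaningful only where \<open>m_lam\<close> vanishes; then \<open>v\<close> exists and its choice is immaterial.\<close>

definition m2_lam ::
  "(real \<Rightarrow> real) \<Rightarrow> (real \<Rightarrow> real) \<Rightarrow> real \<Rightarrow> real \<Rightarrow> real \<Rightarrow> real^8 \<Rightarrow> real" where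
  "m2_lam g h ell lam s q = (let u = kernel_of_trace g h ell lam s q;
                                 v = (SOME v. solves_N g h ell s (s\<^sup>2 * lam) v u)
     in - 2 * s^3 * inner_L2 ell v (\<lambda>x. S_mat *v u x))"

end

theory Submission
  imports Defs
begin

text \<open>
  The substitution \<open>y = s x\<close> turns \<open>N\<^sub>s u = s\<^sup>2 lam u\<close> into
  \<open>U'' = - g U - lam V\<close>, \<open>V'' = - h V + lam U\<close>, a system that does not contain \<open>s\<close>: the
  parameter survives only in the length \<open>s ell\<close> of the interval on which Dirichlet conditions
  are imposed. Take two solutions that vanish at \<open>0\<close> and have independent slopes there, and let
  \<open>F (lam, s)\<close> be the determinant of their values at \<open>y = s ell\<close>. Where \<open>F\<close> vanishes, a
  combination of the two solutions is a Dirichlet eigenfunction, so \<open>s\<^sup>2 lam\<close> is in the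
  spectrum (\<open>det_zero_Spec\<close>). Moreover \<open>F\<close> is \<open>C\<^sup>2\<close>, since the solutions depend smoothly on
  \<open>lam\<close> (\<open>solution_family\<close>) and twice differentiably on the end point (\<open>determinant_C2\<close>).
  Both curves are therefore level curves of \<open>F\<close>, given by \<open>implicit_function_C2\<close>, and what
  remains is to identify the derivatives of \<open>F\<close> at \<open>(lam0, s0)\<close> with the crossing forms.

  Let the first solution be the rescaled eigenfunction \<open>(Ua, Va)\<close>. It vanishes at
  \<open>y0 = s0 ell\<close>, so in the first derivatives of the determinant only its own derivatives count. The
  quantity \<open>U' X - U X' - V' Y + V Y'\<close> of two solutions is constant
  (\<open>ode_system_lagrange\<close>); evaluated at both ends it yields a number \<open>\<kappa>\<close> with
  \<open>(Ua', Va') = \<kappa> (Vb, Ub)\<close> at \<open>y0\<close> (\<open>kappa_exists\<close>). The same identity, applied to the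
  eigenfunction and to its first and second derivatives in \<open>lam\<close>, shows that the crossing forms in
  the \<open>lam\<close>-direction are \<open>- \<kappa> F\<^sub>l\<close> and, if \<open>F\<^sub>l = 0\<close>, \<open>- \<kappa> F\<^sub>l\<^sub>l\<close>
  (\<open>crossing_lam\<close>, \<open>second_crossing\<close>). A virial identity does the same for \<open>- \<kappa> F\<^sub>s\<close>
  (\<open>ode_system_virial\<close>, \<open>crossing_s\<close>). If one of the forms is nonzero then so is \<open>\<kappa>\<close>, and it
  cancels from the quotients.

  The operators are defined by weak derivatives on \<open>H\<^sup>2 \<inter> H\<^sup>1\<^sub>0\<close>, whereas this argument is
  classical. The two are connected by \<open>solves_N_classical\<close> and \<open>classical_solves_N\<close>. The former
  is a regularity statement of du Bois-Reymond type (\<open>weak_second_derivative_zero\<close>) together with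
  the vanishing of boundary values (\<open>H10_boundary\<close>); the latter needs the approximation in \<open>H\<^sup>1\<close> of
  a \<open>C\<^sup>1\<close> function vanishing at both ends by test functions (\<open>classical_H10\<close>).
\<close>

section \<open>Implicit functions of class \<open>C\<^sup>2\<close>\<close>

text \<open>
  The inverse function theorem, applied to \<open>(x, y) \<mapsto> (x, F (x, y))\<close>, provides a differentiable
  solution \<open>f\<close> of \<open>F (x, f x) = 0\<close>. Differentiating this equation gives \<open>f' = - Fx / Fy\<close> along
  the curve; the right-hand side is again differentiable, which yields the second derivative.
\<close>

lemma implicit_function_C2:
  fixes F Fx Fy Fxx Fxy Fyx Fyy :: "real \<times> real \<Rightarrow> real"
  assumes "open U" and inU: "(x0, y0) \<in> U"
    and dF: "\<And>p. p \<in> U \<Longrightarrow> (F has_derivative (\<lambda>d. Fx p * fst d + Fy p * snd d)) (at p)"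
    and dFx: "\<And>p. p \<in> U \<Longrightarrow> (Fx has_derivative (\<lambda>d. Fxx p * fst d + Fxy p * snd d)) (at p)"
    and dFy: "\<And>p. p \<in> U \<Longrightarrow> (Fy has_derivative (\<lambda>d. Fyx p * fst d + Fyy p * snd d)) (at p)"
    and cont: "continuous_on U Fxx" "continuous_on U Fxy" "continuous_on U Fyx" "continuous_on U Fyy"
    and zero: "F (x0, y0) = 0" and nz: "Fy (x0, y0) \<noteq> 0"
  obtains e f where "e > 0" "f x0 = y0" "C2_on {x0 - e<..<x0 + e} f"
    "\<And>x. x \<in> {x0 - e<..<x0 + e} \<Longrightarrow> (x, f x) \<in> U \<and> F (x, f x) = 0"
    "deriv f x0 = - (Fx (x0, y0) / Fy (x0, y0))"
    "Fx (x0, y0) = 0 \<Longrightarrow> deriv (deriv f) x0 = - (Fxx (x0, y0) / Fy (x0, y0))"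
proof -
  define C0 where "C0 = Blinfun (\<lambda>d::real \<times> real. (fst d, 0::real))"
  define C1 where "C1 = Blinfun (\<lambda>d::real \<times> real. (0::real, fst d))"
  define C2 where "C2 = Blinfun (\<lambda>d::real \<times> real. (0::real, snd d))"
  have C0: "blinfun_apply C0 d = (fst d, 0)" and C1: "blinfun_apply C1 d = (0, fst d)"
    and C2: "blinfun_apply C2 d = (0, snd d)" for d
    unfolding C0_def C1_def C2_def
    by (simp_all add: bounded_linear_Blinfun_apply bounded_linear_Pair bounded_linear_fst bounded_linear_snd)
  define H where "H = (\<lambda>p. (fst p, F p))"
  define H' where "H' = (\<lambda>p. C0 + Fx p *\<^sub>R C1 + Fy p *\<^sub>R C2)"
  \<comment> \<open>The inverse of the Jacobian matrix at \<open>(x0, y0)\<close>.\<close>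
  define R where "R = C0 + (- Fx (x0,y0) / Fy (x0,y0)) *\<^sub>R C1 + (1 / Fy (x0,y0)) *\<^sub>R C2"
  have H'_apply: "blinfun_apply (H' p) = (\<lambda>d. (fst d, Fx p * fst d + Fy p * snd d))" for p
    by (auto simp: H'_def blinfun.add_left blinfun.scaleR_left C0 C1 C2)
  have dH: "(H has_derivative blinfun_apply (H' p)) (at p)" if "p \<in> U" for p
    unfolding H_def H'_apply
    by (rule has_derivative_Pair[OF has_derivative_fst[OF has_derivative_ident] dF[OF that]])
  have contFx: "continuous_on U Fx" and contFy: "continuous_on U Fy"
    using has_derivative_continuous[OF dFx] has_derivative_continuous[OF dFy]
    by (auto intro: continuous_at_imp_continuous_on)
  have contH: "continuous_on U H'"
    unfolding H'_def using contFx contFy by (intro continuous_intros)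
  have inv: "R o\<^sub>L H' (x0, y0) = id_blinfun"
    by (rule blinfun_eqI)
       (use nz in \<open>auto simp: R_def H'_apply blinfun.add_left blinfun.diff_left blinfun.scaleR_left C0 C1 C2 field_simps\<close>)
  obtain U' V G G' where G: "open U'" "U' \<subseteq> U" "(x0, y0) \<in> U'" "open V" "H (x0, y0) \<in> V"
    "homeomorphism U' V H G" "\<And>y. y \<in> V \<Longrightarrow> (G has_derivative (G' y)) (at y)"
    using inverse_function_theorem[OF \<open>open U\<close> dH contH inU inv] by metis
  define f where "f = (\<lambda>x. snd (G (x, 0::real)))"
  have V0: "(x0, 0) \<in> V" using G(5) zero by (simp add: H_def)
  have fstG: "fst (G (x, 0)) = x" "F (G (x, 0)) = 0" "G (x, 0) \<in> U" if "(x, 0) \<in> V" for x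
  proof -
    have "H (G (x, 0)) = (x, 0)" "G (x, 0) \<in> U'"
      using G(6) that by (auto simp: homeomorphism_def)
    then show "fst (G (x, 0)) = x" "F (G (x, 0)) = 0" "G (x, 0) \<in> U"
      using G(2) by (auto simp: H_def)
  qed
  have Gf: "G (x, 0) = (x, f x)" if "(x, 0) \<in> V" for x
    using fstG(1)[OF that] by (simp add: f_def prod_eq_iff)
  have inU': "(x, f x) \<in> U" and F0: "F (x, f x) = 0" if "(x, 0) \<in> V" for x
    using fstG(2,3)[OF that] Gf[OF that] by simp_all
  have fx0: "f x0 = y0"
  proof -
    have "G (H (x0, y0)) = (x0, y0)" using G(3,6) by (auto simp: homeomorphism_def)
    then show ?thesis using Gf[OF V0] zero by (simp add: H_def)
  qed
  define W where "W = {x. (x, 0::real) \<in> V}"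
  have "open W"
    unfolding W_def using open_vimage[OF \<open>open V\<close>, of "\<lambda>x. (x, 0)"]
    by (simp add: vimage_def continuous_on_Pair)
  have x0W: "x0 \<in> W" using V0 by (simp add: W_def)
  have difff: "\<exists>D. (f has_real_derivative D) (at x)" if "x \<in> W" for x
  proof -
    have "((\<lambda>x. (x, 0::real)) has_derivative (\<lambda>d. (d, 0))) (at x)"
      by (auto intro!: derivative_eq_intros)
    from has_derivative_snd[OF has_derivative_compose[OF this G(7)]]
    show ?thesis
      unfolding f_def using that real_differentiable_def differentiable_def W_def by blast
  qed
  have contf: "continuous_on W f"
    using difff by (meson DERIV_isCont continuous_at_imp_continuous_on)
  have contfU: "continuous_on W (\<lambda>x. K (x, f x))" if "continuous_on U K" for K :: "real \<times> real \<Rightarrow> real"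
    by (rule continuous_on_compose2[OF that])
       (use contf inU' in \<open>auto intro!: continuous_intros simp: W_def\<close>)
  have chain: "((\<lambda>x. K (x, f x)) has_real_derivative Kx + Ky * D) (at x)"
    if "x \<in> W" "(K has_derivative (\<lambda>d. Kx * fst d + Ky * snd d)) (at (x, f x))"
       "(f has_real_derivative D) (at x)" for K :: "real \<times> real \<Rightarrow> real" and Kx Ky D x
  proof -
    have "((\<lambda>x. (x, f x)) has_derivative (\<lambda>d. (d, D * d))) (at x)"
      using that(3) by (auto intro!: has_derivative_Pair has_derivative_ident simp: has_field_derivative_def)
    from has_derivative_compose[OF this, of K, OF that(2)]
    moreover have "(\<lambda>d. Kx * fst (d, D * d) + Ky * snd (d, D * d)) = (*) (Kx + Ky * D)"
      by (auto simp: algebra_simps)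
    ultimately show ?thesis by (simp add: has_field_derivative_def)
  qed
  have "continuous_on W (\<lambda>x. Fy (x, f x))" by (rule contfU[OF contFy])
  then have "open ((\<lambda>x. Fy (x, f x)) -` (- {0}) \<inter> W)"
    using \<open>open W\<close> by (simp add: continuous_on_open_vimage open_Compl)
  moreover have "x0 \<in> (\<lambda>x. Fy (x, f x)) -` (- {0}) \<inter> W" using x0W nz fx0 by simp
  ultimately obtain e where e: "e > 0" "ball x0 e \<subseteq> (\<lambda>x. Fy (x, f x)) -` (- {0}) \<inter> W"
    by (meson openE)
  define I where "I = {x0 - e<..<x0 + e}"
  have I: "x0 \<in> I" "open I" "I \<subseteq> W" "\<And>x. x \<in> I \<Longrightarrow> Fy (x, f x) \<noteq> 0"
    using e by (auto simp: I_def ball_eq_greaterThanLessThan)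
  define f1 where "f1 = (\<lambda>x. - (Fx (x, f x) / Fy (x, f x)))"
  have df: "(f has_real_derivative f1 x) (at x)" if "x \<in> I" for x
  proof -
    have "x \<in> W" using that I by auto
    then obtain D where D: "(f has_real_derivative D) (at x)" using difff by blast
    have "((\<lambda>x. F (x, f x)) has_real_derivative Fx (x, f x) + Fy (x, f x) * D) (at x)"
      using chain[OF \<open>x \<in> W\<close> dF D] inU' \<open>x \<in> W\<close> by (simp add: W_def)
    moreover have "((\<lambda>x. F (x, f x)) has_real_derivative 0) (at x)"
      using has_field_derivative_transform_within_open[OF DERIV_const \<open>open W\<close> \<open>x \<in> W\<close>, of 0] F0
      by (simp add: W_def)
    ultimately have "Fx (x, f x) + Fy (x, f x) * D = 0" by (rule DERIV_unique)
    then have "D = f1 x" using I(4)[OF that] by (simp add: f1_def field_simps)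
    then show ?thesis using D by simp
  qed
  \<comment> \<open>The quotient rule for \<open>f1\<close>, with \<open>f\<close> itself differentiated by \<open>f1\<close>.\<close>
  define f2 where "f2 = (\<lambda>x. - (((Fxx (x, f x) + Fxy (x, f x) * f1 x) * Fy (x, f x)
      - Fx (x, f x) * (Fyx (x, f x) + Fyy (x, f x) * f1 x)) / (Fy (x, f x))\<^sup>2))"
  have df1: "(f1 has_real_derivative f2 x) (at x)" if "x \<in> I" for x
  proof -
    have xW: "x \<in> W" and xU: "(x, f x) \<in> U" using that I inU' by (auto simp: W_def)
    note d = chain[OF xW dFx[OF xU] df[OF that]] chain[OF xW dFy[OF xU] df[OF that]]
    show ?thesis
      unfolding f1_def f2_def
      by (rule DERIV_minus) (use DERIV_divide[OF d I(4)[OF that]] in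
        \<open>simp add: power2_eq_square f1_def\<close>)
  qed
  have contI: "continuous_on I (\<lambda>x. K (x, f x))" if "continuous_on U K" for K :: "real \<times> real \<Rightarrow> real"
    using contfU[OF that] I(3) by (rule continuous_on_subset)
  have "continuous_on I f1"
    unfolding f1_def using I(4) contI contFx contFy by (intro continuous_intros) auto
  then have "continuous_on I f2"
    unfolding f2_def using I(4) contI contFx contFy cont by (intro continuous_intros) auto
  then have "C2_on I f"
    unfolding C2_on_def using df df1 by (blast intro: has_field_derivative_at_within)
  moreover have deriv1: "deriv f x = f1 x" if "x \<in> I" for x
    using df[OF that] by (rule DERIV_imp_deriv)
  moreover have "deriv (deriv f) x0 = f2 x0"
  proof -
    have "(deriv f has_real_derivative f2 x0) (at x0)"
      using has_field_derivative_transform_within_open[OF df1[OF I(1)] I(2) I(1)] deriv1 by simp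
    then show ?thesis by (rule DERIV_imp_deriv)
  qed
  moreover have "f2 x0 = - (Fxx (x0, y0) / Fy (x0, y0))" if "Fx (x0, y0) = 0"
    using that fx0 nz by (simp add: f2_def f1_def power2_eq_square)
  moreover have "(x, f x) \<in> U \<and> F (x, f x) = 0" if "x \<in> I" for x
    using that I(3) inU' F0 by (auto simp: W_def)
  ultimately show thesis
    using that[of e f] e(1) fx0 I(1) unfolding I_def[symmetric] f1_def by simp
qed

section \<open>Linear differential equations with a parameter\<close>

text \<open>
  Banach's fixed point theorem for \<open>exp (- M t) w t\<close> instead of \<open>w t\<close>: with the weight
  \<open>M = 2 K + 1\<close> the Picard operator is a contraction on the whole of \<open>[0, L]\<close> at once, and no
  continuation from short intervals is involved.
\<close>

lemma lipschitz_ode_exists: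
  fixes f :: "real \<Rightarrow> 'a::banach \<Rightarrow> 'a" and c :: 'a
  assumes L: "0 \<le> L" and cont: "continuous_on ({0..L} \<times> UNIV) (\<lambda>(t, x). f t x)"
    and K: "0 \<le> K" "\<And>t x y. t \<in> {0..L} \<Longrightarrow> norm (f t x - f t y) \<le> K * norm (x - y)"
  obtains w where "w 0 = c"
    "\<And>t. t \<in> {0..L} \<Longrightarrow> (w has_vector_derivative f t (w t)) (at t within {0..L})"
proof -
  define M where "M = 2 * K + 1"
  have M: "M > 0" "K / M \<le> 1/2" using K by (auto simp: M_def field_simps)
  \<comment> \<open>Clamping to \<open>[0, L]\<close> lets the fixed point be sought among bounded continuous functions
    on all of the real line.\<close>
  define cl where "cl = (\<lambda>t. max 0 (min L t))"
  have cl: "cl t \<in> {0..L}" for t using L by (auto simp: cl_def)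
  have cl_cont: "continuous_on UNIV cl" unfolding cl_def by (intro continuous_intros)
  have cl_id: "cl t = t" if "t \<in> {0..L}" for t using that by (auto simp: cl_def)
  define I where "I = (\<lambda>p t. exp (- M * t) *\<^sub>R (c + integral {0..t} (\<lambda>r. f r (exp (M * r) *\<^sub>R p r))))"
  have contf: "continuous_on {0..L} (\<lambda>r. f r (p r))" if "continuous_on {0..L} p" for p :: "real \<Rightarrow> 'a"
  proof -
    have "continuous_on {0..L} (\<lambda>r. (r, p r))" by (intro continuous_intros that)
    from continuous_on_compose2[OF cont this] show ?thesis by auto
  qed
  have contfp: "continuous_on {0..L} (\<lambda>r. f r (exp (M * r) *\<^sub>R p r))" if "continuous_on {0..L} p" for p :: "real \<Rightarrow> 'a"
    by (intro contf continuous_intros that)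
  have contI: "continuous_on {0..L} (I p)" if "continuous_on {0..L} p" for p
    unfolding I_def
    by (intro continuous_intros indefinite_integral_continuous_1 integrable_continuous_real contfp that)
  have inb: "(\<lambda>t. I (apply_bcontfun p) (cl t)) \<in> bcontfun" for p :: "real \<Rightarrow>\<^sub>C 'a"
  proof -
    have cI: "continuous_on {0..L} (I (apply_bcontfun p))" by (rule contI) simp
    have "compact (I (apply_bcontfun p) ` {0..L})"
      by (intro compact_continuous_image cI compact_Icc)
    then obtain b where b: "\<forall>x\<in>I (apply_bcontfun p) ` {0..L}. norm x \<le> b"
      using compact_imp_bounded bounded_iff by metis
    show ?thesis
    proof (rule bcontfun_normI)
      show "continuous_on UNIV (\<lambda>t. I (apply_bcontfun p) (cl t))"
        by (rule continuous_on_compose2[OF cI cl_cont]) (use cl in auto)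
      show "norm (I (apply_bcontfun p) (cl t)) \<le> b" for t
        using b cl by blast
    qed
  qed
  define T where "T = (\<lambda>p :: real \<Rightarrow>\<^sub>C 'a. Bcontfun (\<lambda>t. I (apply_bcontfun p) (cl t)))"
  have T: "apply_bcontfun (T p) t = I (apply_bcontfun p) (cl t)" for p t
    unfolding T_def by (simp add: Bcontfun_inverse[OF inb])
  have "\<exists>!p. T p = p"
  proof (rule banach_fix_type)
    show "\<forall>p q :: real \<Rightarrow>\<^sub>C 'a. dist (T p) (T q) \<le> 1/2 * dist p q"
    proof (intro allI, rule dist_bound)
      fix p q :: "real \<Rightarrow>\<^sub>C 'a" and t :: real
      let ?s = "cl t"
      let ?F = "\<lambda>(p :: real \<Rightarrow>\<^sub>C 'a) r. f r (exp (M * r) *\<^sub>R apply_bcontfun p r)"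
      have int: "?F p integrable_on {0..?s}" for p
        by (rule integrable_continuous_real, rule continuous_on_subset[OF contfp])
           (use cl[of t] in auto)
      have ei: "((\<lambda>r. K * dist p q * exp (M * r)) has_integral
          K * dist p q * exp (M * ?s) / M - K * dist p q * exp (M * 0) / M) {0..?s}"
        by (rule fundamental_theorem_of_calculus)
           (use cl[of t] M in \<open>auto intro!: derivative_eq_intros
              simp flip: has_real_derivative_iff_has_vector_derivative\<close>)
      have "dist (apply_bcontfun (T p) t) (apply_bcontfun (T q) t)
          = exp (- M * ?s) * norm (integral {0..?s} (\<lambda>r. ?F p r - ?F q r))"
        unfolding T I_def dist_norm
        by (subst integral_diff[OF int int]) (simp flip: scaleR_diff_right)
      also have "norm (integral {0..?s} (\<lambda>r. ?F p r - ?F q r))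
          \<le> integral {0..?s} (\<lambda>r. K * dist p q * exp (M * r))"
      proof (rule integral_norm_bound_integral)
        show "(\<lambda>r. ?F p r - ?F q r) integrable_on {0..?s}"
          by (intro integrable_diff int)
        show "(\<lambda>r. K * dist p q * exp (M * r)) integrable_on {0..?s}"
          using ei by blast
        fix r assume "r \<in> {0..?s}"
        then have "r \<in> {0..L}" using cl[of t] by auto
        then have "norm (?F p r - ?F q r) \<le> K * norm (exp (M * r) *\<^sub>R apply_bcontfun p r - exp (M * r) *\<^sub>R apply_bcontfun q r)"
          by (rule K)
        also have "\<dots> = K * (exp (M * r) * dist (apply_bcontfun p r) (apply_bcontfun q r))"
          by (simp add: dist_norm flip: scaleR_diff_right)
        also have "\<dots> \<le> K * (exp (M * r) * dist p q)"
          by (intro mult_left_mono dist_bounded K) auto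
        finally show "norm (?F p r - ?F q r) \<le> K * dist p q * exp (M * r)"
          by (simp add: mult_ac)
      qed
      also have "\<dots> = K / M * dist p q * (exp (M * ?s) - 1)"
        unfolding integral_unique[OF ei] by (simp add: right_diff_distrib diff_divide_distrib)
      also have "exp (- M * ?s) * \<dots> = K / M * dist p q * (1 - exp (- M * ?s))"
        by (simp add: algebra_simps exp_minus diff_divide_distrib)
      also have "\<dots> \<le> K / M * dist p q * 1"
        using K M by (intro mult_left_mono) auto
      also have "\<dots> \<le> 1/2 * dist p q"
        using mult_right_mono[OF M(2), of "dist p q"] by simp
      finally show "dist (apply_bcontfun (T p) t) (apply_bcontfun (T q) t) \<le> 1/2 * dist p q"
        by (simp add: mult_left_mono)
    qed
  qed auto
  then obtain p where p: "T p = p" by blast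
  define w where "w = (\<lambda>t. exp (M * t) *\<^sub>R apply_bcontfun p t)"
  have w: "w t = c + integral {0..t} (\<lambda>r. f r (w r))" if "t \<in> {0..L}" for t
  proof -
    have "apply_bcontfun p t = I (apply_bcontfun p) t"
      using T[of p t] p cl_id[OF that] by simp
    then show ?thesis by (simp add: w_def I_def exp_minus)
  qed
  have contw: "continuous_on {0..L} w" unfolding w_def by (intro continuous_intros) simp
  show thesis
  proof
    show "w 0 = c" using w[of 0] L by simp
    fix t assume t: "t \<in> {0..L}"
    have "((\<lambda>t. c + integral {0..t} (\<lambda>r. f r (w r))) has_vector_derivative f t (w t)) (at t within {0..L})"
      using integral_has_vector_derivative[OF contf[OF contw] t]
      by (auto intro: derivative_eq_intros)
    then show "(w has_vector_derivative f t (w t)) (at t within {0..L})"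
      by (rule has_vector_derivative_transform[OF t, rotated]) (simp add: w)
  qed
qed

text \<open>
  The function \<open>exp (- (2 K + 1) t) (norm (w t))\<^sup>2 - B\<^sup>2 t\<close> is nonincreasing, because
  \<open>2 w \<bullet> w' \<le> 2 K (norm w)\<^sup>2 + 2 B norm w \<le> (2 K + 1) (norm w)\<^sup>2 + B\<^sup>2\<close>.
\<close>

lemma gronwall_bound:
  fixes w :: "real \<Rightarrow> 'a::real_inner"
  assumes w: "\<And>t. t \<in> {0..L} \<Longrightarrow> (w has_vector_derivative w' t) (at t within {0..L})"
    and b: "\<And>t. t \<in> {0..L} \<Longrightarrow> norm (w' t) \<le> K * norm (w t) + B"
    and t: "t \<in> {0..L}" and K: "0 \<le> K"
  shows "(norm (w t))\<^sup>2 \<le> exp ((2 * K + 1) * t) * ((norm (w 0))\<^sup>2 + B\<^sup>2 * t)"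
proof -
  define m where "m = 2 * K + 1"
  define E where "E = (\<lambda>t. exp (- m * t) * (w t \<bullet> w t) - B\<^sup>2 * t)"
  have dE: "(E has_real_derivative
      exp (- m * x) * (2 * (w x \<bullet> w' x) - m * (w x \<bullet> w x)) - B\<^sup>2) (at x within {0..L})"
    if "x \<in> {0..L}" for x
  proof -
    have "((\<lambda>x. w x \<bullet> w x) has_real_derivative 2 * (w x \<bullet> w' x)) (at x within {0..L})"
      using has_derivative_inner[OF w[OF that, unfolded has_vector_derivative_def] w[OF that, unfolded has_vector_derivative_def]]
      unfolding has_field_derivative_def
      by (rule has_derivative_eq_rhs) (auto simp: fun_eq_iff inner_commute)
    note this [derivative_intros]
    show ?thesis unfolding E_def
      by (auto intro!: derivative_eq_intros simp: algebra_simps)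
  qed
  have neg: "exp (- m * x) * (2 * (w x \<bullet> w' x) - m * (w x \<bullet> w x)) - B\<^sup>2 \<le> 0" if "x \<in> {0..L}" for x
  proof -
    have "2 * (w x \<bullet> w' x) \<le> 2 * (norm (w x) * norm (w' x))"
      using norm_cauchy_schwarz[of "w x" "w' x"] by simp
    also have "\<dots> \<le> 2 * (norm (w x) * (K * norm (w x) + B))"
      using b[OF that] by (intro mult_left_mono) auto
    also have "\<dots> \<le> m * (norm (w x))\<^sup>2 + B\<^sup>2"
      using sum_squares_bound[of "norm (w x)" B] by (simp add: m_def power2_eq_square algebra_simps)
    finally have "2 * (w x \<bullet> w' x) - m * (w x \<bullet> w x) \<le> B\<^sup>2"
      by (simp add: power2_norm_eq_inner)
    then have "exp (- m * x) * (2 * (w x \<bullet> w' x) - m * (w x \<bullet> w x)) \<le> exp (- m * x) * B\<^sup>2"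
      by (intro mult_left_mono) auto
    also have "\<dots> \<le> 1 * B\<^sup>2"
      using that K by (intro mult_right_mono) (auto simp: m_def intro!: mult_nonpos_nonneg)
    finally show ?thesis by simp
  qed
  have "E t \<le> E 0"
  proof (rule DERIV_nonpos_imp_decreasing_open[of 0 t E])
    show "0 \<le> t" using t by simp
    show "continuous_on {0..t} E"
      using continuous_on_subset[OF DERIV_continuous_on[OF dE], of "{0..t}"] t by auto
    fix x assume x: "0 < x" "x < t"
    then have "(E has_real_derivative
      exp (- m * x) * (2 * (w x \<bullet> w' x) - m * (w x \<bullet> w x)) - B\<^sup>2) (at x)"
      using dE[of x] t by (simp add: at_within_Icc_at)
    then show "\<exists>y. DERIV E x :> y \<and> y \<le> 0" using neg[of x] x t by auto
  qed
  then have "exp (- m * t) * (norm (w t))\<^sup>2 \<le> (norm (w 0))\<^sup>2 + B\<^sup>2 * t"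
    by (simp add: E_def power2_norm_eq_inner)
  then have "exp (m * t) * (exp (- m * t) * (norm (w t))\<^sup>2) \<le> exp (m * t) * ((norm (w 0))\<^sup>2 + B\<^sup>2 * t)"
    by (intro mult_left_mono) auto
  then show ?thesis unfolding m_def[symmetric] by (simp add: exp_minus flip: mult.assoc)
qed

lemma gronwall_from_zero:
  fixes w :: "real \<Rightarrow> 'a::real_inner"
  assumes w: "\<And>t. t \<in> {0..L} \<Longrightarrow> (w has_vector_derivative w' t) (at t within {0..L})"
    and b: "\<And>t. t \<in> {0..L} \<Longrightarrow> norm (w' t) \<le> K * norm (w t) + B"
    and t: "t \<in> {0..L}" and K: "0 \<le> K" and B: "0 \<le> B" and "w 0 = 0"
  shows "norm (w t) \<le> sqrt (exp ((2 * K + 1) * L) * L) * B"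
proof -
  have "(norm (w t))\<^sup>2 \<le> exp ((2 * K + 1) * t) * (B\<^sup>2 * t)"
    using gronwall_bound[OF w b t K] \<open>w 0 = 0\<close> by simp
  also have "\<dots> \<le> exp ((2 * K + 1) * L) * (B\<^sup>2 * L)"
    using t K by (intro mult_mono) auto
  finally have "norm (w t) \<le> sqrt (exp ((2 * K + 1) * L) * (B\<^sup>2 * L))"
    by (rule real_le_rsqrt)
  also have "\<dots> = sqrt (exp ((2 * K + 1) * L) * L) * B"
    using B by (simp add: real_sqrt_mult)
  finally show ?thesis .
qed

text \<open>
  The equations \<open>w' = (A t + l B) w + b\<close> on \<open>[0, L]\<close>, with spectral parameter \<open>l\<close>.
\<close>

locale linear_family =
  fixes A :: "real \<Rightarrow> 'a::euclidean_space \<Rightarrow>\<^sub>L 'a" and B :: "'a \<Rightarrow>\<^sub>L 'a" and L :: real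
  assumes length_pos: "0 < L" and A_cont: "continuous_on {0..L} A"
begin

definition solves :: "real \<Rightarrow> (real \<Rightarrow> 'a) \<Rightarrow> (real \<Rightarrow> 'a) \<Rightarrow> bool" where
  "solves l w b \<longleftrightarrow> (\<forall>t\<in>{0..L}.
     (w has_vector_derivative blinfun_apply (A t + l *\<^sub>R B) (w t) + b t) (at t within {0..L}))"

definition lipschitz_param :: "(real \<Rightarrow> real \<Rightarrow> 'a) \<Rightarrow> bool" where
  "lipschitz_param z \<longleftrightarrow> (\<forall>l0. \<exists>C. \<forall>l t. \<bar>l - l0\<bar> \<le> 1 \<longrightarrow> t \<in> {0..L} \<longrightarrow>
     norm (z l t - z l0 t) \<le> C * \<bar>l - l0\<bar>)"

text \<open>
  A quadratic error that is uniform in \<open>t\<close> is asked for, instead of mere differentiability in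
  \<open>l\<close>: an error of this kind in the inhomogeneity turns into an error of the same kind in the
  solution. The same holds for the Lipschitz bound in \<open>lipschitz_param\<close>.
\<close>

definition deriv_param :: "(real \<Rightarrow> real \<Rightarrow> 'a) \<Rightarrow> (real \<Rightarrow> real \<Rightarrow> 'a) \<Rightarrow> bool" where
  "deriv_param z z1 \<longleftrightarrow> (\<forall>l0. \<exists>C. \<forall>l t. \<bar>l - l0\<bar> \<le> 1 \<longrightarrow> t \<in> {0..L} \<longrightarrow>
     norm (z l t - z l0 t - (l - l0) *\<^sub>R z1 l0 t) \<le> C * (l - l0)\<^sup>2)"

lemma A_bound: obtains K where "K \<ge> 0" "\<And>t. t \<in> {0..L} \<Longrightarrow> norm (A t) \<le> K"
proof -
  have "compact (A ` {0..L})" by (intro compact_continuous_image A_cont compact_Icc)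
  then obtain K where "\<forall>x\<in>A ` {0..L}. norm x \<le> K"
    using compact_imp_bounded bounded_iff by metis
  then show thesis using that[of "max 0 K"] by (auto simp: le_max_iff_disj)
qed

lemma solves_continuous: "solves l w b \<Longrightarrow> continuous_on {0..L} w"
  by (rule continuous_on_vector_derivative[of _ _ "\<lambda>t. blinfun_apply (A t + l *\<^sub>R B) (w t) + b t"])
    (simp add: solves_def)

lemma bounded_on_L:
  fixes w :: "real \<Rightarrow> 'b::real_normed_vector"
  assumes "continuous_on {0..L} w"
  obtains C where "C \<ge> 0" "\<And>t. t \<in> {0..L} \<Longrightarrow> norm (w t) \<le> C"
proof -
  have "compact (w ` {0..L})" by (intro compact_continuous_image assms compact_Icc)
  then obtain K where "\<forall>x\<in>w ` {0..L}. norm x \<le> K"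
    using compact_imp_bounded bounded_iff by metis
  then show thesis using that[of "max 0 K"] by (auto simp: le_max_iff_disj)
qed

lemma solution_exists:
  assumes "continuous_on {0..L} b"
  obtains w where "w 0 = c" "solves l w b"
proof -
  obtain K where K: "K \<ge> 0" "\<And>t. t \<in> {0..L} \<Longrightarrow> norm (A t) \<le> K" by (rule A_bound) blast
  show thesis
  proof (rule lipschitz_ode_exists[of L "\<lambda>t x. blinfun_apply (A t + l *\<^sub>R B) x + b t" "K + \<bar>l\<bar> * norm B" c])
    have "continuous_on ({0..L} \<times> UNIV) (\<lambda>p. A (fst p))" "continuous_on ({0..L} \<times> (UNIV :: 'a set)) (\<lambda>p. b (fst p))"
      by (rule continuous_on_compose2[OF A_cont continuous_on_fst[OF continuous_on_id]]
          continuous_on_compose2[OF assms continuous_on_fst[OF continuous_on_id]]; auto)+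
    then show "continuous_on ({0..L} \<times> UNIV) (\<lambda>(t, x). blinfun_apply (A t + l *\<^sub>R B) x + b t)"
      unfolding case_prod_unfold by (intro continuous_intros)
    fix t x y assume t: "t \<in> {0..L}"
    have "norm (blinfun_apply (A t + l *\<^sub>R B) (x - y)) \<le> norm (A t + l *\<^sub>R B) * norm (x - y)"
      by (rule norm_blinfun)
    also have "\<dots> \<le> (K + \<bar>l\<bar> * norm B) * norm (x - y)"
      using norm_triangle_ineq[of "A t" "l *\<^sub>R B"] K(2)[OF t] by (intro mult_right_mono) auto
    finally show "norm (blinfun_apply (A t + l *\<^sub>R B) x + b t - (blinfun_apply (A t + l *\<^sub>R B) y + b t))
      \<le> (K + \<bar>l\<bar> * norm B) * norm (x - y)" by (simp add: blinfun.diff_right)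
  qed (use length_pos K that in \<open>auto simp: solves_def\<close>)
qed

text \<open>
  The constant is uniform for \<open>l\<close> in a neighbourhood of \<open>l0\<close>, so that differences of solutions
  for two parameters can be estimated by the equation that they satisfy.
\<close>

lemma solution_bound:
  obtains C where "C \<ge> 0" "\<And>l w b \<beta> t. \<lbrakk>\<bar>l - l0\<bar> \<le> 1; solves l w b; w 0 = 0; 0 \<le> \<beta>;
    \<And>t. t \<in> {0..L} \<Longrightarrow> norm (b t) \<le> \<beta>; t \<in> {0..L}\<rbrakk> \<Longrightarrow> norm (w t) \<le> C * \<beta>"
proof -
  obtain K where K: "K \<ge> 0" "\<And>t. t \<in> {0..L} \<Longrightarrow> norm (A t) \<le> K" by (rule A_bound) blast
  define K' where "K' = K + (\<bar>l0\<bar> + 1) * norm B"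
  have K': "K' \<ge> 0" using K by (simp add: K'_def)
  show thesis
  proof (rule that)
    show "0 \<le> sqrt (exp ((2 * K' + 1) * L) * L)" using length_pos by simp
    fix l w b \<beta> t
    assume l: "\<bar>l - l0\<bar> \<le> 1" and w: "solves l w b" "w 0 = 0" and \<beta>: "0 \<le> \<beta>"
      "\<And>t. t \<in> {0..L} \<Longrightarrow> norm (b t) \<le> \<beta>" and t: "t \<in> {0..L}"
    show "norm (w t) \<le> sqrt (exp ((2 * K' + 1) * L) * L) * \<beta>"
    proof (rule gronwall_from_zero)
      fix t assume t: "t \<in> {0..L}"
      show "(w has_vector_derivative blinfun_apply (A t + l *\<^sub>R B) (w t) + b t) (at t within {0..L})"
        using w t by (simp add: solves_def)
      have "norm (A t + l *\<^sub>R B) \<le> K'"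
      proof -
        have "norm (A t + l *\<^sub>R B) \<le> norm (A t) + \<bar>l\<bar> * norm B"
          using norm_triangle_ineq[of "A t" "l *\<^sub>R B"] by simp
        also have "\<dots> \<le> K + (\<bar>l0\<bar> + 1) * norm B"
          using K(2)[OF t] l by (intro add_mono mult_right_mono) auto
        finally show ?thesis by (simp add: K'_def)
      qed
      then have "norm (blinfun_apply (A t + l *\<^sub>R B) (w t)) \<le> K' * norm (w t)"
        by (meson mult_right_mono norm_blinfun norm_ge_zero order_trans)
      then show "norm (blinfun_apply (A t + l *\<^sub>R B) (w t) + b t) \<le> K' * norm (w t) + \<beta>"
        using \<beta>(2)[OF t] norm_triangle_ineq[of "blinfun_apply (A t + l *\<^sub>R B) (w t)" "b t"] by linarith
    qed (use t K' \<beta> w in auto)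
  qed
qed

lemma solution_unique:
  assumes "solves l w b" "solves l w2 b" "w 0 = w2 0" "t \<in> {0..L}"
  shows "w t = w2 t"
proof -
  obtain C where C: "\<And>l' w b \<beta> t. \<lbrakk>\<bar>l' - l\<bar> \<le> 1; solves l' w b; w 0 = 0; 0 \<le> \<beta>;
    \<And>t. t \<in> {0..L} \<Longrightarrow> norm (b t) \<le> \<beta>; t \<in> {0..L}\<rbrakk> \<Longrightarrow> norm (w t) \<le> C * \<beta>"
    using solution_bound[of l] by metis
  have "solves l (\<lambda>t. w t - w2 t) (\<lambda>t. 0)"
    unfolding solves_def
  proof
    fix t assume t: "t \<in> {0..L}"
    from has_vector_derivative_diff[OF assms(1)[unfolded solves_def, rule_format, OF t] assms(2)[unfolded solves_def, rule_format, OF t]]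
    show "((\<lambda>t. w t - w2 t) has_vector_derivative blinfun_apply (A t + l *\<^sub>R B) (w t - w2 t) + 0) (at t within {0..L})"
      by (simp add: blinfun.diff_right)
  qed
  from C[OF _ this, of 0 t] assms show ?thesis by simp
qed

lemma lipschitz_param_solution:
  assumes z: "\<And>l. solves l (z l) (b l)" "\<And>l. z l 0 = c" and b: "lipschitz_param b"
  shows "lipschitz_param z"
  unfolding lipschitz_param_def
proof
  fix l0
  obtain C where C: "C \<ge> 0" "\<And>l w b \<beta> t. \<lbrakk>\<bar>l - l0\<bar> \<le> 1; solves l w b; w 0 = 0; 0 \<le> \<beta>;
    \<And>t. t \<in> {0..L} \<Longrightarrow> norm (b t) \<le> \<beta>; t \<in> {0..L}\<rbrakk> \<Longrightarrow> norm (w t) \<le> C * \<beta>"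
    using solution_bound[of l0] by metis
  obtain Z where Z: "Z \<ge> 0" "\<And>t. t \<in> {0..L} \<Longrightarrow> norm (z l0 t) \<le> Z"
    using bounded_on_L[OF solves_continuous[OF z(1)[of l0]]] by metis
  obtain D0 where D0: "\<And>l t. \<bar>l - l0\<bar> \<le> 1 \<Longrightarrow> t \<in> {0..L} \<Longrightarrow> norm (b l t - b l0 t) \<le> D0 * \<bar>l - l0\<bar>"
    using b unfolding lipschitz_param_def by metis
  define D where "D = max 0 D0"
  have D: "D \<ge> 0" "norm (b l t - b l0 t) \<le> D * \<bar>l - l0\<bar>" if "\<bar>l - l0\<bar> \<le> 1" "t \<in> {0..L}" for l t
    using D0[OF that] mult_right_mono[of D0 "max 0 D0" "\<bar>l - l0\<bar>"] by (auto simp: D_def)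
  have "norm (z l t - z l0 t) \<le> C * (norm B * Z + D) * \<bar>l - l0\<bar>" if l: "\<bar>l - l0\<bar> \<le> 1" and t: "t \<in> {0..L}" for l t
  proof -
    let ?b = "\<lambda>t. (l - l0) *\<^sub>R blinfun_apply B (z l0 t) + (b l t - b l0 t)"
    have "solves l (\<lambda>t. z l t - z l0 t) ?b"
      unfolding solves_def
    proof
      fix t assume t: "t \<in> {0..L}"
      from has_vector_derivative_diff[OF z(1)[unfolded solves_def, rule_format, OF t] z(1)[unfolded solves_def, rule_format, OF t], of l l0]
      show "((\<lambda>t. z l t - z l0 t) has_vector_derivative blinfun_apply (A t + l *\<^sub>R B) (z l t - z l0 t) + ?b t) (at t within {0..L})"
        by (simp add: blinfun.diff_right blinfun.add_left blinfun.scaleR_left algebra_simps)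
    qed
    moreover have "norm (?b t) \<le> (norm B * Z + D) * \<bar>l - l0\<bar>" if t: "t \<in> {0..L}" for t
    proof -
      have "norm (blinfun_apply B (z l0 t)) \<le> norm B * Z"
        by (meson Z(2) mult_left_mono norm_blinfun norm_ge_zero order_trans t)
      then have "norm ((l - l0) *\<^sub>R blinfun_apply B (z l0 t)) \<le> (norm B * Z) * \<bar>l - l0\<bar>"
        by (simp add: mult.commute mult_left_mono)
      then show ?thesis using D(2)[OF l t] norm_triangle_ineq[of "(l - l0) *\<^sub>R blinfun_apply B (z l0 t)" "b l t - b l0 t"]
        by (simp add: algebra_simps)
    qed
    ultimately have "norm (z l t - z l0 t) \<le> C * ((norm B * Z + D) * \<bar>l - l0\<bar>)"
      using Z(1) D(1)[OF l t] by (intro C(2)[OF l]) (use t in \<open>auto simp: z(2)\<close>)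
    then show ?thesis by (simp add: mult.assoc)
  qed
  then show "\<exists>C. \<forall>l t. \<bar>l - l0\<bar> \<le> 1 \<longrightarrow> t \<in> {0..L} \<longrightarrow> norm (z l t - z l0 t) \<le> C * \<bar>l - l0\<bar>"
    by blast
qed

text \<open>
  Differentiating the equation in \<open>l\<close> leads to the equation for \<open>z1\<close>. The remainder
  \<open>z l - z l0 - (l - l0) z1 l0\<close> solves the equation at \<open>l0\<close> with an inhomogeneity that is
  quadratic in \<open>l - l0\<close>.
\<close>

lemma deriv_param_solution:
  assumes z: "\<And>l. solves l (z l) (b l)" "\<And>l. z l 0 = c" and b: "lipschitz_param b" "deriv_param b b1"
    and z1: "\<And>l. solves l (z1 l) (\<lambda>t. b1 l t + blinfun_apply B (z l t))" "\<And>l. z1 l 0 = 0"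
  shows "deriv_param z z1"
  unfolding deriv_param_def
proof
  fix l0
  obtain C where C: "C \<ge> 0" "\<And>l w b \<beta> t. \<lbrakk>\<bar>l - l0\<bar> \<le> 1; solves l w b; w 0 = 0; 0 \<le> \<beta>;
    \<And>t. t \<in> {0..L} \<Longrightarrow> norm (b t) \<le> \<beta>; t \<in> {0..L}\<rbrakk> \<Longrightarrow> norm (w t) \<le> C * \<beta>"
    using solution_bound[of l0] by metis
  have "lipschitz_param z" by (rule lipschitz_param_solution[OF z b(1)])
  then obtain Z0 where Z0: "\<And>l t. \<bar>l - l0\<bar> \<le> 1 \<Longrightarrow> t \<in> {0..L} \<Longrightarrow> norm (z l t - z l0 t) \<le> Z0 * \<bar>l - l0\<bar>"
    unfolding lipschitz_param_def by metis
  define Z where "Z = max 0 Z0"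
  have Z: "Z \<ge> 0" "norm (z l t - z l0 t) \<le> Z * \<bar>l - l0\<bar>" if "\<bar>l - l0\<bar> \<le> 1" "t \<in> {0..L}" for l t
    using Z0[OF that] mult_right_mono[of Z0 "max 0 Z0" "\<bar>l - l0\<bar>"] by (auto simp: Z_def)
  obtain D0 where D0: "\<And>l t. \<bar>l - l0\<bar> \<le> 1 \<Longrightarrow> t \<in> {0..L} \<Longrightarrow> norm (b l t - b l0 t - (l - l0) *\<^sub>R b1 l0 t) \<le> D0 * (l - l0)\<^sup>2"
    using b(2) unfolding deriv_param_def by metis
  define D where "D = max 0 D0"
  have D: "D \<ge> 0" "norm (b l t - b l0 t - (l - l0) *\<^sub>R b1 l0 t) \<le> D * (l - l0)\<^sup>2" if "\<bar>l - l0\<bar> \<le> 1" "t \<in> {0..L}" for l t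
    using D0[OF that] mult_right_mono[of D0 "max 0 D0" "(l - l0)\<^sup>2"] by (auto simp: D_def)
  have "norm (z l t - z l0 t - (l - l0) *\<^sub>R z1 l0 t) \<le> C * (norm B * Z + D) * (l - l0)\<^sup>2"
    if l: "\<bar>l - l0\<bar> \<le> 1" and t: "t \<in> {0..L}" for l t
  proof -
    let ?w = "\<lambda>t. z l t - z l0 t - (l - l0) *\<^sub>R z1 l0 t"
    let ?b = "\<lambda>t. (l - l0) *\<^sub>R blinfun_apply B (z l t - z l0 t) + (b l t - b l0 t - (l - l0) *\<^sub>R b1 l0 t)"
    have "solves l0 ?w ?b"
      unfolding solves_def
    proof
      fix t assume t: "t \<in> {0..L}"
      from has_vector_derivative_diff[OF has_vector_derivative_diff[OF z(1)[unfolded solves_def, rule_format, OF t] z(1)[unfolded solves_def, rule_format, OF t], of l l0]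
         has_vector_derivative_scaleR[OF DERIV_const z1(1)[unfolded solves_def, rule_format, OF t]], of "l - l0" l0]
      show "(?w has_vector_derivative blinfun_apply (A t + l0 *\<^sub>R B) (?w t) + ?b t) (at t within {0..L})"
        by (rule has_vector_derivative_eq_rhs) (simp add: blinfun.diff_right blinfun.add_right blinfun.scaleR_right blinfun.add_left blinfun.scaleR_left algebra_simps)
    qed
    moreover have "norm (?b t) \<le> (norm B * Z + D) * (l - l0)\<^sup>2" if t: "t \<in> {0..L}" for t
    proof -
      have "norm (blinfun_apply B (z l t - z l0 t)) \<le> norm B * (Z * \<bar>l - l0\<bar>)"
        by (meson Z(2) l mult_left_mono norm_blinfun norm_ge_zero order_trans t)
      then have "\<bar>l - l0\<bar> * norm (blinfun_apply B (z l t - z l0 t)) \<le> \<bar>l - l0\<bar> * (norm B * (Z * \<bar>l - l0\<bar>))"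
        by (intro mult_left_mono) auto
      then have "norm ((l - l0) *\<^sub>R blinfun_apply B (z l t - z l0 t)) \<le> (norm B * Z) * (l - l0)\<^sup>2"
        by (simp add: power2_eq_square mult_ac flip: abs_mult)
      then show ?thesis using D(2)[OF l t] norm_triangle_ineq[of "(l - l0) *\<^sub>R blinfun_apply B (z l t - z l0 t)" "b l t - b l0 t - (l - l0) *\<^sub>R b1 l0 t"]
        by (simp add: algebra_simps)
    qed
    ultimately have "norm (?w t) \<le> C * ((norm B * Z + D) * (l - l0)\<^sup>2)"
      using Z(1) D(1) l by (intro C(2)[of l0 ?w ?b]) (use t in \<open>auto simp: z(2) z1(2)\<close>)
    then show ?thesis by (simp add: mult.assoc)
  qed
  then show "\<exists>C. \<forall>l t. \<bar>l - l0\<bar> \<le> 1 \<longrightarrow> t \<in> {0..L} \<longrightarrow>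
     norm (z l t - z l0 t - (l - l0) *\<^sub>R z1 l0 t) \<le> C * (l - l0)\<^sup>2"
    by blast
qed

lemma lipschitz_param_blinfun:
  assumes "lipschitz_param z" shows "lipschitz_param (\<lambda>l t. blinfun_apply T (z l t))"
  unfolding lipschitz_param_def
proof
  fix l0
  obtain C where C: "\<And>l t. \<bar>l - l0\<bar> \<le> 1 \<Longrightarrow> t \<in> {0..L} \<Longrightarrow> norm (z l t - z l0 t) \<le> C * \<bar>l - l0\<bar>"
    using assms unfolding lipschitz_param_def by metis
  have "norm (blinfun_apply T (z l t) - blinfun_apply T (z l0 t)) \<le> norm T * C * \<bar>l - l0\<bar>"
    if "\<bar>l - l0\<bar> \<le> 1" "t \<in> {0..L}" for l t
    using norm_blinfun[of T "z l t - z l0 t"] mult_left_mono[OF C[OF that], of "norm T"]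
    by (simp add: blinfun.diff_right)
  then show "\<exists>C. \<forall>l t. \<bar>l - l0\<bar> \<le> 1 \<longrightarrow> t \<in> {0..L} \<longrightarrow>
      norm (blinfun_apply T (z l t) - blinfun_apply T (z l0 t)) \<le> C * \<bar>l - l0\<bar>" by blast
qed

lemma deriv_param_blinfun:
  assumes "deriv_param z z1" shows "deriv_param (\<lambda>l t. blinfun_apply T (z l t)) (\<lambda>l t. blinfun_apply T (z1 l t))"
  unfolding deriv_param_def
proof
  fix l0
  obtain C where C: "\<And>l t. \<bar>l - l0\<bar> \<le> 1 \<Longrightarrow> t \<in> {0..L} \<Longrightarrow> norm (z l t - z l0 t - (l - l0) *\<^sub>R z1 l0 t) \<le> C * (l - l0)\<^sup>2"
    using assms unfolding deriv_param_def by metis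
  have "norm (blinfun_apply T (z l t) - blinfun_apply T (z l0 t) - (l - l0) *\<^sub>R blinfun_apply T (z1 l0 t)) \<le> norm T * C * (l - l0)\<^sup>2"
    if "\<bar>l - l0\<bar> \<le> 1" "t \<in> {0..L}" for l t
    using norm_blinfun[of T "z l t - z l0 t - (l - l0) *\<^sub>R z1 l0 t"] mult_left_mono[OF C[OF that], of "norm T"]
    by (simp add: blinfun.diff_right blinfun.scaleR_right)
  then show "\<exists>C. \<forall>l t. \<bar>l - l0\<bar> \<le> 1 \<longrightarrow> t \<in> {0..L} \<longrightarrow>
      norm (blinfun_apply T (z l t) - blinfun_apply T (z l0 t) - (l - l0) *\<^sub>R blinfun_apply T (z1 l0 t)) \<le> C * (l - l0)\<^sup>2" by blast
qed

text \<open>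
  Each derivative in \<open>l\<close> solves the same equation, with an inhomogeneity made of the previous
  one: \<open>B z\<close> for the first and, since \<open>(l B z)'' = l B z'' + 2 B z'\<close>, \<open>2 B z1\<close> for the second.
\<close>

lemma solution_family:
  obtains z z1 z2 where "\<And>l. solves l (z l) (\<lambda>t. 0)" "\<And>l. z l 0 = c"
    "\<And>l. solves l (z1 l) (\<lambda>t. blinfun_apply B (z l t))" "\<And>l. z1 l 0 = 0"
    "\<And>l. solves l (z2 l) (\<lambda>t. 2 *\<^sub>R blinfun_apply B (z1 l t))" "\<And>l. z2 l 0 = 0"
    "deriv_param z z1" "deriv_param z1 z2" "lipschitz_param z" "lipschitz_param z1" "lipschitz_param z2"
proof -
  have Bc: "continuous_on {0..L} (\<lambda>t. blinfun_apply B (w t))" if "continuous_on {0..L} w" for w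
    using that by (intro continuous_intros)
  have ex: "\<exists>w. w 0 = x \<and> solves l w b" if "continuous_on {0..L} b" for l x b
    by (rule solution_exists[OF that, of x l]) blast
  obtain z where z: "\<And>l. solves l (z l) (\<lambda>t. 0)" "\<And>l. z l 0 = c"
    using ex[OF continuous_on_const, of c _ 0] by metis
  have "\<exists>w. w 0 = 0 \<and> solves l w (\<lambda>t. blinfun_apply B (z l t))" for l
    by (rule ex[OF Bc[OF solves_continuous[OF z(1)]]])
  then obtain z1 where z1: "\<And>l. solves l (z1 l) (\<lambda>t. blinfun_apply B (z l t))" "\<And>l. z1 l 0 = 0"
    by metis
  have "\<exists>w. w 0 = 0 \<and> solves l w (\<lambda>t. 2 *\<^sub>R blinfun_apply B (z1 l t))" for l
    by (rule ex[OF continuous_on_scaleR[OF continuous_on_const Bc[OF solves_continuous[OF z1(1)]]]])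
  then obtain z2 where z2: "\<And>l. solves l (z2 l) (\<lambda>t. 2 *\<^sub>R blinfun_apply B (z1 l t))" "\<And>l. z2 l 0 = 0"
    by metis
  have zero: "lipschitz_param (\<lambda>l t. 0)" "deriv_param (\<lambda>l t. 0) (\<lambda>l t. 0)"
    by (auto simp: lipschitz_param_def deriv_param_def intro!: exI[of _ 0])
  have l: "lipschitz_param z" by (rule lipschitz_param_solution[OF z zero(1)])
  have d: "deriv_param z z1" by (rule deriv_param_solution[where b = "\<lambda>l t. 0" and ?b1.0 = "\<lambda>l t. 0" and c = c])
      (use z z1 zero in simp_all)
  have l1: "lipschitz_param z1"
    by (rule lipschitz_param_solution[OF z1 lipschitz_param_blinfun[OF l]])
  have d1: "deriv_param z1 z2"
    by (rule deriv_param_solution[where b = "\<lambda>l t. blinfun_apply B (z l t)" and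
          ?b1.0 = "\<lambda>l t. blinfun_apply B (z1 l t)" and c = 0])
      (use z1 z2 lipschitz_param_blinfun[OF l] deriv_param_blinfun[OF d] in \<open>simp_all add: scaleR_2\<close>)
  have l2': "lipschitz_param (\<lambda>l t. 2 *\<^sub>R blinfun_apply B (z1 l t))"
    using lipschitz_param_blinfun[OF l1, of "2 *\<^sub>R B"] by (simp add: blinfun.scaleR_left)
  have l2: "lipschitz_param z2" by (rule lipschitz_param_solution[OF z2 l2'])
  show thesis by (rule that[OF z z1 z2 d d1 l l1 l2])
qed

lemma has_derivative_param:
  assumes z: "deriv_param z z1" and z1: "continuous_on {0..L} (z1 l0)" and t0: "t0 \<in> {0<..<L}"
    and zt: "(z l0 has_vector_derivative zt) (at t0 within {0..L})"
  shows "((\<lambda>p. z (fst p) (snd p)) has_derivative (\<lambda>d. fst d *\<^sub>R z1 l0 t0 + snd d *\<^sub>R zt)) (at (l0, t0))"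
  unfolding has_derivative_at_alt
proof (intro conjI allI impI)
  show "bounded_linear (\<lambda>d. fst d *\<^sub>R z1 l0 t0 + snd d *\<^sub>R zt)"
    by (intro bounded_linear_intros)
  fix e :: real assume "e > 0"
  then have e: "e / 3 > 0" by simp
  obtain C0 where C0: "\<And>l t. \<bar>l - l0\<bar> \<le> 1 \<Longrightarrow> t \<in> {0..L} \<Longrightarrow>
      norm (z l t - z l0 t - (l - l0) *\<^sub>R z1 l0 t) \<le> C0 * (l - l0)\<^sup>2"
    using z unfolding deriv_param_def by metis
  define C where "C = max 0 C0"
  have C: "C \<ge> 0" "norm (z l t - z l0 t - (l - l0) *\<^sub>R z1 l0 t) \<le> C * (l - l0)\<^sup>2"
    if "\<bar>l - l0\<bar> \<le> 1" "t \<in> {0..L}" for l t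
    using C0[OF that] mult_right_mono[of C0 "max 0 C0" "(l - l0)\<^sup>2"] by (auto simp: C_def)
  obtain d2 where d2: "d2 > 0" "\<And>t. t \<in> {0..L} \<Longrightarrow> \<bar>t - t0\<bar> < d2 \<Longrightarrow> norm (z1 l0 t - z1 l0 t0) < e / 3"
    using z1 t0 e unfolding continuous_on_iff dist_norm
    by (metis greaterThanLessThan_iff atLeastAtMost_iff less_imp_le real_norm_def)
  obtain d3 where d3: "d3 > 0" "\<And>t. t \<in> {0..L} \<Longrightarrow> \<bar>t - t0\<bar> < d3 \<Longrightarrow>
      norm (z l0 t - z l0 t0 - (t - t0) *\<^sub>R zt) \<le> e / 3 * \<bar>t - t0\<bar>"
    using zt e unfolding has_vector_derivative_def has_derivative_within_alt
    by (fold real_norm_def) blast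
  define d where "d = Min {1, e / (3 * (C + 1)), d2, d3, t0, L - t0}"
  have C_nonneg: "C \<ge> 0" by (simp add: C_def)
  have d: "d > 0" "d \<le> 1" "d \<le> e / (3 * (C + 1))" "d \<le> d2" "d \<le> d3" "d \<le> t0" "d \<le> L - t0"
    using d2 d3 t0 C_nonneg \<open>e > 0\<close> by (auto simp: d_def)
  show "\<exists>d>0. \<forall>y. norm (y - (l0, t0)) < d \<longrightarrow>
      norm (z (fst y) (snd y) - z (fst (l0, t0)) (snd (l0, t0))
        - (fst (y - (l0, t0)) *\<^sub>R z1 l0 t0 + snd (y - (l0, t0)) *\<^sub>R zt)) \<le> e * norm (y - (l0, t0))"
  proof (intro exI[of _ d] conjI d(1) allI impI)
    fix y :: "real \<times> real" assume y: "norm (y - (l0, t0)) < d"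
    define l t where "l = fst y" and "t = snd y"
    define n where "n = norm (y - (l0, t0))"
    have n: "\<bar>l - l0\<bar> \<le> n" "\<bar>t - t0\<bar> \<le> n" "n < d"
      using norm_fst_le[of "fst (y - (l0, t0))" "snd (y - (l0, t0))"]
        norm_snd_le[of "snd (y - (l0, t0))" "fst (y - (l0, t0))"] y
      by (cases y; simp add: l_def t_def n_def)+
    have l1: "\<bar>l - l0\<bar> \<le> 1" and tL: "t \<in> {0..L}" using n d by auto
    have "norm (z l t - z l0 t - (l - l0) *\<^sub>R z1 l0 t) \<le> C * (l - l0)\<^sup>2" by (rule C(2)[OF l1 tL])
    also have "\<dots> = (C * \<bar>l - l0\<bar>) * \<bar>l - l0\<bar>" by (simp add: power2_eq_square)
    also have "\<dots> \<le> (C * (e / (3 * (C + 1)))) * n"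
      using n d C_nonneg \<open>e > 0\<close> by (intro mult_mono) auto
    also have "\<dots> \<le> e / 3 * n"
      using C_nonneg \<open>e > 0\<close> n by (intro mult_right_mono) (auto simp: field_simps)
    finally have 1: "norm (z l t - z l0 t - (l - l0) *\<^sub>R z1 l0 t) \<le> e / 3 * n" .
    have "norm ((l - l0) *\<^sub>R (z1 l0 t - z1 l0 t0)) \<le> n * (e / 3)"
      unfolding norm_scaleR using d2(2)[OF tL] n d by (intro mult_mono) auto
    then have 2: "norm ((l - l0) *\<^sub>R (z1 l0 t - z1 l0 t0)) \<le> e / 3 * n" by (simp add: mult.commute)
    have "norm (z l0 t - z l0 t0 - (t - t0) *\<^sub>R zt) \<le> e / 3 * \<bar>t - t0\<bar>"
      using d3(2)[OF tL] n d by auto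
    also have "\<dots> \<le> e / 3 * n" using n e by (intro mult_left_mono) auto
    finally have 3: "norm (z l0 t - z l0 t0 - (t - t0) *\<^sub>R zt) \<le> e / 3 * n" .
    have "z l t - z l0 t0 - ((l - l0) *\<^sub>R z1 l0 t0 + (t - t0) *\<^sub>R zt)
      = (z l t - z l0 t - (l - l0) *\<^sub>R z1 l0 t) + (l - l0) *\<^sub>R (z1 l0 t - z1 l0 t0)
        + (z l0 t - z l0 t0 - (t - t0) *\<^sub>R zt)"
      by (simp add: algebra_simps)
    then have "norm (z l t - z l0 t0 - ((l - l0) *\<^sub>R z1 l0 t0 + (t - t0) *\<^sub>R zt))
      \<le> e / 3 * n + e / 3 * n + e / 3 * n"
      using 1 2 3 by (metis norm_triangle_mono)
    then show "norm (z (fst y) (snd y) - z (fst (l0, t0)) (snd (l0, t0))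
        - (fst (y - (l0, t0)) *\<^sub>R z1 l0 t0 + snd (y - (l0, t0)) *\<^sub>R zt)) \<le> e * norm (y - (l0, t0))"
      by (simp add: l_def t_def n_def)
  qed
qed

lemma continuous_on_param:
  assumes z: "lipschitz_param z" "\<And>l. continuous_on {0..L} (z l)"
  shows "continuous_on (UNIV \<times> {0..L}) (\<lambda>p. z (fst p) (snd p))"
  unfolding continuous_on_def
proof
  fix q :: "real \<times> real" assume "q \<in> UNIV \<times> {0..L}"
  then obtain l0 t0 where q: "q = (l0, t0)" and t0: "t0 \<in> {0..L}" by auto
  let ?F = "at q within UNIV \<times> {0..L}"
  obtain C where C: "\<And>l t. \<bar>l - l0\<bar> \<le> 1 \<Longrightarrow> t \<in> {0..L} \<Longrightarrow> norm (z l t - z l0 t) \<le> C * \<bar>l - l0\<bar>"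
    using z(1) unfolding lipschitz_param_def by metis
  have fst_lim: "((\<lambda>p. \<bar>fst p - l0\<bar>) \<longlongrightarrow> \<bar>l0 - l0\<bar>) ?F"
    unfolding q by (auto intro!: tendsto_eq_intros)
  have "((\<lambda>p. z (fst p) (snd p) - z l0 (snd p)) \<longlongrightarrow> 0) ?F"
  proof (rule Lim_null_comparison)
    have "\<forall>\<^sub>F p in ?F. \<bar>fst p - l0\<bar> < 1"
      using order_tendstoD(2)[OF fst_lim, of 1] by simp
    moreover have "\<forall>\<^sub>F p in ?F. p \<in> UNIV \<times> {0..L}" by (simp add: eventually_at_topological) blast
    ultimately show "\<forall>\<^sub>F p in ?F. norm (z (fst p) (snd p) - z l0 (snd p)) \<le> C * \<bar>fst p - l0\<bar>"
      by eventually_elim (auto intro!: C)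
    show "((\<lambda>p. C * \<bar>fst p - l0\<bar>) \<longlongrightarrow> 0) ?F"
      using tendsto_mult[OF tendsto_const fst_lim, of C] by simp
  qed
  moreover have "continuous_on (UNIV \<times> {0..L}) (\<lambda>p :: real \<times> real. z l0 (snd p))"
    by (rule continuous_on_compose2[OF z(2)[of l0] continuous_on_snd[OF continuous_on_id]]) auto
  then have "((\<lambda>p. z l0 (snd p)) \<longlongrightarrow> z l0 (snd q)) ?F"
    using \<open>q \<in> UNIV \<times> {0..L}\<close> unfolding continuous_on_def by blast
  ultimately have "((\<lambda>p. (z (fst p) (snd p) - z l0 (snd p)) + z l0 (snd p)) \<longlongrightarrow> 0 + z l0 (snd q)) ?F"
    by (rule tendsto_add)
  then show "((\<lambda>p. z (fst p) (snd p)) \<longlongrightarrow> z (fst q) (snd q)) ?F" by (simp add: q)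
qed

end

section \<open>Smooth functions and bumps\<close>

text \<open>
  Smoothness in the form in which test functions require it is a statement about iterated
  derivatives. This recursion takes off the innermost derivative, as the product rule needs.
\<close>

primrec ndiff :: "nat \<Rightarrow> (real \<Rightarrow> real) \<Rightarrow> bool" where
  "ndiff 0 f \<longleftrightarrow> True"
| "ndiff (Suc n) f \<longleftrightarrow> (\<forall>x. f field_differentiable at x) \<and> ndiff n (deriv f)"

definition smooth :: "(real \<Rightarrow> real) \<Rightarrow> bool" where
  "smooth f \<longleftrightarrow> (\<forall>n. ndiff n f)"

lemma ndiff_Suc_D: "ndiff (Suc n) f \<Longrightarrow> ndiff n f"
  by (induction n arbitrary: f) auto

lemma ndiff_iff: "ndiff n f \<longleftrightarrow> (\<forall>k<n. \<forall>x. (deriv ^^ k) f field_differentiable at x)"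
proof (induction n arbitrary: f)
  case (Suc n)
  show ?case
    by (simp add: Suc All_less_Suc2 funpow_Suc_right del: funpow.simps(2))
qed simp

lemma smooth_iff: "smooth f \<longleftrightarrow> (\<forall>n x. (deriv ^^ n) f field_differentiable at x)"
  unfolding smooth_def ndiff_iff by blast

lemma smooth_differentiable: "smooth f \<Longrightarrow> f field_differentiable at x"
  unfolding smooth_iff using funpow_0 by metis

lemma smooth_has_deriv: "smooth f \<Longrightarrow> (f has_real_derivative deriv f x) (at x)"
  using smooth_differentiable field_differentiable_derivI by blast

lemma smooth_deriv: "smooth f \<Longrightarrow> smooth (deriv f)"
  unfolding smooth_def by (metis ndiff.simps(2))

lemma smooth_continuous_on: "smooth f \<Longrightarrow> continuous_on S f"
  by (meson smooth_has_deriv DERIV_isCont continuous_at_imp_continuous_on)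

lemma smooth_antideriv:
  assumes "\<And>x. (F has_real_derivative f x) (at x)" "smooth f"
  shows "smooth F"
proof -
  have "deriv F = f" using assms(1) by (auto intro: DERIV_imp_deriv)
  moreover have "F field_differentiable at x" for x
    using assms(1) field_differentiable_def by blast
  ultimately have "ndiff n F" for n
    using assms(2) by (cases n) (auto simp: smooth_def)
  then show ?thesis by (simp add: smooth_def)
qed

text \<open>
  A coinduction principle: it suffices to find a class of functions that contains \<open>f\<close> and is
  closed under differentiation.
\<close>

lemma deriv_family:
  assumes "\<And>f. f \<in> F \<Longrightarrow> \<exists>f'\<in>F. \<forall>x. (f has_real_derivative f' x) (at x)" "f \<in> F"
  shows "smooth f"
proof -
  have "ndiff n f" if "f \<in> F" for n f
    using that
  proof (induction n arbitrary: f)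
    case (Suc n)
    obtain f' where f': "f' \<in> F" "\<And>x. (f has_real_derivative f' x) (at x)"
      using assms(1)[OF Suc.prems] by blast
    then have "deriv f = f'" by (auto intro: DERIV_imp_deriv)
    then show ?case using f' Suc.IH by (auto simp: field_differentiable_def)
  qed simp
  then show ?thesis using assms(2) by (simp add: smooth_def)
qed

lemma smooth_const: "smooth (\<lambda>x. c)"
  by (rule deriv_family[of "range (\<lambda>c x. c)"]) (auto intro!: exI[of _ 0] derivative_eq_intros)

lemma smooth_affine: "smooth (\<lambda>x. a * x + b)"
  by (rule smooth_antideriv[OF _ smooth_const[of a]]) (auto intro!: derivative_eq_intros)

lemma ndiff_add: "ndiff n f \<Longrightarrow> ndiff n g \<Longrightarrow> ndiff n (\<lambda>x. f x + g x)"
proof (induction n arbitrary: f g)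
  case (Suc n)
  have "deriv (\<lambda>x. f x + g x) = (\<lambda>x. deriv f x + deriv g x)"
    using Suc.prems by (auto simp: fun_eq_iff)
  then show ?case using Suc by (auto intro: field_differentiable_add)
qed simp

lemma ndiff_mult: "ndiff n f \<Longrightarrow> ndiff n g \<Longrightarrow> ndiff n (\<lambda>x. f x * g x)"
proof (induction n arbitrary: f g)
  case (Suc n)
  have "deriv (\<lambda>x. f x * g x) = (\<lambda>x. f x * deriv g x + deriv f x * g x)"
    using Suc.prems by (auto simp: fun_eq_iff)
  moreover have "ndiff n f" "ndiff n g" using Suc.prems by (auto intro: ndiff_Suc_D)
  ultimately show ?case
    using Suc by (auto intro!: field_differentiable_mult ndiff_add)
qed simp

lemma smooth_add: "smooth f \<Longrightarrow> smooth g \<Longrightarrow> smooth (\<lambda>x. f x + g x)"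
  and smooth_mult: "smooth f \<Longrightarrow> smooth g \<Longrightarrow> smooth (\<lambda>x. f x * g x)"
  by (auto simp: smooth_def ndiff_add ndiff_mult)

lemma smooth_polynomial: "real_polynomial_function p \<Longrightarrow> smooth p"
proof (induction rule: real_polynomial_function.induct)
  case (linear f)
  then have "f = (\<lambda>x. f 1 * x + 0)"
    using real_bounded_linear by (metis add.right_neutral mult.commute mult_1)
  then show ?case using smooth_affine by metis
qed (auto intro: smooth_const smooth_add smooth_mult)

lemma smooth_compose_affine:
  assumes "smooth f" shows "smooth (\<lambda>x. f (a * x + b))"
proof (rule deriv_family)
  show "(\<lambda>x. f (a * x + b)) \<in> {\<lambda>x. c * k (a * x + b) | c k. smooth k}"
    using assms by (auto intro!: exI[of _ 1] exI[of _ f])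
  fix F assume "F \<in> {\<lambda>x. c * k (a * x + b) | c k. smooth k}"
  then obtain c k where F: "F = (\<lambda>x. c * k (a * x + b))" and k: "smooth k" by blast
  have "(F has_real_derivative (c * a) * deriv k (a * x + b)) (at x)" for x
  proof -
    have "((\<lambda>x. k (a * x + b)) has_real_derivative deriv k (a * x + b) * a) (at x)"
      by (rule DERIV_chain'[of "\<lambda>x. a * x + b", OF _ smooth_has_deriv[OF k]])
         (auto intro!: derivative_eq_intros)
    from DERIV_cmult[OF this, of c] show ?thesis by (simp add: F mult_ac)
  qed
  then show "\<exists>f'\<in>{\<lambda>x. c * k (a * x + b) | c k. smooth k}. \<forall>x. (F has_real_derivative f' x) (at x)"
    using smooth_deriv[OF k]
    by (intro bexI[of _ "\<lambda>x. (c * a) * deriv k (a * x + b)"]) auto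
qed

definition flat_exp :: "real \<Rightarrow> real" where
  "flat_exp x = (if x > 0 then exp (- 1 / x) else 0)"

lemma poly_exp_decay: "((\<lambda>t. poly p t * exp (- t)) \<longlongrightarrow> (0::real)) at_top"
proof -
  have "((\<lambda>t. \<Sum>i\<le>degree p. coeff p i * (t ^ i / exp t)) \<longlongrightarrow> (\<Sum>i\<le>degree p. coeff p i * 0)) at_top"
    by (intro tendsto_sum tendsto_mult tendsto_const tendsto_power_div_exp_0)
  then show ?thesis
    by (simp add: poly_altdef sum_distrib_right sum_divide_distrib exp_minus field_simps)
qed

text \<open>
  The functions \<open>P (1 / x) exp (- 1 / x)\<close> for positive \<open>x\<close>, with \<open>P\<close> a polynomial, extended by
  \<open>0\<close>, form a class closed under differentiation: with \<open>t = 1 / x\<close>, the polynomial of the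
  derivative is \<open>t\<^sup>2 (P - P')\<close>.
\<close>

lemma smooth_flat_exp: "smooth flat_exp"
proof (rule deriv_family)
  let ?F = "{\<lambda>x. if x > 0 then poly p (1 / x) * exp (- 1 / x) else 0 | p :: real poly. True}"
  show "flat_exp \<in> ?F"
    by (auto simp: flat_exp_def fun_eq_iff intro!: exI[of _ 1])
  fix f assume "f \<in> ?F"
  then obtain p :: "real poly" where f: "f = (\<lambda>x. if x > 0 then poly p (1 / x) * exp (- 1 / x) else 0)"
    by blast
  define q where "q = [:0, 0, 1:] * (p - pderiv p)"
  define f' where "f' = (\<lambda>x. if x > 0 then poly q (1 / x) * exp (- 1 / x) else 0)"
  have "(f has_real_derivative f' x) (at x)" for x
  proof -
    consider "x > 0" | "x < 0" | "x = 0" by linarith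
    then show ?thesis
    proof cases
      case 1
      have "((\<lambda>x. poly p (1 / x) * exp (- 1 / x)) has_real_derivative f' x) (at x)"
        using 1 unfolding f'_def q_def
        by (auto intro!: derivative_eq_intros DERIV_chain'[OF _ poly_DERIV]
            simp: power2_eq_square field_simps)
      then show ?thesis
        by (rule has_field_derivative_transform_within_open[of _ _ _ "{0<..}"]) (use 1 in \<open>auto simp: f\<close>)
    next
      case 2
      then have "f' x = 0" by (simp add: f'_def)
      have "((\<lambda>x. 0) has_real_derivative 0) (at x)" by simp
      then show ?thesis unfolding \<open>f' x = 0\<close>
        by (rule has_field_derivative_transform_within_open[of _ _ _ "{..<0}"]) (use 2 in \<open>auto simp: f\<close>)
    next
      case 3
      have "((\<lambda>h. f h / h) \<longlongrightarrow> 0) (at_right 0)"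
      proof -
        have "((\<lambda>t. poly ([:0, 1:] * p) t * exp (- t)) \<longlongrightarrow> (0::real)) at_top" by (rule poly_exp_decay)
        then have "((\<lambda>h. poly ([:0, 1:] * p) (inverse h) * exp (- inverse h)) \<longlongrightarrow> (0::real)) (at_right 0)"
          by (rule filterlim_compose) (rule filterlim_inverse_at_top_right)
        then show ?thesis
          by (rule Lim_transform_eventually)
             (auto simp: eventually_at_right_field f field_simps intro!: exI[of _ 1])
      qed
      moreover have "((\<lambda>h. f h / h) \<longlongrightarrow> 0) (at_left 0)"
        by (rule tendsto_eventually) (auto simp: eventually_at_left_field f intro!: exI[of _ "-1"])
      ultimately have "((\<lambda>h. f h / h) \<longlongrightarrow> 0) (at 0)" by (simp add: filterlim_split_at_real)
      moreover have "(\<lambda>h. (f (0 + h) - f 0) / h) = (\<lambda>h. f h / h)"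
        by (simp add: f fun_eq_iff)
      ultimately show ?thesis using 3 by (simp only: DERIV_def) (simp add: f'_def)
    qed
  qed
  then show "\<exists>f'\<in>?F. \<forall>x. (f has_real_derivative f' x) (at x)"
    by (intro bexI[of _ f']) (auto simp: f'_def)
qed

text \<open>
  Supported in \<open>[a, b]\<close>; as \<open>n\<close> grows, these functions increase towards the indicator function of
  \<open>(a, b)\<close> instead of concentrating at a point.
\<close>

definition bump :: "real \<Rightarrow> real \<Rightarrow> nat \<Rightarrow> real \<Rightarrow> real" where
  "bump a b n x = flat_exp (real n * x - real n * a) * flat_exp (real n * b - real n * x)"

lemma smooth_bump: "smooth (bump a b n)"
  using smooth_mult[OF smooth_compose_affine[OF smooth_flat_exp, of "real n" "- real n * a"]
    smooth_compose_affine[OF smooth_flat_exp, of "- real n" "real n * b"]]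
  unfolding bump_def[abs_def] by (simp add: algebra_simps)

lemma bump_bounds: "0 \<le> bump a b n x" "bump a b n x \<le> 1"
  unfolding bump_def flat_exp_def by (auto intro!: mult_le_one)

lemma bump_pos: "n > 0 \<Longrightarrow> bump a b n x > 0 \<longleftrightarrow> a < x \<and> x < b"
  unfolding bump_def flat_exp_def by auto

lemma bump_zero: "x \<notin> {a<..<b} \<Longrightarrow> bump a b n x = 0"
  using mult_left_mono[of x a "real n"] mult_left_mono[of b x "real n"]
  by (auto simp: bump_def flat_exp_def)

text \<open>
  The end points may move with \<open>n\<close>: the indicator function of \<open>(0, ell)\<close> itself is to be
  approximated by functions whose supports are compact in \<open>(0, ell)\<close>.
\<close>

lemma bump_tendsto:
  assumes a: "al \<longlonglongrightarrow> a" and b: "bl \<longlonglongrightarrow> b" and x: "a < x" "x < b"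
  shows "(\<lambda>n. bump (al n) (bl n) n x) \<longlonglongrightarrow> 1"
proof -
  have e: "(\<lambda>n. exp (- 1 / (real n * c n))) \<longlonglongrightarrow> 1" if "c \<longlonglongrightarrow> d" "d > 0" for c d
  proof -
    have "(\<lambda>n. (- 1 / c n) * (1 / real n)) \<longlonglongrightarrow> (-1 / d) * 0"
      using that by (intro tendsto_mult tendsto_divide tendsto_const lim_1_over_n) auto
    from tendsto_exp[OF this] show ?thesis by (simp add: mult.commute)
  qed
  have "(\<lambda>n. exp (- 1 / (real n * (x - al n))) * exp (- 1 / (real n * (bl n - x)))) \<longlonglongrightarrow> 1 * 1"
    by (intro tendsto_mult e[of _ "x - a"] e[of _ "b - x"] tendsto_diff tendsto_const a b) (use x in auto)
  moreover have "\<forall>\<^sub>F n in sequentially. exp (- 1 / (real n * (x - al n))) * exp (- 1 / (real n * (bl n - x))) = bump (al n) (bl n) n x"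
    using eventually_gt_at_top[of 0] order_tendstoD(2)[OF a x(1)] order_tendstoD(1)[OF b x(2)]
    by eventually_elim (auto simp: bump_def flat_exp_def simp flip: right_diff_distrib)
  ultimately show ?thesis using Lim_transform_eventually by fastforce
qed

section \<open>Square integrable functions\<close>

abbreviation leb :: "real \<Rightarrow> real measure" where "leb ell \<equiv> lebesgue_on {0<..<ell}"

lemma continuous_Icc_lebesgue:
  fixes f :: "real \<Rightarrow> real"
  assumes "continuous_on {0..ell} f"
  shows "integrable (leb ell) f" "integral\<^sup>L (leb ell) f = integral {0..ell} f"
    "f \<in> borel_measurable (leb ell)"
proof -
  have "set_integrable lebesgue {0..ell} f"
    using continuous_imp_integrable_real[OF assms]
    by (simp add: set_integrable_def integrable_restrict_space)
  then have "set_integrable lebesgue {0<..<ell} f"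
    by (rule set_integrable_subset) auto
  then show i: "integrable (leb ell) f"
    by (simp add: set_integrable_def integrable_restrict_space)
  show "integral\<^sup>L (leb ell) f = integral {0..ell} f"
    using lebesgue_integral_eq_integral[OF i] by (simp add: integral_open_interval_real)
  show "f \<in> borel_measurable (leb ell)" using i by simp
qed

lemma AE_leb_iff: "(AE x in leb ell. P x) \<longleftrightarrow> negligible {x. x \<in> {0<..<ell} \<and> \<not> P x}"
proof -
  have "(AE x in leb ell. P x) \<longleftrightarrow> (AE x in lebesgue. x \<in> {0<..<ell} \<longrightarrow> P x)"
    by (rule AE_restrict_space_iff) simp
  also have "\<dots> \<longleftrightarrow> {x. x \<in> {0<..<ell} \<and> \<not> P x} \<in> null_sets lebesgue"
    using completion.AE_iff_null_sets[where M = lborel and P = "\<lambda>x. x \<in> {0<..<ell} \<longrightarrow> P x"]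
    by simp
  finally show ?thesis by (simp add: negligible_iff_null_sets)
qed

lemma AE_lebI: "(\<And>x. 0 < x \<Longrightarrow> x < ell \<Longrightarrow> P x) \<Longrightarrow> AE x in leb ell. P x"
  by (rule AE_I2) auto

lemma L2_real: "f \<in> L2 ell \<longleftrightarrow> f \<in> borel_measurable (leb ell) \<and> integrable (leb ell) (\<lambda>x. (f x)\<^sup>2)"
  for f :: "real \<Rightarrow> real"
  by (simp add: L2_def)

lemma L2_integrable_mult:
  fixes f k :: "real \<Rightarrow> real"
  assumes "f \<in> L2 ell" "k \<in> L2 ell"
  shows "integrable (leb ell) (\<lambda>x. f x * k x)"
proof (rule Bochner_Integration.integrable_bound)
  show "integrable (leb ell) (\<lambda>x. (f x)\<^sup>2 + (k x)\<^sup>2)"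
    using assms by (auto simp: L2_real)
  show "(\<lambda>x. f x * k x) \<in> borel_measurable (leb ell)" using assms by (auto simp: L2_real)
  have "\<bar>a * b\<bar> \<le> a\<^sup>2 + b\<^sup>2" for a b :: real
    using sum_squares_bound[of "\<bar>a\<bar>" "\<bar>b\<bar>"] zero_le_power2[of a] zero_le_power2[of b]
    unfolding abs_mult power2_abs by linarith
  then show "AE x in leb ell. norm (f x * k x) \<le> norm ((f x)\<^sup>2 + (k x)\<^sup>2)" by simp
qed

lemma continuous_L2: "continuous_on {0..ell} f \<Longrightarrow> f \<in> L2 ell" for f :: "real \<Rightarrow> real"
  unfolding L2_real by (intro conjI continuous_Icc_lebesgue continuous_on_power)

lemma L2_integrable: "f \<in> L2 ell \<Longrightarrow> integrable (leb ell) f" for f :: "real \<Rightarrow> real"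
  using L2_integrable_mult[OF _ continuous_L2[OF continuous_on_const[of _ 1]]] by simp

lemma L2_diff:
  fixes f k :: "real \<Rightarrow> real"
  assumes "f \<in> L2 ell" "k \<in> L2 ell" shows "(\<lambda>x. f x - k x) \<in> L2 ell"
proof -
  have "integrable (leb ell) (\<lambda>x. ((f x)\<^sup>2 + (k x)\<^sup>2) - 2 * (f x * k x))"
    using assms L2_integrable_mult[OF assms] unfolding L2_real
    by (intro Bochner_Integration.integrable_diff Bochner_Integration.integrable_add
        Bochner_Integration.integrable_mult_right) blast+
  then have "integrable (leb ell) (\<lambda>x. (f x - k x)\<^sup>2)"
    by (simp only: power2_diff mult.assoc)
  then show ?thesis using assms unfolding L2_real by (blast intro: borel_measurable_diff)
qed

lemma inner_L2_real: "inner_L2 ell f k = integral\<^sup>L (leb ell) (\<lambda>x. f x * k x)" for f k :: "real \<Rightarrow> real"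
  by (simp add: inner_L2_def)

lemma norm_L2_real: "norm_L2 ell f = sqrt (integral\<^sup>L (leb ell) (\<lambda>x. (f x)\<^sup>2))" for f :: "real \<Rightarrow> real"
  by (simp add: norm_L2_def inner_L2_def power2_eq_square)

text \<open>
  From \<open>2 \<bar>c \<eta>\<bar> \<le> c\<^sup>2 / d + d \<eta>\<^sup>2\<close>, where \<open>d\<close> is chosen small first and \<open>n\<close> large afterwards.
\<close>

lemma tendsto_inner_L2:
  fixes c :: "nat \<Rightarrow> real \<Rightarrow> real" and \<eta> :: "real \<Rightarrow> real"
  assumes ell: "0 < ell" and c: "\<And>n. c n \<in> L2 ell" and \<eta>: "continuous_on {0..ell} \<eta>"
    and lim: "(\<lambda>n. norm_L2 ell (c n)) \<longlonglongrightarrow> 0"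
  shows "(\<lambda>n. integral\<^sup>L (leb ell) (\<lambda>x. c n x * \<eta> x)) \<longlonglongrightarrow> 0"
proof -
  define I where "I = (\<lambda>n. integral\<^sup>L (leb ell) (\<lambda>x. (c n x)\<^sup>2))"
  define H where "H = integral\<^sup>L (leb ell) (\<lambda>x. (\<eta> x)\<^sup>2)"
  have I0: "I n \<ge> 0" for n unfolding I_def by simp
  have H0: "H \<ge> 0" unfolding H_def by simp
  have "(\<lambda>n. (norm_L2 ell (c n))\<^sup>2) \<longlonglongrightarrow> 0\<^sup>2" using lim by (rule tendsto_power)
  then have I: "I \<longlonglongrightarrow> 0" using I0 by (simp add: norm_L2_real I_def)
  have bound: "\<bar>integral\<^sup>L (leb ell) (\<lambda>x. c n x * \<eta> x)\<bar> \<le> I n / (2 * d) + d / 2 * H" if "d > 0" for n d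
  proof -
    have \<eta>2: "\<eta> \<in> L2 ell" by (rule continuous_L2[OF \<eta>])
    have "\<bar>integral\<^sup>L (leb ell) (\<lambda>x. c n x * \<eta> x)\<bar> \<le> integral\<^sup>L (leb ell) (\<lambda>x. \<bar>c n x * \<eta> x\<bar>)"
      using integral_norm_bound[of "leb ell" "\<lambda>x. c n x * \<eta> x"] by simp
    also have "\<dots> \<le> integral\<^sup>L (leb ell) (\<lambda>x. (c n x)\<^sup>2 / (2 * d) + d / 2 * (\<eta> x)\<^sup>2)"
    proof (rule integral_mono)
      show "integrable (leb ell) (\<lambda>x. \<bar>c n x * \<eta> x\<bar>)" using L2_integrable_mult[OF c \<eta>2] by simp
      show "integrable (leb ell) (\<lambda>x. (c n x)\<^sup>2 / (2 * d) + d / 2 * (\<eta> x)\<^sup>2)"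
        using c \<eta>2 by (auto simp: L2_real)
      fix x
      have "0 \<le> (\<bar>c n x\<bar> - d * \<bar>\<eta> x\<bar>)\<^sup>2" by simp
      then show "\<bar>c n x * \<eta> x\<bar> \<le> (c n x)\<^sup>2 / (2 * d) + d / 2 * (\<eta> x)\<^sup>2"
        using that by (simp add: power2_diff abs_mult field_simps power2_eq_square)
    qed
    also have "\<dots> = I n / (2 * d) + d / 2 * H"
      using c \<eta>2 by (simp add: L2_real I_def H_def)
    finally show ?thesis .
  qed
  show ?thesis
  proof (rule LIMSEQ_I)
    fix e :: real assume "e > 0"
    define d where "d = e / (H + 1)"
    have d: "d > 0" "d / 2 * H < e / 2" using \<open>e > 0\<close> H0 by (auto simp: d_def field_simps)
    have "\<forall>\<^sub>F n in sequentially. I n < e * d"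
      using order_tendstoD(2)[OF I, of "e * d"] \<open>e > 0\<close> d by simp
    then obtain N where N: "\<And>n. n \<ge> N \<Longrightarrow> I n < e * d" by (auto simp: eventually_sequentially)
    have "norm (integral\<^sup>L (leb ell) (\<lambda>x. c n x * \<eta> x) - 0) < e" if "n \<ge> N" for n
    proof -
      have "I n / (2 * d) < e / 2" using N[OF that] d by (simp add: field_simps)
      then show ?thesis using bound[OF d(1), of n] d(2) by simp
    qed
    then show "\<exists>N. \<forall>n\<ge>N. norm (integral\<^sup>L (leb ell) (\<lambda>x. c n x * \<eta> x) - 0) < e" by blast
  qed
qed

section \<open>Test functions\<close>

lemma test_functionI:
  assumes "smooth \<phi>" "0 < a" "b < ell" "\<And>x. x \<notin> {a..b} \<Longrightarrow> \<phi> x = 0"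
  shows "\<phi> \<in> test_functions ell"
proof -
  have "closure {x. \<phi> x \<noteq> 0} \<subseteq> {a..b}"
    by (rule closure_minimal) (use assms(4) in blast, rule closed_atLeastAtMost)
  moreover from this have "compact (closure {x. \<phi> x \<noteq> 0})"
    by (meson bounded_closed_interval bounded_subset closed_closure compact_eq_bounded_closed)
  ultimately show ?thesis
    using assms unfolding test_functions_def smooth_iff by auto
qed

lemma test_smooth: "\<phi> \<in> test_functions ell \<Longrightarrow> smooth \<phi>"
  by (simp add: test_functions_def smooth_iff)

lemma test_support:
  assumes "\<phi> \<in> test_functions ell" "0 < ell"
  shows "\<exists>a b. 0 < a \<and> a \<le> b \<and> b < ell \<and> (\<forall>x. x \<notin> {a..b} \<longrightarrow> \<phi> x = 0)"
proof -
  let ?S = "closure {x. \<phi> x \<noteq> 0}"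
  have S: "compact ?S" "?S \<subseteq> {0<..<ell}"
    using assms unfolding test_functions_def by auto
  have zero: "\<phi> x = 0" if "x \<notin> ?S" for x
    using that closure_subset[of "{x. \<phi> x \<noteq> 0}"] by blast
  show ?thesis
  proof (cases "?S = {}")
    case True
    then have "\<forall>x. \<phi> x = 0" using zero by blast
    then show ?thesis using assms(2) by (intro exI[of _ "ell / 2"]) simp
  next
    case False
    obtain a where a: "a \<in> ?S" "\<forall>x\<in>?S. a \<le> x" using compact_attains_inf[OF S(1) False] by blast
    obtain b where b: "b \<in> ?S" "\<forall>x\<in>?S. x \<le> b" using compact_attains_sup[OF S(1) False] by blast
    have "\<phi> x = 0" if "x \<notin> {a..b}" for x
      using a(2) b(2) that zero[of x] by (meson atLeastAtMost_iff)
    moreover have "0 < a" "b < ell"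
      using subsetD[OF S(2) a(1)] subsetD[OF S(2) b(1)] by simp_all
    ultimately show ?thesis using a(1) b(2) by blast
  qed
qed

lemma test_zero:
  assumes "\<phi> \<in> test_functions ell" "x \<notin> {0<..<ell}" shows "\<phi> x = 0"
proof (rule ccontr)
  assume "\<phi> x \<noteq> 0"
  then have "x \<in> closure {x. \<phi> x \<noteq> 0}" by (intro subsetD[OF closure_subset]) simp
  with assms show False unfolding test_functions_def by (blast dest: subsetD)
qed

lemma test_deriv:
  assumes "\<phi> \<in> test_functions ell" "0 < ell" shows "deriv \<phi> \<in> test_functions ell"
proof -
  obtain a b where ab0: "0 < a" "a \<le> b" "b < ell" "\<And>x. x \<notin> {a..b} \<Longrightarrow> \<phi> x = 0"
    using test_support[OF assms] by blast
  note ab = test_smooth[OF assms(1)] ab0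
  have "deriv \<phi> x = 0" if "x \<notin> {a..b}" for x
  proof -
    have "(\<phi> has_real_derivative 0) (at x)"
      by (rule has_field_derivative_transform_within_open[of "\<lambda>x. 0" _ _ "- {a..b}"])
         (use that ab(5) in auto)
    then show ?thesis by (rule DERIV_imp_deriv)
  qed
  then show ?thesis using test_functionI[OF smooth_deriv[OF ab(1)] ab(2,4)] by blast
qed

lemma test_lincomb:
  assumes "\<phi> \<in> test_functions ell" "\<psi> \<in> test_functions ell" "0 < ell"
  shows "(\<lambda>x. \<phi> x - c * \<psi> x) \<in> test_functions ell"
proof -
  obtain a b where ab0: "0 < a" "a \<le> b" "b < ell" "\<And>x. x \<notin> {a..b} \<Longrightarrow> \<phi> x = 0"
    using test_support[OF assms(1,3)] by blast
  note ab = test_smooth[OF assms(1)] ab0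
  obtain a' b' where ab'0: "0 < a'" "a' \<le> b'" "b' < ell" "\<And>x. x \<notin> {a'..b'} \<Longrightarrow> \<psi> x = 0"
    using test_support[OF assms(2,3)] by blast
  note ab' = test_smooth[OF assms(2)] ab'0
  have "smooth (\<lambda>x. \<phi> x + (- c) * \<psi> x)"
    by (intro smooth_add smooth_mult smooth_const ab ab')
  then have sm: "smooth (\<lambda>x. \<phi> x - c * \<psi> x)" by simp
  have "\<phi> x - c * \<psi> x = 0" if "x \<notin> {min a a'..max b b'}" for x
  proof -
    have "x \<notin> {a..b}" "x \<notin> {a'..b'}" using that by auto
    then show ?thesis using ab(5) ab'(5) by simp
  qed
  with sm show ?thesis
    by (intro test_functionI[of _ "min a a'" "max b b'"]) (use ab(2,4) ab'(2,4) in auto)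
qed

lemma test_bump: "0 < a \<Longrightarrow> b < ell \<Longrightarrow> bump a b n \<in> test_functions ell"
  by (rule test_functionI[of _ a b]) (auto simp: smooth_bump intro!: bump_zero)

text \<open>
  The primitive vanishes to the left of the support, and to the right of it because the total
  integral is zero.
\<close>

lemma test_antideriv:
  assumes \<psi>: "\<psi> \<in> test_functions ell" and ell: "0 < ell" and zero: "integral {0..ell} \<psi> = 0"
  obtains \<phi> where "\<phi> \<in> test_functions ell" "deriv \<phi> = \<psi>"
    "\<And>x. x \<in> {0..ell} \<Longrightarrow> \<phi> x = integral {0..x} \<psi>"
proof -
  obtain a b where ab0: "0 < a" "a \<le> b" "b < ell" "\<And>x. x \<notin> {a..b} \<Longrightarrow> \<psi> x = 0"
    using test_support[OF \<psi> ell] by blast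
  note ab = test_smooth[OF \<psi>] ab0
  define \<phi> where "\<phi> = (\<lambda>x. if x \<in> {0..ell} then integral {0..x} \<psi> else 0)"
  have cont: "continuous_on S \<psi>" for S by (rule smooth_continuous_on[OF ab(1)])
  have left: "\<phi> x = 0" if "x < a" for x
  proof -
    have "integral {0..x} \<psi> = integral {0..x} (\<lambda>x. 0)"
      by (rule integral_cong) (use that ab(5) in auto)
    then show ?thesis by (simp add: \<phi>_def)
  qed
  have right: "\<phi> x = 0" if "x > b" for x
  proof (cases "x \<le> ell")
    case True
    have "integral {x..ell} \<psi> = integral {x..ell} (\<lambda>x. 0)"
      by (rule integral_cong) (use that ab(5) in auto)
    moreover have "integral {0..x} \<psi> + integral {x..ell} \<psi> = integral {0..ell} \<psi>"
      by (rule Henstock_Kurzweil_Integration.integral_combine)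
         (use True that ab integrable_continuous_real[OF cont] in auto)
    ultimately show ?thesis using zero by (simp add: \<phi>_def)
  qed (simp add: \<phi>_def)
  have der: "(\<phi> has_real_derivative \<psi> x) (at x)" for x
  proof -
    consider "x < a" | "x > b" | "0 < x" "x < ell" using ab by linarith
    then show ?thesis
    proof cases
      case 1
      have "(\<phi> has_real_derivative 0) (at x)"
        by (rule has_field_derivative_transform_within_open[of "\<lambda>x. 0" _ _ "{..<a}"]) (use 1 left in auto)
      then show ?thesis using ab(5)[of x] 1 by simp
    next
      case 2
      have "(\<phi> has_real_derivative 0) (at x)"
        by (rule has_field_derivative_transform_within_open[of "\<lambda>x. 0" _ _ "{b<..}"]) (use 2 right in auto)
      then show ?thesis using ab(5)[of x] 2 by simp
    next
      case 3
      have "((\<lambda>u. integral {0..u} \<psi>) has_real_derivative \<psi> x) (at x within {0..ell})"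
        by (rule integral_has_real_derivative[OF cont]) (use 3 in auto)
      then have "((\<lambda>u. integral {0..u} \<psi>) has_real_derivative \<psi> x) (at x)"
        using 3 by (simp add: at_within_Icc_at)
      then show ?thesis
        by (rule has_field_derivative_transform_within_open[of _ _ _ "{0<..<ell}"]) (use 3 in \<open>auto simp: \<phi>_def\<close>)
    qed
  qed
  have "\<phi> \<in> test_functions ell"
    by (rule test_functionI[OF smooth_antideriv[OF der ab(1)] ab(2,4)])
       (use left right in \<open>auto simp: not_le\<close>)
  moreover have "deriv \<phi> = \<psi>" using der by (auto intro: DERIV_imp_deriv)
  ultimately show thesis using that by (simp add: \<phi>_def)
qed

lemma test_integral_pos:
  assumes "0 < a" "a < b" "b < ell" "n > 0"
  shows "integral {0..ell} (bump a b n) > 0"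
proof -
  have c: "continuous_on {0..ell} (bump a b n)" by (rule smooth_continuous_on[OF smooth_bump])
  have "integral {0..ell} (bump a b n) \<noteq> 0"
  proof
    assume "integral {0..ell} (bump a b n) = 0"
    then have "\<forall>x\<in>{0..ell}. bump a b n x = 0"
      using integral_eq_0_iff[OF c] bump_bounds(1) assms by simp
    then have "bump a b n ((a + b) / 2) = 0" using assms by simp
    moreover have "bump a b n ((a + b) / 2) > 0" using assms by (subst bump_pos) auto
    ultimately show False by simp
  qed
  moreover have "integral {0..ell} (bump a b n) \<ge> 0"
    by (rule integral_nonneg[OF integrable_continuous_real[OF c]]) (simp add: bump_bounds)
  ultimately show ?thesis by simp
qed

text \<open>
  A test function differs from a multiple of a fixed bump by a test function with integral zero,
  that is, by the derivative of a test function. For the functional given by integration against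
  a function this is the lemma of du Bois-Reymond.
\<close>

lemma functional_on_derivatives:
  fixes T :: "(real \<Rightarrow> real) \<Rightarrow> real"
  assumes ell: "0 < ell"
    and lin: "\<And>\<phi> \<psi> c. \<phi> \<in> test_functions ell \<Longrightarrow> \<psi> \<in> test_functions ell \<Longrightarrow>
      T (\<lambda>x. \<phi> x - c * \<psi> x) = T \<phi> - c * T \<psi>"
    and zero: "\<And>\<phi>. \<phi> \<in> test_functions ell \<Longrightarrow> T (deriv \<phi>) = 0"
  obtains c where "\<And>\<psi>. \<psi> \<in> test_functions ell \<Longrightarrow> T \<psi> = c * integral {0..ell} \<psi>"
proof -
  define \<eta> where "\<eta> = bump (ell / 3) (2 * ell / 3) 1"
  have \<eta>: "\<eta> \<in> test_functions ell" unfolding \<eta>_def by (rule test_bump) (use ell in auto)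
  have pos: "integral {0..ell} \<eta> > 0" unfolding \<eta>_def by (rule test_integral_pos) (use ell in auto)
  have "T \<psi> = T \<eta> / integral {0..ell} \<eta> * integral {0..ell} \<psi>" if \<psi>: "\<psi> \<in> test_functions ell" for \<psi>
  proof -
    define r where "r = integral {0..ell} \<psi> / integral {0..ell} \<eta>"
    have int: "\<psi> integrable_on {0..ell}" "\<eta> integrable_on {0..ell}"
      using \<psi> \<eta> by (auto intro!: integrable_continuous_real smooth_continuous_on test_smooth)
    have "integral {0..ell} (\<lambda>x. \<psi> x - r * \<eta> x) = integral {0..ell} \<psi> - r * integral {0..ell} \<eta>"
      using integral_diff[OF int(1) integrable_cmul[OF int(2), of r]] by simp
    also have "\<dots> = 0" using pos by (simp add: r_def)
    finally obtain \<phi> where \<phi>: "\<phi> \<in> test_functions ell" "deriv \<phi> = (\<lambda>x. \<psi> x - r * \<eta> x)"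
      using test_antideriv[OF test_lincomb[OF \<psi> \<eta> ell] ell] by blast
    have "T \<psi> - r * T \<eta> = 0" using zero[OF \<phi>(1)] lin[OF \<psi> \<eta>] \<phi>(2) by simp
    then show ?thesis by (simp add: r_def)
  qed
  then show thesis by (rule that)
qed

section \<open>The fundamental lemma of the calculus of variations\<close>

lemma test_continuous: "\<phi> \<in> test_functions ell \<Longrightarrow> continuous_on S \<phi>"
  by (rule smooth_continuous_on[OF test_smooth])

lemma test_L2: "\<phi> \<in> test_functions ell \<Longrightarrow> \<phi> \<in> L2 ell"
  by (rule continuous_L2[OF test_continuous])

text \<open>
  Bumps converge boundedly to the indicator function of the interval.
\<close>

lemma weak_zero_interval:
  fixes w :: "real \<Rightarrow> real"
  assumes w: "w \<in> L2 ell" and zero: "\<And>\<psi>. \<psi> \<in> test_functions ell \<Longrightarrow> integral\<^sup>L (leb ell) (\<lambda>x. w x * \<psi> x) = 0"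
    and ab: "0 < a" "a < b" "b < ell"
  shows "integral {a..b} w = 0"
proof -
  have int: "integrable (leb ell) w" by (rule L2_integrable[OF w])
  have ind: "integrable (leb ell) (\<lambda>x. w x * indicator {a<..<b} x)"
  proof -
    have "{a<..<b} \<in> sets (leb ell)"
      using ab by (subst sets_restrict_space_iff) auto
    from integrable_mult_indicator[OF this int] show ?thesis by (simp add: mult.commute)
  qed
  have "(\<lambda>n. integral\<^sup>L (leb ell) (\<lambda>x. w x * bump a b n x)) \<longlonglongrightarrow> integral\<^sup>L (leb ell) (\<lambda>x. w x * indicator {a<..<b} x)"
  proof (rule integral_dominated_convergence[where w = "\<lambda>x. \<bar>w x\<bar>"])
    show "(\<lambda>x. w x * indicator {a<..<b} x) \<in> borel_measurable (leb ell)" using ind by simp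
    show "(\<lambda>x. w x * bump a b n x) \<in> borel_measurable (leb ell)" for n
      using L2_integrable_mult[OF w test_L2[OF test_bump[OF ab(1,3)]]] by simp
    show "integrable (leb ell) (\<lambda>x. \<bar>w x\<bar>)" using int by simp
    have "(\<lambda>n. bump a b n x) \<longlonglongrightarrow> indicator {a<..<b} x" for x
    proof (cases "x \<in> {a<..<b}")
      case True
      then show ?thesis using bump_tendsto[OF tendsto_const tendsto_const, of a x b] by simp
    next
      case False
      then show ?thesis by (simp add: bump_zero)
    qed
    then show "AE x in leb ell. (\<lambda>n. w x * bump a b n x) \<longlonglongrightarrow> w x * indicator {a<..<b} x"
      by (intro AE_I2 tendsto_mult tendsto_const)
    have "\<bar>w x * bump a b n x\<bar> \<le> \<bar>w x\<bar>" for n x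
      using mult_left_mono[OF bump_bounds(2)[of a b n x], of "\<bar>w x\<bar>"] bump_bounds(1)[of a b n x]
      by (simp add: abs_mult)
    then show "AE x in leb ell. norm (w x * bump a b n x) \<le> \<bar>w x\<bar>" for n by simp
  qed
  then have "integral\<^sup>L (leb ell) (\<lambda>x. w x * indicator {a<..<b} x) = 0"
    using zero[OF test_bump[OF ab(1,3)]] by (simp add: LIMSEQ_const_iff)
  moreover have "integral\<^sup>L (leb ell) (\<lambda>x. w x * indicator {a<..<b} x) = integral {0<..<ell} (\<lambda>x. w x * indicator {a<..<b} x)"
    by (rule lebesgue_integral_eq_integral[OF ind]) simp
  moreover have "integral {0<..<ell} (\<lambda>x. w x * indicator {a<..<b} x) = integral {0<..<ell} (\<lambda>x. if x \<in> {a<..<b} then w x else 0)"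
    by (rule integral_cong) (simp add: indicator_def)
  moreover have "\<dots> = integral ({a<..<b} \<inter> {0<..<ell}) w" by (rule integral_restrict_Int)
  moreover have "{a<..<b} \<inter> {0<..<ell} = {a<..<b}" using ab by auto
  ultimately show ?thesis by (simp add: integral_open_interval_real)
qed

text \<open>
  By Lebesgue's differentiation theorem, almost all values of \<open>w\<close> are limits of its means over
  small intervals.
\<close>

lemma weak_zero_AE:
  fixes w :: "real \<Rightarrow> real"
  assumes w: "w \<in> L2 ell" and zero: "\<And>\<psi>. \<psi> \<in> test_functions ell \<Longrightarrow> integral\<^sup>L (leb ell) (\<lambda>x. w x * \<psi> x) = 0"
  shows "AE x in leb ell. w x = 0"
proof -
  define W where "W = (\<lambda>x. if x \<in> {0<..<ell} then w x else 0)"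
  have "w integrable_on {0<..<ell}"
    by (rule integrable_on_lebesgue_on[OF L2_integrable[OF w]]) simp
  then have "W integrable_on UNIV" unfolding W_def by (simp only: integrable_restrict_UNIV)
  then have "W integrable_on cbox a b" for a b
    by (rule integrable_on_subcbox) simp
  from integrable_ccontinuous_explicit[OF this] obtain N where N: "negligible N"
    "\<And>x e. \<lbrakk>x \<notin> N; 0 < e\<rbrakk> \<Longrightarrow> \<exists>d>0. \<forall>h. 0 < h \<and> h < d \<longrightarrow>
       norm (integral (cbox x (x + h *\<^sub>R One)) W /\<^sub>R h ^ DIM(real) - W x) < e"
    by blast
  have "w x = 0" if x: "x \<in> {0<..<ell}" "x \<notin> N" for x
  proof (rule ccontr)
    assume "w x \<noteq> 0"
    then obtain d where d: "d > 0" "\<And>h. 0 < h \<Longrightarrow> h < d \<Longrightarrow>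
       norm (integral (cbox x (x + h *\<^sub>R One)) W /\<^sub>R h ^ DIM(real) - W x) < \<bar>w x\<bar>"
      using N(2)[OF x(2), of "\<bar>w x\<bar>"] by auto
    define h where "h = min (d / 2) ((ell - x) / 2)"
    have h: "0 < h" "h < d" "x + h < ell"
      using d(1) x(1) by (auto simp: h_def min_def field_simps)
    have "integral {x..x + h} W = integral {x..x + h} w"
      by (rule integral_cong) (use x(1) h in \<open>auto simp: W_def\<close>)
    also have "\<dots> = 0"
      using weak_zero_interval[OF w zero, of x "x + h"] x(1) h by simp
    finally have "norm (0 - W x) < \<bar>w x\<bar>" using d(2)[OF h(1,2)] by simp
    then show False using x(1) by (simp add: W_def)
  qed
  then have "{x. x \<in> {0<..<ell} \<and> \<not> w x = 0} \<subseteq> N" by auto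
  then show ?thesis
    unfolding AE_leb_iff by (rule negligible_subset[OF N(1)])
qed

lemma weak_zero_continuous:
  fixes e :: "real \<Rightarrow> real"
  assumes ell: "0 < ell" and e: "continuous_on {0..ell} e"
    and zero: "\<And>\<psi>. \<psi> \<in> test_functions ell \<Longrightarrow> integral\<^sup>L (leb ell) (\<lambda>x. e x * \<psi> x) = 0"
    and x: "x \<in> {0..ell}"
  shows "e x = 0"
proof -
  have inner: "e x = 0" if x: "x \<in> {0<..<ell}" for x
  proof -
    have "((\<lambda>t. integral {x / 2..t} e) has_real_derivative e x) (at x within {x/2..ell})"
      by (rule integral_has_real_derivative[OF continuous_on_subset[OF e]]) (use x in auto)
    then have "((\<lambda>t. integral {x / 2..t} e) has_real_derivative e x) (at x)"
      using x by (simp add: at_within_Icc_at)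
    moreover have "((\<lambda>t. integral {x / 2..t} e) has_real_derivative 0) (at x)"
      by (rule has_field_derivative_transform_within_open[of "\<lambda>x. 0" _ _ "{x/2<..<ell}"])
         (use x weak_zero_interval[OF continuous_L2[OF e] zero, of "x/2"] in auto)
    ultimately show ?thesis by (rule DERIV_unique)
  qed
  have "closure {0<..<ell} = {0..ell}" using ell by simp
  then show ?thesis
    using continuous_constant_on_closure[of "{0<..<ell}" e 0 x] e inner x by simp
qed

lemma integration_by_parts_test:
  assumes f: "\<And>x. x \<in> {0..ell} \<Longrightarrow> (f has_real_derivative f' x) (at x within {0..ell})"
    and f': "continuous_on {0..ell} f'" and \<phi>: "\<phi> \<in> test_functions ell" and ell: "0 < ell"
  shows "integral\<^sup>L (leb ell) (\<lambda>x. f x * deriv \<phi> x) = - integral\<^sup>L (leb ell) (\<lambda>x. f' x * \<phi> x)"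
proof -
  have cf: "continuous_on {0..ell} f" by (rule DERIV_continuous_on[OF f])
  note c = test_continuous[OF \<phi>] test_continuous[OF test_deriv[OF \<phi> ell]]
  have "((\<lambda>x. f x * deriv \<phi> x + f' x * \<phi> x) has_integral f ell * \<phi> ell - f 0 * \<phi> 0) {0..ell}"
  proof (rule fundamental_theorem_of_calculus)
    fix x assume x: "x \<in> {0..ell}"
    have "(\<phi> has_real_derivative deriv \<phi> x) (at x within {0..ell})"
      by (rule has_field_derivative_at_within[OF smooth_has_deriv[OF test_smooth[OF \<phi>]]])
    from DERIV_mult[OF f[OF x] this]
    show "((\<lambda>x. f x * \<phi> x) has_vector_derivative f x * deriv \<phi> x + f' x * \<phi> x) (at x within {0..ell})"
      by (simp add: has_real_derivative_iff_has_vector_derivative algebra_simps)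
  qed (use ell in simp)
  moreover have "\<phi> ell = 0" "\<phi> 0 = 0" using test_zero[OF \<phi>] by auto
  ultimately have "integral {0..ell} (\<lambda>x. f x * deriv \<phi> x + f' x * \<phi> x) = 0"
    by (simp add: integral_unique)
  moreover have "integral {0..ell} (\<lambda>x. f x * deriv \<phi> x + f' x * \<phi> x)
     = integral {0..ell} (\<lambda>x. f x * deriv \<phi> x) + integral {0..ell} (\<lambda>x. f' x * \<phi> x)"
    by (intro Henstock_Kurzweil_Integration.integral_add integrable_continuous_real continuous_intros cf f' c)
  ultimately show ?thesis
    by (subst (1 2) continuous_Icc_lebesgue(2)) (auto intro!: continuous_intros cf f' c)
qed

lemma deriv_diff_cmult_smooth:
  assumes "smooth f" "smooth k"
  shows "deriv (\<lambda>x. f x - c * k x) = (\<lambda>x. deriv f x - c * deriv k x)"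
proof
  fix x
  have "((\<lambda>x. f x - c * k x) has_real_derivative deriv f x - c * deriv k x) (at x)"
    by (intro DERIV_diff DERIV_cmult smooth_has_deriv assms)
  then show "deriv (\<lambda>x. f x - c * k x) x = deriv f x - c * deriv k x" by (rule DERIV_imp_deriv)
qed

lemma L2_integral_lincomb:
  fixes f \<phi> \<psi> :: "real \<Rightarrow> real"
  assumes "f \<in> L2 ell" "\<phi> \<in> L2 ell" "\<psi> \<in> L2 ell"
  shows "integral\<^sup>L (leb ell) (\<lambda>x. f x * (\<phi> x - c * \<psi> x))
    = integral\<^sup>L (leb ell) (\<lambda>x. f x * \<phi> x) - c * integral\<^sup>L (leb ell) (\<lambda>x. f x * \<psi> x)"
proof -
  have "(\<lambda>x. f x * (\<phi> x - c * \<psi> x)) = (\<lambda>x. f x * \<phi> x - c * (f x * \<psi> x))"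
    by (auto simp: algebra_simps)
  then show ?thesis
    using L2_integrable_mult[OF assms(1,2)] L2_integrable_mult[OF assms(1,3)] by simp
qed

text \<open>
  Two steps of du Bois-Reymond. The functional \<open>\<psi> \<mapsto> \<integral> d \<psi>'\<close> annihilates derivatives of test
  functions, so it is \<open>c \<integral> \<psi> = - \<integral> c x \<psi>'\<close>. Hence integration against \<open>d + c x\<close> annihilates
  derivatives as well, and \<open>d + c x\<close> is constant.
\<close>

lemma weak_second_derivative_zero:
  fixes d :: "real \<Rightarrow> real"
  assumes ell: "0 < ell" and d: "continuous_on {0..ell} d"
    and zero: "\<And>\<phi>. \<phi> \<in> test_functions ell \<Longrightarrow> integral\<^sup>L (leb ell) (\<lambda>x. d x * deriv (deriv \<phi>) x) = 0"
  obtains \<alpha> \<beta> where "\<And>x. x \<in> {0..ell} \<Longrightarrow> d x = \<alpha> + \<beta> * x"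
proof -
  have d2: "d \<in> L2 ell" by (rule continuous_L2[OF d])
  note tL2 = test_L2 test_L2[OF test_deriv[OF _ ell]]
  obtain c where c: "\<And>\<psi>. \<psi> \<in> test_functions ell \<Longrightarrow>
      integral\<^sup>L (leb ell) (\<lambda>x. d x * deriv \<psi> x) = c * integral {0..ell} \<psi>"
  proof (rule functional_on_derivatives[OF ell, of "\<lambda>\<psi>. integral\<^sup>L (leb ell) (\<lambda>x. d x * deriv \<psi> x)"])
    fix \<phi> \<psi> and c :: real assume t: "\<phi> \<in> test_functions ell" "\<psi> \<in> test_functions ell"
    show "integral\<^sup>L (leb ell) (\<lambda>x. d x * deriv (\<lambda>x. \<phi> x - c * \<psi> x) x)
      = integral\<^sup>L (leb ell) (\<lambda>x. d x * deriv \<phi> x) - c * integral\<^sup>L (leb ell) (\<lambda>x. d x * deriv \<psi> x)"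
      using t by (simp add: deriv_diff_cmult_smooth test_smooth L2_integral_lincomb d2 tL2)
  qed (use zero in auto)
  define e where "e = (\<lambda>x. d x + c * x)"
  have e: "continuous_on {0..ell} e" unfolding e_def by (intro continuous_intros d)
  have e2: "e \<in> L2 ell" by (rule continuous_L2[OF e])
  have e_zero: "integral\<^sup>L (leb ell) (\<lambda>x. e x * deriv \<psi> x) = 0" if t: "\<psi> \<in> test_functions ell" for \<psi>
  proof -
    have "integral\<^sup>L (leb ell) (\<lambda>x. (c * x) * deriv \<psi> x) = - integral\<^sup>L (leb ell) (\<lambda>x. c * \<psi> x)"
      by (rule integration_by_parts_test[OF _ _ t ell]) (auto intro!: derivative_eq_intros)
    also have "\<dots> = - (c * integral {0..ell} \<psi>)"
      using continuous_Icc_lebesgue(2)[OF test_continuous[OF t]] by simp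
    finally have 1: "integral\<^sup>L (leb ell) (\<lambda>x. (c * x) * deriv \<psi> x) = - (c * integral {0..ell} \<psi>)" .
    have "integral\<^sup>L (leb ell) (\<lambda>x. e x * deriv \<psi> x)
      = integral\<^sup>L (leb ell) (\<lambda>x. d x * deriv \<psi> x + (c * x) * deriv \<psi> x)"
      by (simp add: e_def algebra_simps)
    also have "\<dots> = integral\<^sup>L (leb ell) (\<lambda>x. d x * deriv \<psi> x) + integral\<^sup>L (leb ell) (\<lambda>x. (c * x) * deriv \<psi> x)"
      by (intro Bochner_Integration.integral_add L2_integrable_mult d2 tL2 t continuous_L2 continuous_intros)
    finally show ?thesis using 1 c[OF t] by simp
  qed
  obtain c1 where c1: "\<And>\<psi>. \<psi> \<in> test_functions ell \<Longrightarrow>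
      integral\<^sup>L (leb ell) (\<lambda>x. e x * \<psi> x) = c1 * integral {0..ell} \<psi>"
  proof (rule functional_on_derivatives[OF ell, of "\<lambda>\<psi>. integral\<^sup>L (leb ell) (\<lambda>x. e x * \<psi> x)"])
    fix \<phi> \<psi> and c :: real assume t: "\<phi> \<in> test_functions ell" "\<psi> \<in> test_functions ell"
    show "integral\<^sup>L (leb ell) (\<lambda>x. e x * (\<phi> x - c * \<psi> x))
      = integral\<^sup>L (leb ell) (\<lambda>x. e x * \<phi> x) - c * integral\<^sup>L (leb ell) (\<lambda>x. e x * \<psi> x)"
      using t by (simp add: L2_integral_lincomb e2 tL2)
  qed (use e_zero in auto)
  have "e x - c1 = 0" if "x \<in> {0..ell}" for x
  proof (rule weak_zero_continuous[OF ell _ _ that])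
    show "continuous_on {0..ell} (\<lambda>x. e x - c1)" by (intro continuous_intros e)
    fix \<psi> assume t: "\<psi> \<in> test_functions ell"
    have "integral\<^sup>L (leb ell) (\<lambda>x. (e x - c1) * \<psi> x) = integral\<^sup>L (leb ell) (\<lambda>x. e x * \<psi> x - c1 * \<psi> x)"
      by (simp add: algebra_simps)
    also have "\<dots> = integral\<^sup>L (leb ell) (\<lambda>x. e x * \<psi> x) - c1 * integral\<^sup>L (leb ell) \<psi>"
      using L2_integrable_mult[OF e2 test_L2[OF t]] L2_integrable[OF test_L2[OF t]] by simp
    also have "\<dots> = 0"
      using c1[OF t] continuous_Icc_lebesgue(2)[OF test_continuous[OF t]] by simp
    finally show "integral\<^sup>L (leb ell) (\<lambda>x. (e x - c1) * \<psi> x) = 0" .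
  qed
  then show thesis by (intro that[of c1 "- c"]) (simp add: e_def algebra_simps)
qed


section \<open>Weak derivatives of classical functions\<close>

lemma has_weak_deriv_iff: "has_weak_deriv ell f f' \<longleftrightarrow> (\<forall>\<phi>\<in>test_functions ell.
    integral\<^sup>L (leb ell) (\<lambda>x. f x * deriv \<phi> x) = - integral\<^sup>L (leb ell) (\<lambda>x. f' x * \<phi> x))"
  by (simp add: has_weak_deriv_def inner_L2_real)

lemma weak_deriv_unique:
  assumes "f1 \<in> L2 ell" "f2 \<in> L2 ell" "has_weak_deriv ell f f1" "has_weak_deriv ell f f2"
  shows "AE x in leb ell. f1 x = f2 x"
proof -
  have "AE x in leb ell. f1 x - f2 x = 0"
  proof (rule weak_zero_AE[OF L2_diff[OF assms(1,2)]])
    fix \<psi> assume t: "\<psi> \<in> test_functions ell"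
    have "integral\<^sup>L (leb ell) (\<lambda>x. \<psi> x * (f1 x - 1 * f2 x)) = 0"
      using L2_integral_lincomb[OF test_L2[OF t] assms(1,2), of 1] assms(3,4) t
      unfolding has_weak_deriv_iff by (simp add: mult.commute)
    then show "integral\<^sup>L (leb ell) (\<lambda>x. (f1 x - f2 x) * \<psi> x) = 0" by (simp add: mult.commute)
  qed
  then show ?thesis by eventually_elim simp
qed

lemma wderiv_spec:
  assumes "f' \<in> L2 ell" "has_weak_deriv ell f f'"
  shows "wderiv ell f \<in> L2 ell" "has_weak_deriv ell f (wderiv ell f)"
    "AE x in leb ell. wderiv ell f x = f' x"
proof -
  show *: "wderiv ell f \<in> L2 ell" "has_weak_deriv ell f (wderiv ell f)"
    unfolding wderiv_def by (rule someI2[of _ f'], use assms in blast, blast)+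
  show "AE x in leb ell. wderiv ell f x = f' x"
    by (rule weak_deriv_unique[OF * (1) assms(1) *(2) assms(2)])
qed

lemma has_weak_deriv_AE:
  assumes "f \<in> L2 ell" "f2 \<in> L2 ell" "AE x in leb ell. f x = f2 x" "has_weak_deriv ell f2 k" "0 < ell"
  shows "has_weak_deriv ell f k"
  unfolding has_weak_deriv_iff
proof
  fix \<phi> assume t: "\<phi> \<in> test_functions ell"
  note d = test_L2[OF test_deriv[OF t \<open>0 < ell\<close>]]
  have "integral\<^sup>L (leb ell) (\<lambda>x. f x * deriv \<phi> x) = integral\<^sup>L (leb ell) (\<lambda>x. f2 x * deriv \<phi> x)"
  proof (rule integral_cong_AE)
    show "AE x in leb ell. f x * deriv \<phi> x = f2 x * deriv \<phi> x"
      using assms(3) by eventually_elim simp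
  qed (use L2_integrable_mult[OF assms(1) d] L2_integrable_mult[OF assms(2) d] in auto)
  then show "integral\<^sup>L (leb ell) (\<lambda>x. f x * deriv \<phi> x) = - integral\<^sup>L (leb ell) (\<lambda>x. k x * \<phi> x)"
    using assms(4) t by (simp add: has_weak_deriv_iff)
qed

text \<open>
  One-sided derivatives at the end points, as in the definition of \<open>C2_on\<close>.
\<close>

definition classical_deriv :: "real \<Rightarrow> (real \<Rightarrow> real) \<Rightarrow> (real \<Rightarrow> real) \<Rightarrow> bool" where
  "classical_deriv ell f f' \<longleftrightarrow>
    (\<forall>x\<in>{0..ell}. (f has_real_derivative f' x) (at x within {0..ell}))"

lemma classical_deriv_continuous: "classical_deriv ell f f' \<Longrightarrow> continuous_on {0..ell} f"
  unfolding classical_deriv_def by (rule DERIV_continuous_on) blast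

lemma classical_has_weak_deriv:
  assumes "classical_deriv ell f f'" "continuous_on {0..ell} f'" "0 < ell"
  shows "has_weak_deriv ell f f'"
  unfolding has_weak_deriv_iff
  using integration_by_parts_test[OF _ assms(2) _ assms(3)] assms(1)
  by (simp add: classical_deriv_def)

lemma classical_wderiv:
  assumes "classical_deriv ell f f'" "continuous_on {0..ell} f'" "0 < ell"
  shows "wderiv ell f \<in> L2 ell" "has_weak_deriv ell f (wderiv ell f)" "AE x in leb ell. wderiv ell f x = f' x"
  using wderiv_spec[OF continuous_L2[OF assms(2)] classical_has_weak_deriv[OF assms]] by auto

lemma classical_H1:
  assumes "classical_deriv ell f f'" "continuous_on {0..ell} f'" "0 < ell"
  shows "f \<in> H1 ell"
  using continuous_L2[OF classical_deriv_continuous[OF assms(1)]] continuous_L2[OF assms(2)]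
    classical_has_weak_deriv[OF assms]
  by (auto simp: H1_def)

lemma classical_H2:
  assumes f: "classical_deriv ell f f'" "classical_deriv ell f' f''" "continuous_on {0..ell} f''" and ell: "0 < ell"
  shows "f \<in> H2 ell" "AE x in leb ell. wderiv ell (wderiv ell f) x = f'' x"
proof -
  note c = classical_deriv_continuous[OF f(2)]
  show "f \<in> H2 ell"
    unfolding H2_def using classical_H1[OF f(1) c ell] classical_H1[OF f(2,3) ell]
      classical_has_weak_deriv[OF f(1) c ell] by blast
  note w = classical_wderiv[OF f(1) c ell]
  have "has_weak_deriv ell (wderiv ell f) f''"
    by (rule has_weak_deriv_AE[OF w(1) continuous_L2[OF c] w(3) classical_has_weak_deriv[OF f(2,3) ell] ell])
  from wderiv_spec(3)[OF continuous_L2[OF f(3)] this]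
  show "AE x in leb ell. wderiv ell (wderiv ell f) x = f'' x" .
qed

text \<open>
  Subtracting from \<open>f\<close> a twofold primitive of \<open>k\<close> leaves a continuous function with vanishing
  second weak derivative. It is affine, so \<open>f\<close> inherits the regularity of the primitive.
\<close>

lemma H2_classical:
  assumes f: "f \<in> H2 ell" "continuous_on {0..ell} f" and k: "continuous_on {0..ell} k"
    and AE: "AE x in leb ell. wderiv ell (wderiv ell f) x = k x" and ell: "0 < ell"
  obtains f' where "classical_deriv ell f f'" "classical_deriv ell f' k"
proof -
  obtain f1 f2 where f1: "f1 \<in> L2 ell" "has_weak_deriv ell f f1" and f2: "f2 \<in> L2 ell" "has_weak_deriv ell f1 f2"
    using f(1) by (auto simp: H2_def H1_def)
  note w1 = wderiv_spec[OF f1]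
  have "has_weak_deriv ell (wderiv ell f) f2"
    by (rule has_weak_deriv_AE[OF w1(1) f1(1) w1(3) f2(2) ell])
  note w2 = wderiv_spec[OF f2(1) this]
  define K1 where "K1 = (\<lambda>x. integral {0..x} k)"
  define K where "K = (\<lambda>x. integral {0..x} K1)"
  have K1: "classical_deriv ell K1 k"
    unfolding classical_deriv_def K1_def using integral_has_real_derivative[OF k] by blast
  note cK1 = classical_deriv_continuous[OF K1]
  have K: "classical_deriv ell K K1"
    unfolding classical_deriv_def K_def using integral_has_real_derivative[OF cK1] by blast
  note cK = classical_deriv_continuous[OF K]
  have d: "continuous_on {0..ell} (\<lambda>x. f x - K x)" by (intro continuous_intros f(2) cK)
  obtain \<alpha> \<beta> where ab: "\<And>x. x \<in> {0..ell} \<Longrightarrow> f x - K x = \<alpha> + \<beta> * x"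
  proof (rule weak_second_derivative_zero[OF ell d])
    fix \<phi> assume t: "\<phi> \<in> test_functions ell"
    note t1 = test_deriv[OF t ell]
    note t2 = test_deriv[OF t1 ell]
    have "integral\<^sup>L (leb ell) (\<lambda>x. f x * deriv (deriv \<phi>) x) = integral\<^sup>L (leb ell) (\<lambda>x. wderiv ell (wderiv ell f) x * \<phi> x)"
      using w1(2) w2(2) t t1 by (simp add: has_weak_deriv_iff)
    also have "\<dots> = integral\<^sup>L (leb ell) (\<lambda>x. k x * \<phi> x)"
    proof (rule integral_cong_AE)
      show "AE x in leb ell. wderiv ell (wderiv ell f) x * \<phi> x = k x * \<phi> x"
        using AE by eventually_elim simp
    qed (use L2_integrable_mult[OF w2(1) test_L2[OF t]] L2_integrable_mult[OF continuous_L2[OF k] test_L2[OF t]] in auto)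
    also have "\<dots> = integral\<^sup>L (leb ell) (\<lambda>x. K x * deriv (deriv \<phi>) x)"
      using classical_has_weak_deriv[OF K cK1 ell] classical_has_weak_deriv[OF K1 k ell] t t1
      by (simp add: has_weak_deriv_iff)
    finally have eq: "integral\<^sup>L (leb ell) (\<lambda>x. f x * deriv (deriv \<phi>) x) = integral\<^sup>L (leb ell) (\<lambda>x. K x * deriv (deriv \<phi>) x)" .
    have "integral\<^sup>L (leb ell) (\<lambda>x. (f x - K x) * deriv (deriv \<phi>) x)
      = integral\<^sup>L (leb ell) (\<lambda>x. deriv (deriv \<phi>) x * (f x - 1 * K x))"
      by (simp add: mult.commute)
    also have "\<dots> = 0"
      using eq unfolding L2_integral_lincomb[OF test_L2[OF t2] continuous_L2[OF f(2)] continuous_L2[OF cK]]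
      by (simp add: mult.commute)
    finally show "integral\<^sup>L (leb ell) (\<lambda>x. (f x - K x) * deriv (deriv \<phi>) x) = 0" .
  qed blast
  have fK: "f x = K x + (\<alpha> + \<beta> * x)" if "x \<in> {0..ell}" for x using ab[OF that] by simp
  show thesis
  proof (rule that[of "\<lambda>x. K1 x + \<beta>"])
    show "classical_deriv ell f (\<lambda>x. K1 x + \<beta>)"
      unfolding classical_deriv_def
    proof
      fix x assume x: "x \<in> {0..ell}"
      have "((\<lambda>x. K x + (\<alpha> + \<beta> * x)) has_real_derivative K1 x + \<beta>) (at x within {0..ell})"
        using K x unfolding classical_deriv_def by (auto intro!: derivative_eq_intros)
      then show "(f has_real_derivative K1 x + \<beta>) (at x within {0..ell})"
        by (rule has_field_derivative_transform_within[where d = 1]) (use x fK in auto)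
    qed
    show "classical_deriv ell (\<lambda>x. K1 x + \<beta>) k"
      using K1 unfolding classical_deriv_def by (auto intro!: derivative_eq_intros)
  qed
qed

text \<open>
  For a test function \<open>\<phi>\<close> the integral of \<open>(\<eta> \<phi>)'\<close> vanishes for every \<open>\<eta>\<close>. In the limit the integral
  of \<open>(\<eta> f)'\<close> vanishes too; the choices \<open>\<eta> = 1\<close> and \<open>\<eta> = x\<close> separate the two ends.
\<close>

lemma H10_boundary:
  assumes f: "f \<in> H10 ell" and d: "classical_deriv ell f f'" "continuous_on {0..ell} f'" and ell: "0 < ell"
  shows "f 0 = 0" "f ell = 0"
proof -
  obtain \<phi> where \<phi>: "\<And>n. \<phi> n \<in> test_functions ell"
    "(\<lambda>n. norm_L2 ell (\<lambda>x. \<phi> n x - f x)) \<longlonglongrightarrow> 0"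
    "(\<lambda>n. norm_L2 ell (\<lambda>x. deriv (\<phi> n) x - wderiv ell f x)) \<longlonglongrightarrow> 0"
    using f by (auto simp: H10_def)
  note w = classical_wderiv[OF d ell]
  note cf = classical_deriv_continuous[OF d(1)]
  have key: "\<eta> ell * f ell - \<eta> 0 * f 0 = 0"
    if \<eta>: "classical_deriv ell \<eta> \<eta>'" "continuous_on {0..ell} \<eta>'" for \<eta> \<eta>'
  proof -
    note c\<eta> = classical_deriv_continuous[OF \<eta>(1)]
    have l1: "(\<lambda>n. integral\<^sup>L (leb ell) (\<lambda>x. (\<phi> n x - f x) * \<eta>' x)) \<longlonglongrightarrow> 0"
      by (rule tendsto_inner_L2[OF ell L2_diff[OF test_L2[OF \<phi>(1)] continuous_L2[OF cf]] \<eta>(2) \<phi>(2)])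
    have l2: "(\<lambda>n. integral\<^sup>L (leb ell) (\<lambda>x. (deriv (\<phi> n) x - wderiv ell f x) * \<eta> x)) \<longlonglongrightarrow> 0"
      by (rule tendsto_inner_L2[OF ell L2_diff[OF test_L2[OF test_deriv[OF \<phi>(1) ell]] w(1)] c\<eta> \<phi>(3)])
    have ftc: "integral {0..ell} (\<lambda>x. \<eta> x * f' x + \<eta>' x * f x) = \<eta> ell * f ell - \<eta> 0 * f 0"
    proof (rule integral_unique, rule fundamental_theorem_of_calculus)
      fix x assume x: "x \<in> {0..ell}"
      from DERIV_mult[of \<eta> "\<eta>' x" x "{0..ell}" f "f' x"] \<eta>(1) d(1) x
      show "((\<lambda>x. \<eta> x * f x) has_vector_derivative \<eta> x * f' x + \<eta>' x * f x) (at x within {0..ell})"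
        by (simp add: classical_deriv_def has_real_derivative_iff_has_vector_derivative algebra_simps)
    qed (use ell in simp)
    have eq: "integral\<^sup>L (leb ell) (\<lambda>x. (deriv (\<phi> n) x - wderiv ell f x) * \<eta> x) + integral\<^sup>L (leb ell) (\<lambda>x. (\<phi> n x - f x) * \<eta>' x)
      = - (\<eta> ell * f ell - \<eta> 0 * f 0)" for n
    proof -
      note t = \<phi>(1)[of n] and t1 = test_deriv[OF \<phi>(1)[of n] ell]
      note L = continuous_L2[OF c\<eta>] continuous_L2[OF \<eta>(2)] continuous_L2[OF cf] continuous_L2[OF d(2)] test_L2[OF t] test_L2[OF t1]
      have "integral\<^sup>L (leb ell) (\<lambda>x. wderiv ell f x * \<eta> x) = integral\<^sup>L (leb ell) (\<lambda>x. f' x * \<eta> x)"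
      proof (rule integral_cong_AE)
        show "AE x in leb ell. wderiv ell f x * \<eta> x = f' x * \<eta> x" using w(3) by eventually_elim simp
      qed (use L2_integrable_mult[OF w(1) L(1)] L2_integrable_mult[OF L(4) L(1)] in auto)
      then have 1: "integral\<^sup>L (leb ell) (\<lambda>x. (deriv (\<phi> n) x - wderiv ell f x) * \<eta> x)
        = integral\<^sup>L (leb ell) (\<lambda>x. \<eta> x * deriv (\<phi> n) x) - integral\<^sup>L (leb ell) (\<lambda>x. \<eta> x * f' x)"
        using L2_integral_lincomb[OF L(1) L(6) w(1), of 1] by (simp add: mult.commute)
      have 2: "integral\<^sup>L (leb ell) (\<lambda>x. (\<phi> n x - f x) * \<eta>' x)
        = integral\<^sup>L (leb ell) (\<lambda>x. \<eta>' x * \<phi> n x) - integral\<^sup>L (leb ell) (\<lambda>x. \<eta>' x * f x)"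
        using L2_integral_lincomb[OF L(2) L(5) L(3), of 1] by (simp add: mult.commute)
      have 3: "integral\<^sup>L (leb ell) (\<lambda>x. \<eta> x * deriv (\<phi> n) x) = - integral\<^sup>L (leb ell) (\<lambda>x. \<eta>' x * \<phi> n x)"
        using classical_has_weak_deriv[OF \<eta> ell] t by (simp add: has_weak_deriv_iff)
      have "integral\<^sup>L (leb ell) (\<lambda>x. \<eta> x * f' x) + integral\<^sup>L (leb ell) (\<lambda>x. \<eta>' x * f x)
        = integral\<^sup>L (leb ell) (\<lambda>x. \<eta> x * f' x + \<eta>' x * f x)"
        using L2_integrable_mult[OF L(1) L(4)] L2_integrable_mult[OF L(2) L(3)] by simp
      also have "\<dots> = \<eta> ell * f ell - \<eta> 0 * f 0"
        unfolding ftc[symmetric] by (rule continuous_Icc_lebesgue(2)) (intro continuous_intros c\<eta> \<eta> d cf)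
      finally show ?thesis using 1 2 3 by simp
    qed
    have "(\<lambda>n::nat. - (\<eta> ell * f ell - \<eta> 0 * f 0)) \<longlonglongrightarrow> 0"
      using tendsto_add[OF l2 l1] unfolding eq by simp
    then show ?thesis by (simp add: LIMSEQ_const_iff)
  qed
  have "1 * f ell - 1 * f 0 = 0"
    using key[of "\<lambda>x. 1" "\<lambda>x. 0"] by (simp add: classical_deriv_def)
  moreover have "ell * f ell - 0 * f 0 = 0"
    using key[of "\<lambda>x. x" "\<lambda>x. 1"] by (simp add: classical_deriv_def)
  ultimately show "f 0 = 0" "f ell = 0" using ell by auto
qed

text \<open>
  It suffices to approximate \<open>f'\<close>, whose integral is zero, by test functions \<open>\<psi>\<close> with integral
  zero, and to take their primitives. With polynomials \<open>p\<close> close to \<open>f'\<close> and bumps \<open>\<zeta>\<close> exhausting the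
  interval, \<open>\<psi> = \<zeta> (p - c)\<close> will do; the constant \<open>c\<close> that makes the integral zero tends to the mean
  of \<open>f'\<close>, which is zero. All limits are by dominated convergence.
\<close>

lemma classical_H10:
  assumes f: "classical_deriv ell f f'" "continuous_on {0..ell} f'" and ell: "0 < ell"
    and bd: "f 0 = 0" "f ell = 0"
  shows "f \<in> H10 ell"
proof -
  have "\<exists>p. real_polynomial_function p \<and> (\<forall>x\<in>{0..ell}. \<bar>f' x - p x\<bar> < 1 / real (Suc n))" for n
    using Stone_Weierstrass_real_polynomial_function[OF compact_Icc f(2), of "1 / real (Suc n)"]
    by (metis of_nat_0_less_iff zero_less_Suc zero_less_divide_1_iff)
  then obtain p where p: "\<And>n. real_polynomial_function (p n)"
    "\<And>n x. x \<in> {0..ell} \<Longrightarrow> \<bar>f' x - p n x\<bar> < 1 / real (Suc n)"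
    by metis
  have "compact (f' ` {0..ell})" by (intro compact_continuous_image f(2) compact_Icc)
  then obtain F where F: "\<And>x. x \<in> {0..ell} \<Longrightarrow> \<bar>f' x\<bar> \<le> F"
    using compact_imp_bounded bounded_iff by (metis imageI real_norm_def)
  have p_bound: "\<bar>p n x\<bar> \<le> F + 1" if "x \<in> {0..ell}" for n x
  proof -
    have "1 / real (Suc n) \<le> 1" by simp
    then show ?thesis using F[OF that] p(2)[OF that, of n] by linarith
  qed
  have p_lim: "(\<lambda>n. p n x) \<longlonglongrightarrow> f' x" if "x \<in> {0..ell}" for x
  proof -
    have "(\<lambda>n. p n x - f' x) \<longlonglongrightarrow> 0"
    proof (rule Lim_null_comparison)
      show "\<forall>\<^sub>F n in sequentially. norm (p n x - f' x) \<le> 1 / real (Suc n)"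
        using p(2)[OF that] by (intro always_eventually) (auto simp: abs_minus_commute intro: less_imp_le)
      show "(\<lambda>n. 1 / real (Suc n)) \<longlonglongrightarrow> 0" by (rule LIMSEQ_Suc[OF lim_1_over_n])
    qed
    from tendsto_add[OF this tendsto_const[of "f' x"]] show ?thesis by simp
  qed
  define a where "a = (\<lambda>n. ell / (real n + 2))"
  define \<zeta> where "\<zeta> = (\<lambda>n. bump (a (Suc n)) (ell - a (Suc n)) (Suc n))"
  have a: "0 < a n" "ell - a n < ell" for n using ell by (auto simp: a_def)
  have a2: "a (Suc n) < ell - a (Suc n)" for n
    using divide_left_mono[of 3 "real (Suc n) + 2" ell] ell by (simp add: a_def)
  have \<zeta>_test: "\<zeta> n \<in> test_functions ell" for n unfolding \<zeta>_def by (rule test_bump[OF a])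
  have \<zeta>_cont: "continuous_on S (\<zeta> n)" for n S by (rule test_continuous[OF \<zeta>_test])
  have \<zeta>_pos: "integral {0..ell} (\<zeta> n) > 0" for n
    unfolding \<zeta>_def by (rule test_integral_pos[OF a(1) a2 a(2)]) simp
  have \<zeta>_bd: "0 \<le> \<zeta> n x" "\<zeta> n x \<le> 1" for n x unfolding \<zeta>_def by (rule bump_bounds)+
  have \<zeta>_lim: "(\<lambda>n. \<zeta> n x) \<longlonglongrightarrow> 1" if "0 < x" "x < ell" for x
  proof -
    have "(\<lambda>n. ell * (1 / real (Suc (Suc n)))) \<longlonglongrightarrow> ell * 0"
      by (intro tendsto_mult tendsto_const LIMSEQ_Suc lim_1_over_n)
    then have a0: "a \<longlonglongrightarrow> 0" by (simp add: a_def add.commute)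
    have "(\<lambda>n. bump (a n) (ell - a n) n x) \<longlonglongrightarrow> 1"
      by (rule bump_tendsto[OF a0 _ that]) (use tendsto_diff[OF tendsto_const a0, of ell] in simp)
    from LIMSEQ_Suc[OF this] show ?thesis by (simp add: \<zeta>_def)
  qed
  have p_cont: "continuous_on S (p n)" for n S by (rule smooth_continuous_on[OF smooth_polynomial[OF p(1)]])
  have dom: "(\<lambda>n. integral {0..ell} (s n)) \<longlonglongrightarrow> integral {0..ell} g"
    if c: "\<And>n. continuous_on {0..ell} (s n)" "continuous_on {0..ell} g"
      and lim: "\<And>x. 0 < x \<Longrightarrow> x < ell \<Longrightarrow> (\<lambda>n. s n x) \<longlonglongrightarrow> g x"
      and bd: "\<And>n x. 0 < x \<Longrightarrow> x < ell \<Longrightarrow> \<bar>s n x\<bar> \<le> K" for s :: "nat \<Rightarrow> real \<Rightarrow> real" and g K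
  proof -
    have "(\<lambda>n. integral\<^sup>L (leb ell) (s n)) \<longlonglongrightarrow> integral\<^sup>L (leb ell) g"
    proof (rule integral_dominated_convergence[where w = "\<lambda>x. K"])
      show "integrable (leb ell) (\<lambda>x. K)" by (rule continuous_Icc_lebesgue(1)) simp
      show "AE x in leb ell. (\<lambda>n. s n x) \<longlonglongrightarrow> g x" by (rule AE_lebI[OF lim])
      show "AE x in leb ell. norm (s n x) \<le> K" for n by (rule AE_lebI) (simp add: bd)
    qed (auto intro: continuous_Icc_lebesgue(3) c)
    then show ?thesis by (simp add: continuous_Icc_lebesgue(2) c)
  qed
  have f'_int: "integral {0..x} f' = f x" if "x \<in> {0..ell}" for x
  proof -
    have "(f' has_integral f x - f 0) {0..x}"
    proof (rule fundamental_theorem_of_calculus)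
      fix t assume "t \<in> {0..x}"
      then have "(f has_real_derivative f' t) (at t within {0..ell})" using f(1) that by (simp add: classical_deriv_def)
      then have "(f has_real_derivative f' t) (at t within {0..x})" by (rule DERIV_subset) (use that in auto)
      then show "(f has_vector_derivative f' t) (at t within {0..x})"
        by (simp add: has_real_derivative_iff_has_vector_derivative)
    qed (use that in simp)
    then show ?thesis using bd by (simp add: integral_unique)
  qed
  define c where "c = (\<lambda>n. integral {0..ell} (\<lambda>x. \<zeta> n x * p n x) / integral {0..ell} (\<zeta> n))"
  have F0: "F \<ge> 0" using F[of 0] ell by auto
  have "(\<lambda>n. integral {0..ell} (\<lambda>x. \<zeta> n x * p n x)) \<longlonglongrightarrow> integral {0..ell} f'"
  proof (rule dom[where K = "F + 1"])
    fix x assume x: "0 < x" "x < ell"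
    show "(\<lambda>n. \<zeta> n x * p n x) \<longlonglongrightarrow> f' x" using tendsto_mult[OF \<zeta>_lim[OF x] p_lim[of x]] x by simp
    show "\<bar>\<zeta> n x * p n x\<bar> \<le> F + 1" for n
      using mult_mono[OF \<zeta>_bd(2)[of n x] p_bound[of x n]] x \<zeta>_bd(1)[of n x] F0 by (simp add: abs_mult)
  qed (intro continuous_intros \<zeta>_cont p_cont f(2))+
  then have num: "(\<lambda>n. integral {0..ell} (\<lambda>x. \<zeta> n x * p n x)) \<longlonglongrightarrow> 0"
    using f'_int[of ell] bd ell by simp
  have den: "(\<lambda>n. integral {0..ell} (\<zeta> n)) \<longlonglongrightarrow> integral {0..ell} (\<lambda>x. 1)"
    by (rule dom[where K = 1]) (auto intro: \<zeta>_lim \<zeta>_cont simp: \<zeta>_bd)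
  have c_lim: "c \<longlonglongrightarrow> 0"
    unfolding c_def using tendsto_divide[OF num den] ell by simp
  then have "Bseq c" by (rule convergent_imp_Bseq[OF convergentI])
  then obtain C where C: "\<And>n. \<bar>c n\<bar> \<le> C" unfolding Bseq_def by auto
  define \<psi> where "\<psi> = (\<lambda>n x. \<zeta> n x * (p n x - c n))"
  have \<psi>_test: "\<psi> n \<in> test_functions ell" for n
  proof (rule test_functionI[OF _ a(1) a(2)])
    have "smooth (\<lambda>x. \<zeta> n x * (p n x + (- c n)))"
      by (intro smooth_mult smooth_add smooth_const smooth_polynomial p(1) test_smooth[OF \<zeta>_test])
    then show "smooth (\<psi> n)" by (simp add: \<psi>_def)
    show "\<psi> n x = 0" if "x \<notin> {a (Suc n)..ell - a (Suc n)}" for x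
      using that bump_zero[of x "a (Suc n)" "ell - a (Suc n)" "Suc n"] by (force simp: \<psi>_def \<zeta>_def)
  qed
  have \<psi>_cont: "continuous_on S (\<psi> n)" for n S by (rule test_continuous[OF \<psi>_test])
  have \<psi>_zero: "integral {0..ell} (\<psi> n) = 0" for n
  proof -
    have "integral {0..ell} (\<psi> n) = integral {0..ell} (\<lambda>x. \<zeta> n x * p n x - c n * \<zeta> n x)"
      by (simp add: \<psi>_def algebra_simps)
    also have "\<dots> = integral {0..ell} (\<lambda>x. \<zeta> n x * p n x) - integral {0..ell} (\<lambda>x. c n * \<zeta> n x)"
      by (intro Henstock_Kurzweil_Integration.integral_diff integrable_continuous_real continuous_intros \<zeta>_cont p_cont)
    also have "\<dots> = 0" using \<zeta>_pos[of n] by (simp add: c_def)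
    finally show ?thesis .
  qed
  have "\<exists>\<phi>. \<phi> \<in> test_functions ell \<and> deriv \<phi> = \<psi> n \<and> (\<forall>x\<in>{0..ell}. \<phi> x = integral {0..x} (\<psi> n))" for n
    by (rule test_antideriv[OF \<psi>_test ell \<psi>_zero]) blast
  then obtain \<phi> where \<phi>: "\<And>n. \<phi> n \<in> test_functions ell" "\<And>n. deriv (\<phi> n) = \<psi> n"
    "\<And>n x. x \<in> {0..ell} \<Longrightarrow> \<phi> n x = integral {0..x} (\<psi> n)"
    by metis
  have diff_bound: "\<bar>\<psi> n x - f' x\<bar> \<le> 2 * F + 1 + C" if "0 < x" "x < ell" for n x
  proof -
    have "\<bar>\<psi> n x\<bar> \<le> 1 * (F + 1 + C)"
      unfolding \<psi>_def abs_mult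
      by (rule mult_mono) (use \<zeta>_bd[of n x] p_bound[of x n] C[of n] that in auto)
    then show ?thesis using F[of x] that by auto
  qed
  have diff_lim: "(\<lambda>n. \<psi> n x - f' x) \<longlonglongrightarrow> 0" if "0 < x" "x < ell" for x
  proof -
    have "(\<lambda>n. \<zeta> n x * (p n x - c n) - f' x) \<longlonglongrightarrow> 1 * (f' x - 0) - f' x"
      by (intro tendsto_intros \<zeta>_lim p_lim c_lim) (use that in auto)
    then show ?thesis by (simp add: \<psi>_def)
  qed
  have L1: "(\<lambda>n. integral {0..ell} (\<lambda>x. \<bar>\<psi> n x - f' x\<bar>)) \<longlonglongrightarrow> integral {0..ell} (\<lambda>x. 0)"
  proof (rule dom[where K = "2 * F + 1 + C"])
    show "(\<lambda>n. \<bar>\<psi> n x - f' x\<bar>) \<longlonglongrightarrow> 0" if "0 < x" "x < ell" for x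
      using tendsto_rabs[OF diff_lim[OF that]] by simp
  qed (use diff_bound in \<open>auto intro!: continuous_intros \<psi>_cont f(2)\<close>)
  have L2: "(\<lambda>n. integral {0..ell} (\<lambda>x. (\<psi> n x - f' x)\<^sup>2)) \<longlonglongrightarrow> integral {0..ell} (\<lambda>x. 0)"
  proof (rule dom[where K = "(2 * F + 1 + C)\<^sup>2"])
    show "(\<lambda>n. (\<psi> n x - f' x)\<^sup>2) \<longlonglongrightarrow> 0" if "0 < x" "x < ell" for x
      using tendsto_power[OF diff_lim[OF that], of 2] by simp
    show "\<bar>(\<psi> n x - f' x)\<^sup>2\<bar> \<le> (2 * F + 1 + C)\<^sup>2" if "0 < x" "x < ell" for n x
      using power_mono[OF diff_bound[OF that, of n], of 2] by simp
  qed (intro continuous_intros \<psi>_cont f(2))+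
  note cf = classical_deriv_continuous[OF f(1)] and w = classical_wderiv[OF f ell]
  have \<phi>_bound: "\<bar>\<phi> n x - f x\<bar> \<le> integral {0..ell} (\<lambda>x. \<bar>\<psi> n x - f' x\<bar>)" if "x \<in> {0..ell}" for n x
  proof -
    have cx: "continuous_on {0..x} f'" by (rule continuous_on_subset[OF f(2)]) (use that in auto)
    have "\<phi> n x - f x = integral {0..x} (\<lambda>x. \<psi> n x - f' x)"
      unfolding \<phi>(3)[OF that] f'_int[OF that, symmetric]
      by (rule Henstock_Kurzweil_Integration.integral_diff[symmetric]) (intro integrable_continuous_real \<psi>_cont cx)+
    also have "\<bar>\<dots>\<bar> \<le> integral {0..x} (\<lambda>x. \<bar>\<psi> n x - f' x\<bar>)"
      using integral_norm_bound_integral[of "\<lambda>x. \<psi> n x - f' x" "{0..x}" "\<lambda>x. \<bar>\<psi> n x - f' x\<bar>"]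
      by (simp add: integrable_continuous_real continuous_intros \<psi>_cont cx)
    also have "\<dots> \<le> integral {0..ell} (\<lambda>x. \<bar>\<psi> n x - f' x\<bar>)"
      by (rule integral_subset_le) (use that in \<open>auto intro!: integrable_continuous_real continuous_intros \<psi>_cont cx f(2)\<close>)
    finally show ?thesis .
  qed
  have "(\<lambda>n. norm_L2 ell (\<lambda>x. \<phi> n x - f x)) \<longlonglongrightarrow> 0"
  proof (rule Lim_null_comparison)
    let ?R = "\<lambda>n. integral {0..ell} (\<lambda>x. \<bar>\<psi> n x - f' x\<bar>)"
    have "norm_L2 ell (\<lambda>x. \<phi> n x - f x) \<le> sqrt (ell * (?R n)\<^sup>2)" for n
    proof -
      have "integral {0..ell} (\<lambda>x. (\<phi> n x - f x)\<^sup>2) \<le> integral {0..ell} (\<lambda>x. (?R n)\<^sup>2)"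
      proof (rule integral_le)
        fix x assume "x \<in> {0..ell}"
        from power_mono[OF \<phi>_bound[OF this], of n 2]
        show "(\<phi> n x - f x)\<^sup>2 \<le> (?R n)\<^sup>2" by simp
      qed (intro integrable_continuous_real continuous_intros test_continuous[OF \<phi>(1)] cf)+
      then show ?thesis
        unfolding norm_L2_real using ell
        by (subst continuous_Icc_lebesgue(2)) (auto intro!: continuous_intros test_continuous[OF \<phi>(1)] cf)
    qed
    then show "\<forall>\<^sub>F n in sequentially. norm (norm_L2 ell (\<lambda>x. \<phi> n x - f x)) \<le> sqrt (ell * (?R n)\<^sup>2)"
      by (intro always_eventually allI) (simp add: norm_L2_real)
    have "(\<lambda>n. sqrt (ell * (?R n)\<^sup>2)) \<longlonglongrightarrow> sqrt (ell * 0\<^sup>2)"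
      using L1 by (intro tendsto_intros) simp
    then show "(\<lambda>n. sqrt (ell * (?R n)\<^sup>2)) \<longlonglongrightarrow> 0" by simp
  qed
  moreover have "(\<lambda>n. norm_L2 ell (\<lambda>x. deriv (\<phi> n) x - wderiv ell f x)) \<longlonglongrightarrow> 0"
  proof -
    have "norm_L2 ell (\<lambda>x. deriv (\<phi> n) x - wderiv ell f x) = sqrt (integral {0..ell} (\<lambda>x. (\<psi> n x - f' x)\<^sup>2))" for n
    proof -
      have "integral\<^sup>L (leb ell) (\<lambda>x. (\<psi> n x - wderiv ell f x)\<^sup>2) = integral\<^sup>L (leb ell) (\<lambda>x. (\<psi> n x - f' x)\<^sup>2)"
      proof (rule integral_cong_AE)
        show "AE x in leb ell. (\<psi> n x - wderiv ell f x)\<^sup>2 = (\<psi> n x - f' x)\<^sup>2"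
          using w(3) by eventually_elim simp
      qed (use L2_diff[OF test_L2[OF \<psi>_test] w(1)] L2_diff[OF test_L2[OF \<psi>_test] continuous_L2[OF f(2)]] in
           \<open>auto simp: L2_real\<close>)
      also have "\<dots> = integral {0..ell} (\<lambda>x. (\<psi> n x - f' x)\<^sup>2)"
        by (rule continuous_Icc_lebesgue(2)) (intro continuous_intros \<psi>_cont f(2))
      finally show ?thesis unfolding norm_L2_real \<phi>(2) by simp
    qed
    then show ?thesis using tendsto_real_sqrt[OF L2] by simp
  qed
  ultimately show ?thesis
    using classical_H1[OF f ell] \<phi>(1) unfolding H10_def by blast
qed

section \<open>The eigenvalue equation as a classical boundary value problem\<close>

text \<open>
  The eigenvalue equation in the variable \<open>y = s x\<close>, on \<open>[0, L]\<close> and with inhomogeneities. With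
  \<open>P = V\<close>, \<open>Q = U\<close> it is the equation for the derivative of a solution \<open>(U, V)\<close> with respect to \<open>lam\<close>.
\<close>

definition ode_system :: "(real \<Rightarrow> real) \<Rightarrow> (real \<Rightarrow> real) \<Rightarrow> real \<Rightarrow> real \<Rightarrow> (real \<Rightarrow> real) \<Rightarrow> (real \<Rightarrow> real) \<Rightarrow>
    (real \<Rightarrow> real) \<Rightarrow> (real \<Rightarrow> real) \<Rightarrow> (real \<Rightarrow> real) \<Rightarrow> (real \<Rightarrow> real) \<Rightarrow> bool" where
  "ode_system g h lam L U U' V V' P Q \<longleftrightarrow>
     classical_deriv L U U' \<and> classical_deriv L U' (\<lambda>y. - g y * U y - lam * V y - P y) \<and>
     classical_deriv L V V' \<and> classical_deriv L V' (\<lambda>y. - h y * V y + lam * U y + Q y)"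

lemma classical_deriv_cong:
  "classical_deriv ell f f' \<Longrightarrow> (\<And>x. x \<in> {0..ell} \<Longrightarrow> f x = k x) \<Longrightarrow> (\<And>x. x \<in> {0..ell} \<Longrightarrow> f' x = k' x)
    \<Longrightarrow> classical_deriv ell k k'"
  unfolding classical_deriv_def
  by (metis has_field_derivative_transform_within zero_less_one)

lemma classical_deriv_shrink:
  assumes "classical_deriv ell f f'" "0 < s"
  shows "classical_deriv (s * ell) (\<lambda>y. f (y / s)) (\<lambda>y. f' (y / s) / s)"
  unfolding classical_deriv_def
proof
  fix y assume y: "y \<in> {0..s * ell}"
  have img: "(\<lambda>y. y / s) ` {0..s * ell} \<subseteq> {0..ell}" using assms(2) by (auto simp: field_simps)
  have "y / s \<in> {0..ell}" using img y by blast
  then have "(f has_real_derivative f' (y / s)) (at (y / s) within (\<lambda>y. y / s) ` {0..s * ell})"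
    using assms(1) DERIV_subset[OF _ img] unfolding classical_deriv_def by blast
  moreover have "((\<lambda>y. y / s) has_real_derivative 1 / s) (at y within {0..s * ell})"
    using assms(2) by (auto intro!: derivative_eq_intros)
  ultimately show "((\<lambda>y. f (y / s)) has_real_derivative f' (y / s) / s) (at y within {0..s * ell})"
    using DERIV_image_chain[of f _ "\<lambda>y. y / s" y "{0..s * ell}" "1 / s"] by (simp add: comp_def)
qed

lemma classical_deriv_stretch:
  assumes "classical_deriv (s * ell) U U'" "0 < s"
  shows "classical_deriv ell (\<lambda>x. U (s * x)) (\<lambda>x. s * U' (s * x))"
proof -
  have "classical_deriv ((1 / s) * (s * ell)) (\<lambda>y. U (y / (1 / s))) (\<lambda>y. U' (y / (1 / s)) / (1 / s))"
    by (rule classical_deriv_shrink[OF assms(1)]) (use assms(2) in simp)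
  then show ?thesis using assms(2) by (simp add: mult.commute)
qed

lemma classical_deriv_cmult: "classical_deriv L f f' \<Longrightarrow> classical_deriv L (\<lambda>x. c * f x) (\<lambda>x. c * f' x)"
  unfolding classical_deriv_def by (auto intro: DERIV_cmult)

lemma continuous_scaled:
  fixes p :: "real \<Rightarrow> real"
  assumes "continuous_on {0..s * ell} p" "0 < s" shows "continuous_on {0..ell} (\<lambda>x. p (s * x))"
  by (rule continuous_on_compose2[OF assms(1)]) (use assms(2) in \<open>auto intro!: continuous_intros\<close>)

text \<open>
  In an element of the domain, the equation expresses the second weak derivatives by continuous
  functions, so \<open>H2_classical\<close> applies; then \<open>y = s x\<close> divides second derivatives by \<open>s\<^sup>2\<close>.
\<close>

lemma solves_N_classical:
  assumes ell: "0 < ell" and s: "0 < s" and g: "continuous_on {0..s * ell} g" and h: "continuous_on {0..s * ell} h"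
    and f: "continuous_on {0..ell} (\<lambda>x. f x $ 1)" "continuous_on {0..ell} (\<lambda>x. f x $ 2)"
    and sol: "solves_N g h ell s (s\<^sup>2 * lam) w f"
  obtains U' V' where "ode_system g h lam (s * ell) (\<lambda>y. w (y / s) $ 1) U' (\<lambda>y. w (y / s) $ 2) V'
      (\<lambda>y. f (y / s) $ 2 / s\<^sup>2) (\<lambda>y. f (y / s) $ 1 / s\<^sup>2)"
    "w 0 = 0" "w ell = 0" "\<And>x. x \<notin> {0..ell} \<Longrightarrow> w x = 0"
proof -
  have w: "\<And>i. (\<lambda>x. w x $ i) \<in> H2 ell" "\<And>i. (\<lambda>x. w x $ i) \<in> H10 ell" "continuous_on {0..ell} w"
    "\<And>x. x \<notin> {0..ell} \<Longrightarrow> w x = 0"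
    using sol by (auto simp: solves_N_def dom_N_def)
  have cw: "continuous_on {0..ell} (\<lambda>x. w x $ i)" for i by (intro continuous_intros w(3))
  note gs = continuous_scaled[OF g s] and hs = continuous_scaled[OF h s]
  define k1 where "k1 = (\<lambda>x. - s\<^sup>2 * g (s * x) * w x $ 1 - s\<^sup>2 * lam * w x $ 2 - f x $ 2)"
  define k2 where "k2 = (\<lambda>x. - s\<^sup>2 * h (s * x) * w x $ 2 + s\<^sup>2 * lam * w x $ 1 + f x $ 1)"
  have ck: "continuous_on {0..ell} k1" "continuous_on {0..ell} k2"
    unfolding k1_def k2_def by (intro continuous_intros cw f gs hs)+
  have AE: "AE x in leb ell. N_op g h ell s w x - (s\<^sup>2 * lam) *\<^sub>R w x = f x"
    using sol by (simp add: solves_N_def)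
  have "AE x in leb ell. wderiv ell (wderiv ell (\<lambda>x. w x $ 1)) x = k1 x"
    using AE by eventually_elim (auto simp: vec_eq_iff forall_2 N_op_def schroed_def k1_def)
  then obtain u1 where u1: "classical_deriv ell (\<lambda>x. w x $ 1) u1" "classical_deriv ell u1 k1"
    using H2_classical[OF w(1) cw ck(1) _ ell] by blast
  have "AE x in leb ell. wderiv ell (wderiv ell (\<lambda>x. w x $ 2)) x = k2 x"
    using AE by eventually_elim (auto simp: vec_eq_iff forall_2 N_op_def schroed_def k2_def)
  then obtain u2 where u2: "classical_deriv ell (\<lambda>x. w x $ 2) u2" "classical_deriv ell u2 k2"
    using H2_classical[OF w(1) cw ck(2) _ ell] by blast
  have bd: "w 0 = 0" "w ell = 0"
    using H10_boundary[OF w(2) u1(1) classical_deriv_continuous[OF u1(2)] ell]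
      H10_boundary[OF w(2) u2(1) classical_deriv_continuous[OF u2(2)] ell]
    by (auto simp: vec_eq_iff forall_2)
  have second: "classical_deriv (s * ell) (\<lambda>y. u (y / s) / s) (\<lambda>y. k (y / s) / s\<^sup>2)"
    if "classical_deriv ell u k" for u k
    using classical_deriv_cmult[OF classical_deriv_shrink[OF that s], of "1 / s"]
    by (simp add: power2_eq_square mult.commute)
  show thesis
  proof (rule that[of "\<lambda>y. u1 (y / s) / s" "\<lambda>y. u2 (y / s) / s", OF _ bd w(4)])
    show "ode_system g h lam (s * ell) (\<lambda>y. w (y / s) $ 1) (\<lambda>y. u1 (y / s) / s) (\<lambda>y. w (y / s) $ 2) (\<lambda>y. u2 (y / s) / s)
      (\<lambda>y. f (y / s) $ 2 / s\<^sup>2) (\<lambda>y. f (y / s) $ 1 / s\<^sup>2)"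
      unfolding ode_system_def
    proof (intro conjI)
      show "classical_deriv (s * ell) (\<lambda>y. u1 (y / s) / s)
        (\<lambda>y. - g y * w (y / s) $ 1 - lam * w (y / s) $ 2 - f (y / s) $ 2 / s\<^sup>2)"
        by (rule classical_deriv_cong[OF second[OF u1(2)]]) (use s in \<open>auto simp: k1_def field_simps\<close>)
      show "classical_deriv (s * ell) (\<lambda>y. u2 (y / s) / s)
        (\<lambda>y. - h y * w (y / s) $ 2 + lam * w (y / s) $ 1 + f (y / s) $ 1 / s\<^sup>2)"
        by (rule classical_deriv_cong[OF second[OF u2(2)]]) (use s in \<open>auto simp: k2_def field_simps\<close>)
    qed (intro classical_deriv_shrink u1(1) u2(1) s)+
  qed
qed

lemma classical_solves_N:
  assumes ell: "0 < ell" and s: "0 < s" and g: "continuous_on {0..s * ell} g" and h: "continuous_on {0..s * ell} h"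
    and ode_system: "ode_system g h lam (s * ell) U U' V V' P Q" and c: "continuous_on {0..s * ell} P" "continuous_on {0..s * ell} Q"
    and bd: "U 0 = 0" "V 0 = 0" "U (s * ell) = 0" "V (s * ell) = 0"
    and f: "\<And>x. 0 < x \<Longrightarrow> x < ell \<Longrightarrow> f x $ 1 = s\<^sup>2 * Q (s * x)" "\<And>x. 0 < x \<Longrightarrow> x < ell \<Longrightarrow> f x $ 2 = s\<^sup>2 * P (s * x)"
    and w: "w = (\<lambda>x. if x \<in> {0..ell} then vector [U (s * x), V (s * x)] else 0)"
  shows "solves_N g h ell s (s\<^sup>2 * lam) w f"
proof -
  define k1 where "k1 = (\<lambda>x. s * (s * (- g (s * x) * U (s * x) - lam * V (s * x) - P (s * x))))"
  define k2 where "k2 = (\<lambda>x. s * (s * (- h (s * x) * V (s * x) + lam * U (s * x) + Q (s * x))))"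
  have w1: "w x $ 1 = U (s * x)" and w2: "w x $ 2 = V (s * x)" if "x \<in> {0..ell}" for x
    using that by (auto simp: w)
  note S = ode_system[unfolded ode_system_def]
  have "classical_deriv ell (\<lambda>x. U (s * x)) (\<lambda>x. s * U' (s * x))" "classical_deriv ell (\<lambda>x. V (s * x)) (\<lambda>x. s * V' (s * x))"
    using S by (auto intro: classical_deriv_stretch s)
  from this[THEN classical_deriv_cong]
  have d1: "classical_deriv ell (\<lambda>x. w x $ 1) (\<lambda>x. s * U' (s * x))" "classical_deriv ell (\<lambda>x. w x $ 2) (\<lambda>x. s * V' (s * x))"
    using w1 w2 by auto
  have d2: "classical_deriv ell (\<lambda>x. s * U' (s * x)) k1" "classical_deriv ell (\<lambda>x. s * V' (s * x)) k2"
    unfolding k1_def k2_def using S by (intro classical_deriv_cmult classical_deriv_stretch[OF _ s]; blast)+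
  have cUV: "continuous_on {0..s * ell} U" "continuous_on {0..s * ell} V"
    using S classical_deriv_continuous by blast+
  have ck: "continuous_on {0..ell} k1" "continuous_on {0..ell} k2"
    unfolding k1_def k2_def
    by (intro continuous_intros continuous_scaled[OF _ s] g h c cUV)+
  note c1 = d2[THEN classical_deriv_continuous]
  have b: "w 0 = 0" "w ell = 0" using bd ell by (auto simp: w vec_eq_iff forall_2)
  have H: "(\<lambda>x. w x $ 1) \<in> H2 ell" "(\<lambda>x. w x $ 2) \<in> H2 ell"
    "AE x in leb ell. wderiv ell (wderiv ell (\<lambda>x. w x $ 1)) x = k1 x"
    "AE x in leb ell. wderiv ell (wderiv ell (\<lambda>x. w x $ 2)) x = k2 x"
    using classical_H2[OF d1(1) d2(1) ck(1) ell] classical_H2[OF d1(2) d2(2) ck(2) ell] by auto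
  have H10: "(\<lambda>x. w x $ 1) \<in> H10 ell" "(\<lambda>x. w x $ 2) \<in> H10 ell"
    using classical_H10[OF d1(1) c1(1) ell] classical_H10[OF d1(2) c1(2) ell] b by auto
  have cw: "continuous_on {0..ell} w"
  proof -
    have "continuous_on {0..ell} (\<lambda>x. \<chi> i. w x $ i)"
      using d1[THEN classical_deriv_continuous]
      by (intro continuous_on_vec_lambda) (metis exhaust_2)
    then show ?thesis by simp
  qed
  have "w \<in> dom_N ell"
    unfolding dom_N_def using H(1,2) H10 cw by (auto simp: forall_2 w)
  moreover have "AE x in leb ell. N_op g h ell s w x - (s\<^sup>2 * lam) *\<^sub>R w x = f x"
  proof -
    have "AE x in leb ell. 0 < x \<and> x < ell" by (rule AE_lebI) simp
    with H(3,4) show ?thesis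
  proof eventually_elim
    case (elim x)
    then have x: "x \<in> {0..ell}" "0 < x" "x < ell" by auto
    show ?case
      using elim(1,2) f[OF x(2,3)]
      by (simp add: vec_eq_iff forall_2 N_op_def schroed_def k1_def k2_def w1[OF x(1)] w2[OF x(1)] power2_eq_square algebra_simps)
  qed
  qed
  ultimately show ?thesis by (simp add: solves_N_def)
qed

lemma vector_8_component:
  "(vector [a, b, c, d, e, f, g, h] :: real^8) $ 5 = e" "(vector [a, b, c, d, e, f, g, h] :: real^8) $ 6 = f"
  by (simp_all add: vector_def)

section \<open>Shooting\<close>

text \<open>
  The state \<open>(U, U', V, V')\<close> of the second order system as a first order system.
\<close>

type_synonym state = "real \<times> real \<times> real \<times> real"

definition st_u :: "state \<Rightarrow> real" where "st_u z = fst z"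
definition st_u' :: "state \<Rightarrow> real" where "st_u' z = fst (snd z)"
definition st_v :: "state \<Rightarrow> real" where "st_v z = fst (snd (snd z))"
definition st_v' :: "state \<Rightarrow> real" where "st_v' z = snd (snd (snd z))"

lemmas st_defs = st_u_def st_u'_def st_v_def st_v'_def

lemma st_bounded_linear: "bounded_linear st_u" "bounded_linear st_u'" "bounded_linear st_v" "bounded_linear st_v'"
  unfolding st_defs[abs_def]
  by (intro bounded_linear_compose[OF bounded_linear_fst] bounded_linear_compose[OF bounded_linear_snd]
      bounded_linear_fst bounded_linear_snd bounded_linear_ident)+

definition Shift :: "state \<Rightarrow>\<^sub>L state" where "Shift = Blinfun (\<lambda>z. (st_u' z, 0, st_v' z, 0))"
definition Pot1 :: "state \<Rightarrow>\<^sub>L state" where "Pot1 = Blinfun (\<lambda>z. (0, st_u z, 0, 0))"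
definition Pot2 :: "state \<Rightarrow>\<^sub>L state" where "Pot2 = Blinfun (\<lambda>z. (0, 0, 0, st_v z))"
definition Coupling :: "state \<Rightarrow>\<^sub>L state" where "Coupling = Blinfun (\<lambda>z. (0, - st_v z, 0, st_u z))"

text \<open>
  Chosen so that \<open>x \<bullet> Det z\<close> is the determinant of the \<open>(U, V)\<close>-components of \<open>x\<close> and \<open>z\<close>, and
  \<open>x \<bullet> Det' z\<close> the derivative of this determinant along the flow. Inner products with a linear map
  make the product rule available for both.
\<close>

definition Det :: "state \<Rightarrow>\<^sub>L state" where "Det = Blinfun (\<lambda>z. (st_v z, 0, - st_u z, 0))"
definition Det' :: "state \<Rightarrow>\<^sub>L state" where "Det' = Blinfun (\<lambda>z. (st_v' z, st_v z, - st_u' z, - st_u z))"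

lemma state_blinfuns:
  "blinfun_apply Shift z = (st_u' z, 0, st_v' z, 0)"
  "blinfun_apply Pot1 z = (0, st_u z, 0, 0)"
  "blinfun_apply Pot2 z = (0, 0, 0, st_v z)"
  "blinfun_apply Coupling z = (0, - st_v z, 0, st_u z)"
  "blinfun_apply Det z = (st_v z, 0, - st_u z, 0)"
  "blinfun_apply Det' z = (st_v' z, st_v z, - st_u' z, - st_u z)"
  unfolding Shift_def Pot1_def Pot2_def Coupling_def Det_def Det'_def
  by (subst bounded_linear_Blinfun_apply;
      intro bounded_linear_Pair st_bounded_linear bounded_linear_minus bounded_linear_zero refl)+

lemma inner_Det: "x \<bullet> blinfun_apply Det z = st_u x * st_v z - st_v x * st_u z"
  and inner_Det': "x \<bullet> blinfun_apply Det' z = st_u' x * st_v z + st_u x * st_v' z - st_v' x * st_u z - st_v x * st_u' z"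
  by (cases x; simp add: state_blinfuns inner_prod_def st_defs)+

definition has_partials :: "(real \<times> real \<Rightarrow> 'a::real_normed_vector) \<Rightarrow> 'a \<Rightarrow> 'a \<Rightarrow> real \<times> real \<Rightarrow> bool" where
  "has_partials f a b p \<longleftrightarrow> (f has_derivative (\<lambda>d. fst d *\<^sub>R a + snd d *\<^sub>R b)) (at p)"

lemma has_partials_inner:
  fixes a b :: "real \<times> real \<Rightarrow> 'a::real_inner" and J :: "'a \<Rightarrow>\<^sub>L 'a"
  assumes "has_partials a al as p" "has_partials b bl bs p"
  shows "has_partials (\<lambda>p. a p \<bullet> blinfun_apply J (b p))
    (al \<bullet> blinfun_apply J (b p) + a p \<bullet> blinfun_apply J bl)
    (as \<bullet> blinfun_apply J (b p) + a p \<bullet> blinfun_apply J bs) p"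
  using has_derivative_inner[OF assms(1)[unfolded has_partials_def]
      bounded_linear.has_derivative[OF blinfun.bounded_linear_right assms(2)[unfolded has_partials_def], of J]]
  unfolding has_partials_def
  by (rule has_derivative_eq_rhs)
     (auto simp: fun_eq_iff blinfun.add_right blinfun.scaleR_right inner_simps algebra_simps)

lemma has_partials_add: "has_partials f a b p \<Longrightarrow> has_partials f2 a2 b2 p \<Longrightarrow> has_partials (\<lambda>p. f p + f2 p) (a + a2) (b + b2) p"
  unfolding has_partials_def
  by (drule (1) has_derivative_add, erule has_derivative_eq_rhs) (auto simp: fun_eq_iff algebra_simps)

lemma has_partials_cmult: "has_partials f a b p \<Longrightarrow> has_partials (\<lambda>p. c *\<^sub>R f p) (c *\<^sub>R a) (c *\<^sub>R b) p"
  unfolding has_partials_def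
  by (drule has_derivative_scaleR_right, erule has_derivative_eq_rhs) (auto simp: fun_eq_iff algebra_simps)

lemma has_partials_swap: "has_partials f a b (snd p, fst p) \<Longrightarrow> has_partials (\<lambda>p. f (snd p, fst p)) b a p"
proof -
  assume f: "has_partials f a b (snd p, fst p)"
  have "((\<lambda>p. (snd p, fst p)) has_derivative (\<lambda>d :: real \<times> real. (snd d, fst d))) (at p)"
    by (intro has_derivative_Pair has_derivative_fst has_derivative_snd has_derivative_ident)
  from has_derivative_compose[OF this f[unfolded has_partials_def]]
  show ?thesis unfolding has_partials_def by (rule has_derivative_eq_rhs) (auto simp: fun_eq_iff)
qed

lemma has_partials_real: "has_partials f a b p \<Longrightarrow> (f has_derivative (\<lambda>d. a * fst d + b * snd d)) (at p)"
  for f :: "real \<times> real \<Rightarrow> real"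
  by (simp add: has_partials_def mult.commute)

locale shooting =
  fixes g h :: "real \<Rightarrow> real" and L :: real
  assumes L_pos: "0 < L" and g_cont: "continuous_on {0..L} g" and h_cont: "continuous_on {0..L} h"
begin

definition A :: "real \<Rightarrow> state \<Rightarrow>\<^sub>L state" where
  "A y = Shift - g y *\<^sub>R Pot1 - h y *\<^sub>R Pot2"

sublocale linear_family A Coupling L
  by unfold_locales (auto simp: L_pos A_def intro!: continuous_intros g_cont h_cont)

lemma field_components:
  "st_u (blinfun_apply (A y + l *\<^sub>R Coupling) z) = st_u' z"
  "st_u' (blinfun_apply (A y + l *\<^sub>R Coupling) z) = - g y * st_u z - l * st_v z"
  "st_v (blinfun_apply (A y + l *\<^sub>R Coupling) z) = st_v' z"
  "st_v' (blinfun_apply (A y + l *\<^sub>R Coupling) z) = - h y * st_v z + l * st_u z"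
  by (simp_all add: A_def blinfun.add_left blinfun.diff_left blinfun.scaleR_left state_blinfuns)
     (simp_all add: st_defs)

lemma solves_ode_system:
  assumes "solves l w b" "\<And>y. b y = (0, - P y, 0, Q y)"
  shows "ode_system g h l L (\<lambda>y. st_u (w y)) (\<lambda>y. st_u' (w y)) (\<lambda>y. st_v (w y)) (\<lambda>y. st_v' (w y)) P Q"
proof -
  have w: "(w has_vector_derivative blinfun_apply (A y + l *\<^sub>R Coupling) (w y) + b y) (at y within {0..L})"
    if "y \<in> {0..L}" for y
    using assms(1) that by (simp add: solves_def)
  have comp: "classical_deriv L (\<lambda>y. f (w y)) k"
    if f: "bounded_linear f" and k: "\<And>y. f (blinfun_apply (A y + l *\<^sub>R Coupling) (w y)) + f (b y) = k y" for f k
    unfolding classical_deriv_def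
  proof
    fix y assume "y \<in> {0..L}"
    from bounded_linear.has_vector_derivative[OF f w[OF this]]
    show "((\<lambda>y. f (w y)) has_real_derivative k y) (at y within {0..L})"
      by (simp add: has_real_derivative_iff_has_vector_derivative k linear_add[OF bounded_linear.linear[OF f]])
  qed
  show ?thesis
    unfolding ode_system_def
    by (intro conjI comp st_bounded_linear) (simp_all only: field_components assms(2), simp_all add: st_defs)
qed

lemma ode_system_solves:
  assumes "ode_system g h l L U U' V V' P Q"
  shows "solves l (\<lambda>y. (U y, U' y, V y, V' y)) (\<lambda>y. (0, - P y, 0, Q y))"
  unfolding solves_def
proof
  fix y assume y: "y \<in> {0..L}"
  have "((\<lambda>y. (U y, U' y, V y, V' y)) has_vector_derivative
      (U' y, - g y * U y - l * V y - P y, V' y, - h y * V y + l * U y + Q y)) (at y within {0..L})"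
    using assms y unfolding ode_system_def classical_deriv_def has_real_derivative_iff_has_vector_derivative
    by (intro has_vector_derivative_Pair) auto
  then show "((\<lambda>y. (U y, U' y, V y, V' y)) has_vector_derivative
      blinfun_apply (A y + l *\<^sub>R Coupling) (U y, U' y, V y, V' y) + (0, - P y, 0, Q y)) (at y within {0..L})"
    by (rule has_vector_derivative_eq_rhs)
       (simp add: prod_eq_iff field_components[unfolded st_defs] )
qed

lemma ode_system_unique:
  assumes "ode_system g h l L U U' V V' P Q" "ode_system g h l L X X' Y Y' P Q"
    "U 0 = X 0" "U' 0 = X' 0" "V 0 = Y 0" "V' 0 = Y' 0" "y \<in> {0..L}"
  shows "U y = X y" "U' y = X' y" "V y = Y y" "V' y = Y' y"
  using solution_unique[OF ode_system_solves[OF assms(1)] ode_system_solves[OF assms(2)] _ assms(7)] assms(3-6) by auto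

lemma has_partials_param:
  assumes z: "deriv_param z z1" "\<And>l. solves l (z l) (b l)" "continuous_on {0..L} (z1 l)"
    and y: "0 < s * ell" "s * ell < L"
  shows "has_partials (\<lambda>p. z (fst p) (snd p * ell)) (z1 l (s * ell))
    (ell *\<^sub>R (blinfun_apply (A (s * ell) + l *\<^sub>R Coupling) (z l (s * ell)) + b l (s * ell))) (l, s)"
proof -
  have yt: "(z l has_vector_derivative (blinfun_apply (A (s * ell) + l *\<^sub>R Coupling) (z l (s * ell)) + b l (s * ell)))
      (at (s * ell) within {0..L})"
    using z(2)[of l] y by (simp add: solves_def)
  have d: "((\<lambda>p. (fst p, snd p * ell)) has_derivative (\<lambda>d. (fst d, snd d * ell))) (at (l, s))"
    by (auto intro!: derivative_eq_intros)
  from has_derivative_param[OF z(1,3) _ yt] y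
  have "((\<lambda>p. z (fst p) (snd p)) has_derivative (\<lambda>d. fst d *\<^sub>R z1 l (s * ell) + snd d *\<^sub>R
     (blinfun_apply (A (s * ell) + l *\<^sub>R Coupling) (z l (s * ell)) + b l (s * ell)))) (at (fst (l, s), snd (l, s) * ell))"
    by simp
  from has_derivative_compose[OF d this] show ?thesis
    unfolding has_partials_def by (simp add: mult.commute)
qed

lemma continuous_param:
  assumes z: "lipschitz_param z" "\<And>l. continuous_on {0..L} (z l)"
  shows "continuous_on {p. 0 < snd p * ell \<and> snd p * ell < L} (\<lambda>p. z (fst p) (snd p * ell))"
  by (rule continuous_on_compose2[OF continuous_on_param[OF z], of _ "\<lambda>p. (fst p, snd p * ell)", simplified])
     (auto intro!: continuous_intros)

end

context shooting begin

text \<open>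
  Solutions for all values of the spectral parameter, with their first and second derivatives in it.
\<close>

definition family :: "(real \<Rightarrow> real \<Rightarrow> state) \<Rightarrow> (real \<Rightarrow> real \<Rightarrow> state) \<Rightarrow> (real \<Rightarrow> real \<Rightarrow> state) \<Rightarrow> bool" where
  "family z z1 z2 \<longleftrightarrow>
     (\<forall>l. solves l (z l) (\<lambda>t. 0)) \<and> (\<forall>l. solves l (z1 l) (\<lambda>t. blinfun_apply Coupling (z l t))) \<and>
     (\<forall>l. solves l (z2 l) (\<lambda>t. 2 *\<^sub>R blinfun_apply Coupling (z1 l t))) \<and>
     (\<forall>l. z1 l 0 = 0) \<and> (\<forall>l. z2 l 0 = 0) \<and>
     deriv_param z z1 \<and> deriv_param z1 z2 \<and> lipschitz_param z \<and> lipschitz_param z1 \<and> lipschitz_param z2"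

lemma family_exists: obtains z z1 z2 where "family z z1 z2" "\<And>l. z l 0 = c"
proof (rule solution_family[of c])
  fix z z1 z2
  assume *: "\<And>l. solves l (z l) (\<lambda>t. 0)" "\<And>l. z l 0 = c"
    "\<And>l. solves l (z1 l) (\<lambda>t. blinfun_apply Coupling (z l t))" "\<And>l. z1 l 0 = 0"
    "\<And>l. solves l (z2 l) (\<lambda>t. 2 *\<^sub>R blinfun_apply Coupling (z1 l t))" "\<And>l. z2 l 0 = 0"
    "deriv_param z z1" "deriv_param z1 z2" "lipschitz_param z" "lipschitz_param z1" "lipschitz_param z2"
  then have "family z z1 z2" by (simp add: family_def)
  then show thesis using that *(2) by blast
qed

text \<open>
  The derivative in the end point brings in the vector field, and hence \<open>g\<close> and \<open>h\<close>; but in \<open>Det'\<close>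
  only \<open>U, V, U', V'\<close> occur. So the first derivatives can be differentiated once more although the
  coefficients are only continuous.
\<close>

lemma determinant_C2:
  fixes ell :: real
  assumes a: "family a a1 a2" and b: "family b b1 b2"
  defines "W \<equiv> {p. 0 < snd p * ell \<and> snd p * ell < L}"
  shows "\<exists>Fl Fs Fll Fls Fsl Fss. (\<forall>p\<in>W.
     has_partials (\<lambda>p. a (fst p) (snd p * ell) \<bullet> blinfun_apply Det (b (fst p) (snd p * ell))) (Fl p) (Fs p) p \<and>
     has_partials Fl (Fll p) (Fls p) p \<and> has_partials Fs (Fsl p) (Fss p) p) \<and>
     continuous_on W Fll \<and> continuous_on W Fls \<and> continuous_on W Fsl \<and> continuous_on W Fss \<and>
     (\<forall>l s. Fl (l, s) = a1 l (s * ell) \<bullet> blinfun_apply Det (b l (s * ell)) + a l (s * ell) \<bullet> blinfun_apply Det (b1 l (s * ell))) \<and>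
     (\<forall>l s. Fs (l, s) = ell * (a l (s * ell) \<bullet> blinfun_apply Det' (b l (s * ell)))) \<and>
     (\<forall>l s. Fll (l, s) = a2 l (s * ell) \<bullet> blinfun_apply Det (b l (s * ell))
        + 2 * (a1 l (s * ell) \<bullet> blinfun_apply Det (b1 l (s * ell)))
        + a l (s * ell) \<bullet> blinfun_apply Det (b2 l (s * ell)))"
proof -
  define G where "G = (\<lambda>p. A (snd p * ell) + fst p *\<^sub>R Coupling)"
  define at_p where "at_p = (\<lambda>(z :: real \<Rightarrow> real \<Rightarrow> state) p. z (fst p) (snd p * ell))"
  define d0 where "d0 = (\<lambda>z p. ell *\<^sub>R blinfun_apply (G p) (at_p z p))"
  define d1 where "d1 = (\<lambda>z z1 p. ell *\<^sub>R (blinfun_apply (G p) (at_p z1 p) + blinfun_apply Coupling (at_p z p)))"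
  have v0: "has_partials (at_p z) (at_p z1 p) (d0 z p) p" and v1: "has_partials (at_p z1) (at_p z2 p) (d1 z z1 p) p"
    if "family z z1 z2" "p \<in> W" for z z1 z2 p
  proof -
    obtain l s where p: "p = (l, s)" by fastforce
    have y: "0 < s * ell" "s * ell < L" using that(2) by (auto simp: W_def p)
    note f = that(1)[unfolded family_def]
    have c: "continuous_on {0..L} (z1 l)" "continuous_on {0..L} (z2 l)"
      using f solves_continuous by blast+
    show "has_partials (at_p z) (at_p z1 p) (d0 z p) p"
      using has_partials_param[of z z1 "\<lambda>l t. 0" l s ell] f c y by (simp add: at_p_def d0_def G_def p)
    show "has_partials (at_p z1) (at_p z2 p) (d1 z z1 p) p"
      using has_partials_param[of z1 z2 "\<lambda>l t. blinfun_apply Coupling (z l t)" l s ell] f c y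
      by (simp add: at_p_def d1_def G_def p)
  qed
  have cont: "continuous_on W (at_p z)" "continuous_on W (at_p z1)" "continuous_on W (at_p z2)" if "family z z1 z2" for z z1 z2
    unfolding at_p_def W_def using that unfolding family_def
    by (intro continuous_param; meson solves_continuous)+
  have contG: "continuous_on W G"
  proof -
    have "continuous_on W (\<lambda>p. A (snd p * ell))"
      by (rule continuous_on_compose2[OF A_cont, of _ "\<lambda>p. snd p * ell"]) (auto simp: W_def intro!: continuous_intros)
    then show ?thesis unfolding G_def by (intro continuous_intros)
  qed
  have contd: "continuous_on W (d0 z)" "continuous_on W (d1 z z1)" if "family z z1 z2" for z z1 z2
    unfolding d0_def d1_def by (intro continuous_intros contG cont[OF that])+
  let ?D = "\<lambda>x y. x \<bullet> blinfun_apply Det y" and ?E = "\<lambda>x y. x \<bullet> blinfun_apply Det' y"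
  let ?a = "at_p a" and ?a1 = "at_p a1" and ?a2 = "at_p a2" and ?b = "at_p b" and ?b1 = "at_p b1" and ?b2 = "at_p b2"
  have first: "has_partials (\<lambda>p. ?D (?a p) (?b p)) (?D (?a1 p) (?b p) + ?D (?a p) (?b1 p)) (ell *\<^sub>R ?E (?a p) (?b p)) p"
    if "p \<in> W" for p
  proof -
    have fc: "st_u (blinfun_apply (G p) z) = st_u' z" "st_v (blinfun_apply (G p) z) = st_v' z" for z
      by (simp_all add: G_def field_components)
    have "?D (d0 a p) (?b p) + ?D (?a p) (d0 b p) = ell *\<^sub>R ?E (?a p) (?b p)"
      unfolding d0_def by (simp add: inner_Det inner_Det' blinfun.scaleR_right inner_simps fc algebra_simps
        linear_scale[OF bounded_linear.linear[OF st_bounded_linear(1)]] linear_scale[OF bounded_linear.linear[OF st_bounded_linear(3)]])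
    with has_partials_inner[OF v0[OF a that] v0[OF b that], of Det] show ?thesis by simp
  qed
  show ?thesis
  proof (intro exI conjI ballI allI)
    fix p assume p: "p \<in> W"
    note va = v0[OF a p] v1[OF a p] and vb = v0[OF b p] v1[OF b p]
    show "has_partials (\<lambda>p. a (fst p) (snd p * ell) \<bullet> blinfun_apply Det (b (fst p) (snd p * ell)))
      (?D (?a1 p) (?b p) + ?D (?a p) (?b1 p)) (ell *\<^sub>R ?E (?a p) (?b p)) p"
      using first[OF p] by (simp add: at_p_def)
    show "has_partials (\<lambda>p. ?D (?a1 p) (?b p) + ?D (?a p) (?b1 p))
      ((?D (?a2 p) (?b p) + ?D (?a1 p) (?b1 p)) + (?D (?a1 p) (?b1 p) + ?D (?a p) (?b2 p)))
      ((?D (d1 a a1 p) (?b p) + ?D (?a1 p) (d0 b p)) + (?D (d0 a p) (?b1 p) + ?D (?a p) (d1 b b1 p))) p"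
      by (intro has_partials_add has_partials_inner va vb)
    show "has_partials (\<lambda>p. ell *\<^sub>R ?E (?a p) (?b p))
      (ell *\<^sub>R (?E (?a1 p) (?b p) + ?E (?a p) (?b1 p))) (ell *\<^sub>R (?E (d0 a p) (?b p) + ?E (?a p) (d0 b p))) p"
      by (intro has_partials_cmult has_partials_inner va vb)
  qed (intro continuous_intros cont[OF a] cont[OF b] contd[OF a] contd[OF b] | simp add: at_p_def)+
qed

end

section \<open>Identities for classical solutions\<close>

lemma classical_deriv_subset:
  assumes "classical_deriv L f f'" "L' \<le> L" shows "classical_deriv L' f f'"
  unfolding classical_deriv_def
proof
  fix x assume "x \<in> {0..L'}"
  then have "(f has_real_derivative f' x) (at x within {0..L})"
    using assms by (auto simp: classical_deriv_def)
  then show "(f has_real_derivative f' x) (at x within {0..L'})"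
    by (rule DERIV_subset) (use assms(2) in auto)
qed

lemma ode_systemD:
  assumes "ode_system g h l L U U' V V' P Q" "y \<in> {0..L}"
  shows "(U has_real_derivative U' y) (at y within {0..L})"
    "(U' has_real_derivative - g y * U y - l * V y - P y) (at y within {0..L})"
    "(V has_real_derivative V' y) (at y within {0..L})"
    "(V' has_real_derivative - h y * V y + l * U y + Q y) (at y within {0..L})"
  using assms by (simp_all add: ode_system_def classical_deriv_def)

lemma ode_system_subset: "ode_system g h l L U U' V V' P Q \<Longrightarrow> L' \<le> L \<Longrightarrow> ode_system g h l L' U U' V V' P Q"
  by (auto simp: ode_system_def intro: classical_deriv_subset)

lemma ode_system_cong:
  assumes "ode_system g h l L U U' V V' P Q" "\<And>y. y \<in> {0..L} \<Longrightarrow> P y = R y" "\<And>y. y \<in> {0..L} \<Longrightarrow> Q y = T y"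
  shows "ode_system g h l L U U' V V' R T"
  using assms by (simp add: ode_system_def classical_deriv_def)

lemma ode_system_continuous:
  assumes "ode_system g h l L U U' V V' P Q"
  shows "continuous_on {0..L} U" "continuous_on {0..L} V" "continuous_on {0..L} U'" "continuous_on {0..L} V'"
  using assms by (auto simp: ode_system_def intro: classical_deriv_continuous)

lemma ode_system_zero_initial:
  assumes ode_system: "ode_system g h l L U U' V V' P Q" and L: "0 < L"
    and zero: "\<And>y. y \<in> {0..L} \<Longrightarrow> U y = 0" "\<And>y. y \<in> {0..L} \<Longrightarrow> V y = 0"
  shows "U' 0 = 0" "V' 0 = 0"
proof -
  have 0: "0 \<in> {0..L}" using L by simp
  have at0: "(at 0 within {0..L}) \<noteq> bot"
    using L by (simp add: trivial_limit_within islimpt_Icc)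
  have zero_deriv: "D = 0" if "(f has_real_derivative D) (at 0 within {0..L})" "\<And>y. y \<in> {0..L} \<Longrightarrow> f y = 0" for f D
  proof -
    have "((\<lambda>y. 0) has_real_derivative D) (at 0 within {0..L})"
      by (rule has_field_derivative_transform_within[OF that(1) zero_less_one 0]) (use that(2) in auto)
    moreover have "((\<lambda>y. 0) has_real_derivative 0) (at 0 within {0..L})" by simp
    ultimately show ?thesis using at0 by (metis has_real_derivative_iff_has_vector_derivative vector_derivative_unique_within)
  qed
  show "U' 0 = 0" "V' 0 = 0"
    using zero_deriv[OF ode_systemD(1)[OF ode_system 0] zero(1)] zero_deriv[OF ode_systemD(3)[OF ode_system 0] zero(2)] by auto
qed

lemma ode_system_lincomb:
  assumes "ode_system g h l L U U' V V' P Q" "ode_system g h l L X X' Y Y' R T"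
  shows "ode_system g h l L (\<lambda>y. a * U y + b * X y) (\<lambda>y. a * U' y + b * X' y) (\<lambda>y. a * V y + b * Y y)
    (\<lambda>y. a * V' y + b * Y' y) (\<lambda>y. a * P y + b * R y) (\<lambda>y. a * Q y + b * T y)"
  unfolding ode_system_def classical_deriv_def
proof (intro conjI ballI)
  fix y assume y: "y \<in> {0..L}"
  note d = ode_systemD[OF assms(1) y] ode_systemD[OF assms(2) y]
  show "((\<lambda>y. a * U y + b * X y) has_real_derivative a * U' y + b * X' y) (at y within {0..L})"
    "((\<lambda>y. a * V y + b * Y y) has_real_derivative a * V' y + b * Y' y) (at y within {0..L})"
    by (intro DERIV_add DERIV_cmult d)+
  show "((\<lambda>y. a * U' y + b * X' y) has_real_derivative
      - g y * (a * U y + b * X y) - l * (a * V y + b * Y y) - (a * P y + b * R y)) (at y within {0..L})"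
    by (rule DERIV_cong[OF DERIV_add[OF DERIV_cmult[OF d(2)] DERIV_cmult[OF d(6)]]]) (simp add: algebra_simps)
  show "((\<lambda>y. a * V' y + b * Y' y) has_real_derivative
      - h y * (a * V y + b * Y y) + l * (a * U y + b * X y) + (a * Q y + b * T y)) (at y within {0..L})"
    by (rule DERIV_cong[OF DERIV_add[OF DERIV_cmult[OF d(4)] DERIV_cmult[OF d(8)]]]) (simp add: algebra_simps)
qed

text \<open>
  The terms with \<open>g\<close> and \<open>h\<close> cancel within the \<open>U\<close>- and the \<open>V\<close>-part, the terms with \<open>l\<close> between
  the two parts: this is the symmetry of \<open>S N\<^sub>s\<close>.
\<close>

lemma ode_system_lagrange:
  assumes "ode_system g h l L U U' V V' P Q" "ode_system g h l L X X' Y Y' R T"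
  shows "classical_deriv L (\<lambda>y. U' y * X y - U y * X' y - V' y * Y y + V y * Y' y)
    (\<lambda>y. U y * R y + V y * T y - P y * X y - Q y * Y y)"
  unfolding classical_deriv_def
proof
  fix y assume y: "y \<in> {0..L}"
  note d = ode_systemD[OF assms(1) y] ode_systemD[OF assms(2) y]
  show "((\<lambda>y. U' y * X y - U y * X' y - V' y * Y y + V y * Y' y) has_real_derivative
      U y * R y + V y * T y - P y * X y - Q y * Y y) (at y within {0..L})"
    by (rule DERIV_cong, (rule d derivative_intros)+) (simp add: algebra_simps)
qed

text \<open>
  Multiplying the equations by \<open>y U'\<close> and \<open>y V'\<close> generates \<open>y g'\<close> and \<open>y h'\<close>, as differentiating
  \<open>s\<^sup>2 g (s x)\<close> in \<open>s\<close> does. The terms \<open>U U' - V V'\<close> trade the kinetic energies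
  \<open>U'\<^sup>2\<close> and \<open>V'\<^sup>2\<close> for potential ones.
\<close>

lemma ode_system_virial:
  assumes "ode_system g h l L U U' V V' (\<lambda>y. 0) (\<lambda>y. 0)" "classical_deriv L g g'" "classical_deriv L h h'"
  shows "classical_deriv L
    (\<lambda>y. y * ((V' y)\<^sup>2 + h y * (V y)\<^sup>2 - (U' y)\<^sup>2 - g y * (U y)\<^sup>2) - 2 * l * (y * (U y * V y)) + U y * U' y - V y * V' y)
    (\<lambda>y. (2 * h y + y * h' y) * (V y)\<^sup>2 - (2 * g y + y * g' y) * (U y)\<^sup>2 - 4 * l * (U y * V y))"
  unfolding classical_deriv_def
proof
  fix y assume y: "y \<in> {0..L}"
  have gh: "(g has_real_derivative g' y) (at y within {0..L})" "(h has_real_derivative h' y) (at y within {0..L})"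
    using assms(2,3) y by (auto simp: classical_deriv_def)
  note d = ode_systemD[OF assms(1) y] gh
  show "((\<lambda>y. y * ((V' y)\<^sup>2 + h y * (V y)\<^sup>2 - (U' y)\<^sup>2 - g y * (U y)\<^sup>2) - 2 * l * (y * (U y * V y)) + U y * U' y - V y * V' y)
      has_real_derivative (2 * h y + y * h' y) * (V y)\<^sup>2 - (2 * g y + y * g' y) * (U y)\<^sup>2 - 4 * l * (U y * V y)) (at y within {0..L})"
    unfolding power2_eq_square
    by (rule DERIV_cong, (rule d derivative_intros)+) (simp add: algebra_simps)
qed

lemma integral_stretch:
  assumes "classical_deriv (s * ell) W W'" "0 < s" "0 \<le> ell"
  shows "((\<lambda>x. W' (s * x)) has_integral (W (s * ell) - W 0) / s) {0..ell}"
proof -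
  have d: "classical_deriv ell (\<lambda>x. (1 / s) * W (s * x)) (\<lambda>x. (1 / s) * (s * W' (s * x)))"
    by (intro classical_deriv_cmult classical_deriv_stretch assms)
  have "((\<lambda>x. (1 / s) * (s * W' (s * x))) has_integral (1 / s) * W (s * ell) - (1 / s) * W (s * 0)) {0..ell}"
    by (rule fundamental_theorem_of_calculus)
       (use d assms(3) in \<open>auto simp: classical_deriv_def simp flip: has_real_derivative_iff_has_vector_derivative\<close>)
  then show ?thesis using assms(2) by (simp add: diff_divide_distrib)
qed

lemma C2_on_classical_deriv:
  assumes "C2_on {0..L} g" obtains g' where "classical_deriv L g g'" "continuous_on {0..L} g'"
proof -
  obtain g' g'' where d: "\<And>x. x \<in> {0..L} \<Longrightarrow> (g has_real_derivative g' x) (at x within {0..L})"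
    "\<And>x. x \<in> {0..L} \<Longrightarrow> (g' has_real_derivative g'' x) (at x within {0..L})"
    using assms unfolding C2_on_def by blast
  then show thesis using that[of g'] DERIV_continuous_on[OF d(2)] by (simp add: classical_deriv_def)
qed

lemma in_SpecI:
  assumes "solves_N g h ell s mu w (\<lambda>x. 0)" "solves_N g h ell s mu w' (\<lambda>x. 0)" "w \<noteq> w'"
  shows "mu \<in> Spec_N g h ell s"
proof -
  have "(\<lambda>x. 0) \<in> (L2 ell :: (real \<Rightarrow> real^2) set)" by (simp add: L2_def)
  then show ?thesis using assms unfolding Spec_N_def resolvent_N_def by blast
qed

lemma vector_derivative_component:
  fixes w :: "real \<Rightarrow> real^2"
  assumes "classical_deriv ell (\<lambda>x. w x $ 1) d1" "classical_deriv ell (\<lambda>x. w x $ 2) d2" "0 < ell" "x \<in> {0..ell}"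
  shows "vector_derivative w (at x within {0..ell}) = (vector [d1 x, d2 x] :: real^2)"
proof (rule vector_derivative_within_closed_interval[OF assms(3,4)])
  have "((\<lambda>x. w x $ 1 *\<^sub>R axis 1 1 + w x $ 2 *\<^sub>R axis (2::2) 1) has_vector_derivative d1 x *\<^sub>R axis 1 1 + d2 x *\<^sub>R axis (2::2) (1::real)) (at x within {0..ell})"
    using assms by (intro has_vector_derivative_add has_vector_derivative_scaleR[OF _ has_vector_derivative_const, THEN has_vector_derivative_eq_rhs])
      (auto simp: classical_deriv_def)
  moreover have "(\<lambda>x. w x $ 1 *\<^sub>R axis 1 1 + w x $ 2 *\<^sub>R axis (2::2) 1) = w"
    by (auto simp: fun_eq_iff vec_eq_iff forall_2 axis_def)
  moreover have "d1 x *\<^sub>R axis 1 1 + d2 x *\<^sub>R axis (2::2) 1 = vector [d1 x, d2 x]"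
    by (auto simp: vec_eq_iff forall_2 axis_def)
  ultimately show "(w has_vector_derivative vector [d1 x, d2 x]) (at x within {0..ell})" by simp
qed

section \<open>Spectrum, trace and crossing forms in terms of solutions\<close>

lemma S_mat_apply: "S_mat *v z = vector [z $ 2, z $ 1]"
  by (simp add: vec_eq_iff forall_2 S_mat_def matrix_vector_mult_def sum_2)

lemma inner_real2: "x \<bullet> y = x $ 1 * y $ 1 + x $ 2 * (y $ 2)" for x y :: "real^2"
  by (simp add: inner_vec_def sum_2)

lemma B_mat_derivative:
  assumes "(g has_real_derivative g') (at (s * x))" "(h has_real_derivative h') (at (s * x))"
  shows "dBs_mat g h s x *v z = vector [(2 * s * h (s * x) + s\<^sup>2 * (x * h')) * z $ 2, - (2 * s * g (s * x) + s\<^sup>2 * (x * g')) * z $ 1]"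
proof -
  define E12 where "E12 = (vector [vector [0, 1], vector [0, 0]] :: real^2^2)"
  define E21 where "E21 = (vector [vector [0, 0], vector [1, 0]] :: real^2^2)"
  have chain: "((\<lambda>r. r\<^sup>2 * p (r * x)) has_real_derivative 2 * s * p (s * x) + s\<^sup>2 * (x * p')) (at s)"
    if "(p has_real_derivative p') (at (s * x))" for p p'
  proof -
    have "((\<lambda>r. p (r * x)) has_real_derivative p' * x) (at s)"
      by (rule DERIV_chain'[of "\<lambda>r. r * x", OF _ that]) (auto intro!: derivative_eq_intros)
    then show ?thesis by (auto intro!: derivative_eq_intros)
  qed
  have B: "Bs_mat g h r x = (r\<^sup>2 * h (r * x)) *\<^sub>R E12 + (- (r\<^sup>2 * g (r * x))) *\<^sub>R E21" for r
    by (simp add: Bs_mat_def B_mat_def E12_def E21_def vec_eq_iff forall_2)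
  have "((\<lambda>r. Bs_mat g h r x) has_vector_derivative
      (2 * s * h (s * x) + s\<^sup>2 * (x * h')) *\<^sub>R E12 + (- (2 * s * g (s * x) + s\<^sup>2 * (x * g'))) *\<^sub>R E21) (at s)"
    unfolding B
    using has_vector_derivative_add[OF has_vector_derivative_scaleR[OF chain[OF assms(2)] has_vector_derivative_const[of E12]]
       has_vector_derivative_scaleR[OF DERIV_minus[OF chain[OF assms(1)]] has_vector_derivative_const[of E21]]]
    by simp
  then have "dBs_mat g h s x = (2 * s * h (s * x) + s\<^sup>2 * (x * h')) *\<^sub>R E12 + (- (2 * s * g (s * x) + s\<^sup>2 * (x * g'))) *\<^sub>R E21"
    unfolding dBs_mat_def by (rule vector_derivative_at)
  then show ?thesis
    by (simp add: vec_eq_iff forall_2 matrix_vector_mult_def sum_2 E12_def E21_def)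
qed

lemma inner_L2_S:
  "inner_L2 ell w (\<lambda>x. S_mat *v z x) = integral\<^sup>L (leb ell) (\<lambda>x. w x $ 1 * z x $ 2 + w x $ 2 * z x $ 1)"
  by (simp add: inner_L2_def S_mat_apply inner_real2)

lemma integral_leb_stretch:
  assumes "classical_deriv (s * ell) W W'" "continuous_on {0..s * ell} W'" "0 < s" "0 < ell"
    and f: "\<And>x. 0 < x \<Longrightarrow> x < ell \<Longrightarrow> f x = W' (s * x)"
  shows "integral\<^sup>L (leb ell) f = (W (s * ell) - W 0) / s"
proof -
  have "integral\<^sup>L (leb ell) f = integral\<^sup>L (leb ell) (\<lambda>x. W' (s * x))"
    by (rule Bochner_Integration.integral_cong[OF refl]) (simp add: f)
  also have "\<dots> = integral {0..ell} (\<lambda>x. W' (s * x))"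
    by (rule continuous_Icc_lebesgue(2)[OF continuous_scaled[OF assms(2,3)]])
  also have "\<dots> = (W (s * ell) - W 0) / s"
    by (rule integral_unique[OF integral_stretch[OF assms(1,3)]]) (use assms(4) in simp)
  finally show ?thesis .
qed

context shooting begin

lemma family_ode_system:
  assumes "family z z1 z2"
  shows "ode_system g h l L (\<lambda>y. st_u (z l y)) (\<lambda>y. st_u' (z l y)) (\<lambda>y. st_v (z l y)) (\<lambda>y. st_v' (z l y)) (\<lambda>y. 0) (\<lambda>y. 0)"
    "ode_system g h l L (\<lambda>y. st_u (z1 l y)) (\<lambda>y. st_u' (z1 l y)) (\<lambda>y. st_v (z1 l y)) (\<lambda>y. st_v' (z1 l y))
       (\<lambda>y. st_v (z l y)) (\<lambda>y. st_u (z l y))"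
    "ode_system g h l L (\<lambda>y. st_u (z2 l y)) (\<lambda>y. st_u' (z2 l y)) (\<lambda>y. st_v (z2 l y)) (\<lambda>y. st_v' (z2 l y))
       (\<lambda>y. 2 * st_v (z1 l y)) (\<lambda>y. 2 * st_u (z1 l y))"
proof -
  note f = assms[unfolded family_def]
  show "ode_system g h l L (\<lambda>y. st_u (z l y)) (\<lambda>y. st_u' (z l y)) (\<lambda>y. st_v (z l y)) (\<lambda>y. st_v' (z l y)) (\<lambda>y. 0) (\<lambda>y. 0)"
    by (rule solves_ode_system[of _ _ "\<lambda>t. 0"]) (use f in \<open>auto simp: zero_prod_def\<close>)
  show "ode_system g h l L (\<lambda>y. st_u (z1 l y)) (\<lambda>y. st_u' (z1 l y)) (\<lambda>y. st_v (z1 l y)) (\<lambda>y. st_v' (z1 l y))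
       (\<lambda>y. st_v (z l y)) (\<lambda>y. st_u (z l y))"
    by (rule solves_ode_system[of _ _ "\<lambda>t. blinfun_apply Coupling (z l t)"]) (use f in \<open>auto simp: state_blinfuns\<close>)
  show "ode_system g h l L (\<lambda>y. st_u (z2 l y)) (\<lambda>y. st_u' (z2 l y)) (\<lambda>y. st_v (z2 l y)) (\<lambda>y. st_v' (z2 l y))
       (\<lambda>y. 2 * st_v (z1 l y)) (\<lambda>y. 2 * st_u (z1 l y))"
    by (rule solves_ode_system[of _ _ "\<lambda>t. 2 *\<^sub>R blinfun_apply Coupling (z1 l t)"]) (use f in \<open>auto simp: state_blinfuns\<close>)
qed

text \<open>
  A vanishing determinant provides a nontrivial combination of the two solutions that vanishes at
  \<open>s ell\<close>. Its slope at \<open>0\<close> is not zero, so it is an eigenfunction other than zero and \<open>N\<^sub>s - s\<^sup>2 l\<close>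
  is not injective.
\<close>

lemma det_zero_Spec:
  assumes a: "family a a1 a2" "\<And>l. a l 0 = (0, p, 0, q)" and b: "family b b1 b2" "\<And>l. b l 0 = (0, - q, 0, p)"
    and pq: "\<not> (p = 0 \<and> q = 0)" and ell: "0 < ell" and s: "0 < s" "s * ell < L"
    and zero: "a l (s * ell) \<bullet> blinfun_apply Det (b l (s * ell)) = 0"
  shows "s\<^sup>2 * l \<in> Spec_N g h ell s"
proof -
  have det: "st_u (a l (s * ell)) * st_v (b l (s * ell)) = st_v (a l (s * ell)) * st_u (b l (s * ell))"
    using zero by (simp add: inner_Det)
  obtain \<alpha> \<beta> where ab: "\<not> (\<alpha> = 0 \<and> \<beta> = 0)" "\<alpha> * st_u (a l (s * ell)) + \<beta> * st_u (b l (s * ell)) = 0"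
    "\<alpha> * st_v (a l (s * ell)) + \<beta> * st_v (b l (s * ell)) = 0"
  proof -
    consider "\<not> (st_v (b l (s * ell)) = 0 \<and> st_v (a l (s * ell)) = 0)"
      | "st_v (b l (s * ell)) = 0" "st_v (a l (s * ell)) = 0" "\<not> (st_u (b l (s * ell)) = 0 \<and> st_u (a l (s * ell)) = 0)"
      | "st_v (b l (s * ell)) = 0" "st_v (a l (s * ell)) = 0" "st_u (b l (s * ell)) = 0" "st_u (a l (s * ell)) = 0"
      by blast
    then show ?thesis
    proof cases
      case 1
      then show ?thesis using det by (intro that[of "st_v (b l (s * ell))" "- st_v (a l (s * ell))"]) (auto simp: algebra_simps)
    next
      case 2
      then show ?thesis by (intro that[of "st_u (b l (s * ell))" "- st_u (a l (s * ell))"]) auto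
    next
      case 3
      then show ?thesis by (intro that[of 1 0]) auto
    qed
  qed
  define U where "U = (\<lambda>y. \<alpha> * st_u (a l y) + \<beta> * st_u (b l y))"
  define V where "V = (\<lambda>y. \<alpha> * st_v (a l y) + \<beta> * st_v (b l y))"
  define U' where "U' = (\<lambda>y. \<alpha> * st_u' (a l y) + \<beta> * st_u' (b l y))"
  define V' where "V' = (\<lambda>y. \<alpha> * st_v' (a l y) + \<beta> * st_v' (b l y))"
  have sysL: "ode_system g h l L U U' V V' (\<lambda>y. 0) (\<lambda>y. 0)"
    using ode_system_lincomb[OF family_ode_system(1)[OF a(1), of l] family_ode_system(1)[OF b(1), of l], of \<alpha> \<beta>]
    by (simp add: U_def V_def U'_def V'_def)
  have ode_system: "ode_system g h l (s * ell) U U' V V' (\<lambda>y. 0) (\<lambda>y. 0)"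
    by (rule ode_system_subset[OF sysL]) (use s in simp)
  have c: "continuous_on {0..s * ell} g" "continuous_on {0..s * ell} h"
    using s by (auto intro: continuous_on_subset[OF g_cont] continuous_on_subset[OF h_cont])
  have init: "U 0 = 0" "V 0 = 0" "U' 0 = \<alpha> * p - \<beta> * q" "V' 0 = \<alpha> * q + \<beta> * p"
    by (simp_all add: U_def V_def U'_def V'_def a(2) b(2) st_defs)
  have end0: "U (s * ell) = 0" "V (s * ell) = 0"
    using ab by (simp_all add: U_def V_def)
  define w where "w = (\<lambda>x. if x \<in> {0..ell} then vector [U (s * x), V (s * x)] else 0 :: real^2)"
  have w: "solves_N g h ell s (s\<^sup>2 * l) w (\<lambda>x. 0)"
    by (rule classical_solves_N[OF ell s(1) c ode_system _ _ init(1,2) end0 _ _ w_def]) auto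
  have w0: "solves_N g h ell s (s\<^sup>2 * l) (\<lambda>x. 0) (\<lambda>x. 0)"
    by (rule classical_solves_N[OF ell s(1) c, of _ "\<lambda>y. 0" "\<lambda>y. 0" "\<lambda>y. 0" "\<lambda>y. 0" "\<lambda>y. 0" "\<lambda>y. 0"])
       (auto simp: ode_system_def classical_deriv_def fun_eq_iff vec_eq_iff forall_2)
  have "w \<noteq> (\<lambda>x. 0)"
  proof
    assume w_zero: "w = (\<lambda>x. 0)"
    have UV: "U y = 0" "V y = 0" if y: "y \<in> {0..s * ell}" for y
    proof -
      have "w (y / s) = 0" using w_zero by simp
      moreover have "y / s \<in> {0..ell}" using y s(1) by (auto simp: field_simps)
      ultimately show "U y = 0" "V y = 0" using s(1) by (auto simp: w_def vec_eq_iff forall_2)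
    qed
    have "U' 0 = 0" "V' 0 = 0"
      using ode_system_zero_initial[OF ode_system _ UV] s(1) ell by simp_all
    then have e: "\<alpha> * p = \<beta> * q" "\<alpha> * q = - (\<beta> * p)" using init by auto
    have "\<alpha> * (p\<^sup>2 + q\<^sup>2) = (\<alpha> * p) * p + (\<alpha> * q) * q" by (simp add: power2_eq_square algebra_simps)
    also have "\<dots> = 0" unfolding e by simp
    finally have "\<alpha> = 0" using pq by (simp add: sum_power2_eq_zero_iff)
    then have "\<beta> * q = 0" "\<beta> * p = 0" using e by auto
    then show False using ab(1) pq \<open>\<alpha> = 0\<close> by auto
  qed
  then show ?thesis by (rule in_SpecI[OF w w0])
qed

end

lemma Tr_derivative_components:
  "Tr ell s w $ 5 = - (1 / s) * vector_derivative w (at 0 within {0..ell}) $ 1"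
  "Tr ell s w $ 6 = (1 / s) * vector_derivative w (at 0 within {0..ell}) $ 2"
  by (simp_all add: Tr_def Let_def vector_8_component)

text \<open>
  The fifth and sixth entries of the trace are, up to factors, the slopes at \<open>0\<close>, and these
  determine a solution with Dirichlet conditions at \<open>0\<close>.
\<close>

lemma Tr_inj_on_ker:
  assumes ell: "0 < ell" and s: "0 < s" and g: "continuous_on {0..s * ell} g" and h: "continuous_on {0..s * ell} h"
  shows "inj_on (Tr ell s) (ker_N g h ell s (s\<^sup>2 * lam))"
proof (rule inj_onI)
  interpret shooting g h "s * ell" by unfold_locales (use ell s g h in auto)
  have ker: "\<exists>U' V'. ode_system g h lam (s * ell) (\<lambda>y. w (y / s) $ 1) U' (\<lambda>y. w (y / s) $ 2) V' (\<lambda>y. 0) (\<lambda>y. 0) \<and>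
      w 0 = 0 \<and> (\<forall>x. x \<notin> {0..ell} \<longrightarrow> w x = 0) \<and> vector_derivative w (at 0 within {0..ell}) = vector [s * U' 0, s * V' 0]"
    if "w \<in> ker_N g h ell s (s\<^sup>2 * lam)" for w
  proof -
    have sol: "solves_N g h ell s (s\<^sup>2 * lam) w (\<lambda>x. 0)" using that by (simp add: ker_N_def)
    obtain U' V' where uv: "ode_system g h lam (s * ell) (\<lambda>y. w (y / s) $ 1) U' (\<lambda>y. w (y / s) $ 2) V' (\<lambda>y. 0) (\<lambda>y. 0)"
      "w 0 = 0" "\<And>x. x \<notin> {0..ell} \<Longrightarrow> w x = 0"
      by (rule solves_N_classical[OF ell s g h _ _ sol]) auto
    have "classical_deriv ell (\<lambda>x. w x $ 1) (\<lambda>x. s * U' (s * x))" "classical_deriv ell (\<lambda>x. w x $ 2) (\<lambda>x. s * V' (s * x))"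
      using uv(1) classical_deriv_stretch[of s ell "\<lambda>y. w (y / s) $ 1" U'] classical_deriv_stretch[of s ell "\<lambda>y. w (y / s) $ 2" V'] s
      by (auto simp: ode_system_def)
    from vector_derivative_component[OF this ell, of 0] ell uv show ?thesis by auto
  qed
  fix w1 w2 assume w: "w1 \<in> ker_N g h ell s (s\<^sup>2 * lam)" "w2 \<in> ker_N g h ell s (s\<^sup>2 * lam)" and eq: "Tr ell s w1 = Tr ell s w2"
  obtain U1 V1 where 1: "ode_system g h lam (s * ell) (\<lambda>y. w1 (y / s) $ 1) U1 (\<lambda>y. w1 (y / s) $ 2) V1 (\<lambda>y. 0) (\<lambda>y. 0)"
      "w1 0 = 0" "\<And>x. x \<notin> {0..ell} \<Longrightarrow> w1 x = 0" "vector_derivative w1 (at 0 within {0..ell}) = vector [s * U1 0, s * V1 0]"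
    using ker[OF w(1)] by blast
  obtain U2 V2 where 2: "ode_system g h lam (s * ell) (\<lambda>y. w2 (y / s) $ 1) U2 (\<lambda>y. w2 (y / s) $ 2) V2 (\<lambda>y. 0) (\<lambda>y. 0)"
      "w2 0 = 0" "\<And>x. x \<notin> {0..ell} \<Longrightarrow> w2 x = 0" "vector_derivative w2 (at 0 within {0..ell}) = vector [s * U2 0, s * V2 0]"
    using ker[OF w(2)] by blast
  have "Tr ell s w1 $ 5 = Tr ell s w2 $ 5" "Tr ell s w1 $ 6 = Tr ell s w2 $ 6" using eq by simp_all
  then have "U1 0 = U2 0" "V1 0 = V2 0" using s unfolding Tr_derivative_components 1(4) 2(4) by auto
  then have *: "w1 (y / s) $ 1 = w2 (y / s) $ 1" "w1 (y / s) $ 2 = w2 (y / s) $ 2" if "y \<in> {0..s * ell}" for y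
    using ode_system_unique(1,3)[OF 1(1) 2(1) _ _ _ _ that] 1(2) 2(2) by auto
  show "w1 = w2"
  proof
    fix x
    show "w1 x = w2 x"
    proof (cases "x \<in> {0..ell}")
      case True
      then show ?thesis using *[of "s * x"] s by (auto simp: vec_eq_iff forall_2)
    next
      case False
      then show ?thesis using 1(3) 2(3) by simp
    qed
  qed
qed

lemma kernel_of_trace_eq:
  assumes "0 < ell" "0 < s" "continuous_on {0..s * ell} g" "continuous_on {0..s * ell} h"
    "w \<in> ker_N g h ell s (s\<^sup>2 * lam)"
  shows "kernel_of_trace g h ell lam s (Tr ell s w) = w"
  unfolding kernel_of_trace_def by (rule inv_into_f_f[OF Tr_inj_on_ker[OF assms(1-4)] assms(5)])

section \<open>Crossing forms as derivatives of the determinant\<close>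

text \<open>
  A simple crossing: \<open>a\<close> continues the eigenfunction \<open>u\<close> to all values of the spectral parameter,
  and \<open>b\<close> starts with the orthogonal slope \<open>(- q, p)\<close>. That \<open>b\<close> does not satisfy the boundary
  condition at \<open>y0\<close> expresses that the kernel is one-dimensional.
\<close>

locale crossing = shooting +
  fixes ell lam0 s0 :: real and u :: "real \<Rightarrow> real^2" and a a1 a2 b b1 b2 :: "real \<Rightarrow> real \<Rightarrow> state" and p q :: real
  assumes ell: "0 < ell" and s0: "0 < s0" and s0_L: "s0 * ell < L"
    and fam_a: "family a a1 a2" "\<And>l. a l 0 = (0, p, 0, q)"
    and fam_b: "family b b1 b2" "\<And>l. b l 0 = (0, - q, 0, p)"
    and u_eq: "\<And>x. x \<in> {0..ell} \<Longrightarrow> u x = vector [st_u (a lam0 (s0 * x)), st_v (a lam0 (s0 * x))]"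
    and u_end: "st_u (a lam0 (s0 * ell)) = 0" "st_v (a lam0 (s0 * ell)) = 0"
    and b_end: "\<not> (st_u (b lam0 (s0 * ell)) = 0 \<and> st_v (b lam0 (s0 * ell)) = 0)"
begin

abbreviation "y0 \<equiv> s0 * ell"
abbreviation "Ua y \<equiv> st_u (a lam0 y)"
abbreviation "Ua' y \<equiv> st_u' (a lam0 y)"
abbreviation "Va y \<equiv> st_v (a lam0 y)"
abbreviation "Va' y \<equiv> st_v' (a lam0 y)"
abbreviation "Ub y \<equiv> st_u (b lam0 y)"
abbreviation "Ub' y \<equiv> st_u' (b lam0 y)"
abbreviation "Vb y \<equiv> st_v (b lam0 y)"
abbreviation "Vb' y \<equiv> st_v' (b lam0 y)"

lemma y0_pos: "0 < y0" using ell s0 by simp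

lemma cont_y0: "continuous_on {0..y0} g" "continuous_on {0..y0} h"
  using s0_L by (auto intro: continuous_on_subset[OF g_cont] continuous_on_subset[OF h_cont])

lemma sys_y0: "ode_system g h l L X X' Y Y' P Q \<Longrightarrow> ode_system g h l y0 X X' Y Y' P Q"
  using s0_L by (auto intro: ode_system_subset)

lemmas sys_a = family_ode_system(1)[OF fam_a(1), THEN sys_y0] and sys_a1 = family_ode_system(2)[OF fam_a(1), THEN sys_y0]
  and sys_a2 = family_ode_system(3)[OF fam_a(1), THEN sys_y0] and sys_b = family_ode_system(1)[OF fam_b(1), THEN sys_y0]
  and sys_b1 = family_ode_system(2)[OF fam_b(1), THEN sys_y0]

lemma initial:
  "Ua 0 = 0" "Va 0 = 0" "Ub 0 = 0" "Vb 0 = 0"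
  "st_u (a1 l 0) = 0" "st_v (a1 l 0) = 0" "st_u' (a1 l 0) = 0" "st_v' (a1 l 0) = 0"
  "st_u (a2 l 0) = 0" "st_v (a2 l 0) = 0" "st_u' (a2 l 0) = 0" "st_v' (a2 l 0) = 0"
  "st_u (b1 l 0) = 0" "st_v (b1 l 0) = 0"
  using fam_a fam_b by (simp_all add: family_def st_defs)

text \<open>
  The Lagrange identity for \<open>a\<close> and \<open>b\<close> leaves \<open>Ua' Ub = Va' Vb\<close> at \<open>y0\<close>, since all other
  boundary terms vanish.
\<close>

lemma kappa_exists: "\<exists>\<kappa>. Ua' y0 = \<kappa> * Vb y0 \<and> Va' y0 = \<kappa> * Ub y0"
proof -
  define W where "W = (\<lambda>y. Ua' y * Ub y - Ua y * Ub' y - Va' y * Vb y + Va y * Vb' y)"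
  have "classical_deriv y0 W (\<lambda>y. 0)"
    using ode_system_lagrange[OF sys_a[of lam0] sys_b[of lam0]] by (simp add: W_def)
  then have "((\<lambda>y. 0) has_integral W y0 - W 0) {0..y0}"
    using y0_pos by (intro fundamental_theorem_of_calculus)
      (auto simp: classical_deriv_def simp flip: has_real_derivative_iff_has_vector_derivative)
  then have "W y0 = W 0" by (simp add: has_integral_0_eq)
  then have eq: "Ua' y0 * Ub y0 = Va' y0 * Vb y0" using u_end initial by (simp add: W_def)
  show ?thesis
  proof (cases "Vb y0 = 0")
    case True
    then have "Ub y0 \<noteq> 0" using b_end by simp
    then show ?thesis using eq True by (intro exI[of _ "Va' y0 / Ub y0"]) simp
  next
    case False
    then show ?thesis using eq by (intro exI[of _ "Ua' y0 / Vb y0"]) (simp add: field_simps)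
  qed
qed

text \<open>
  The Lagrange identity for the eigenfunction and a solution of an inhomogeneous equation. It is used
  for the derivatives of the solutions in \<open>lam\<close>; the boundary term is \<open>\<kappa>\<close> times a determinant.
\<close>

lemma pairing:
  assumes X: "ode_system g h lam0 y0 X X' Y Y' R T" and R: "continuous_on {0..y0} R" "continuous_on {0..y0} T"
    and X0: "X 0 = 0" "Y 0 = 0"
    and k: "Ua' y0 = \<kappa> * Vb y0" "Va' y0 = \<kappa> * Ub y0"
    and f: "\<And>x. 0 < x \<Longrightarrow> x < ell \<Longrightarrow> f x = Ua (s0 * x) * R (s0 * x) + Va (s0 * x) * T (s0 * x)"
  shows "s0 * integral\<^sup>L (leb ell) f = \<kappa> * (X y0 * Vb y0 - Y y0 * Ub y0)"
proof -
  have "s0 * integral\<^sup>L (leb ell) f = s0 * (((Ua' y0 * X y0 - Ua y0 * X' y0 - Va' y0 * Y y0 + Va y0 * Y' y0)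
      - (Ua' 0 * X 0 - Ua 0 * X' 0 - Va' 0 * Y 0 + Va 0 * Y' 0)) / s0)"
    by (rule arg_cong[where f = "(*) s0"], rule integral_leb_stretch[OF ode_system_lagrange[OF sys_a X] _ s0 ell])
       (use ode_system_continuous[OF sys_a] ode_system_continuous[OF X] R f in \<open>auto intro!: continuous_intros\<close>)
  also have "\<dots> = \<kappa> * (X y0 * Vb y0 - Y y0 * Ub y0)"
    unfolding u_end initial X0 k using s0 by (simp add: field_simps)
  finally show ?thesis .
qed

text \<open>
  The first and second derivatives of the determinant at \<open>(lam0, s0)\<close>, in the form in which
  \<open>determinant_C2\<close> delivers them.
\<close>

definition Fl where "Fl = a1 lam0 y0 \<bullet> blinfun_apply Det (b lam0 y0) + a lam0 y0 \<bullet> blinfun_apply Det (b1 lam0 y0)"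
definition Fs where "Fs = ell * (a lam0 y0 \<bullet> blinfun_apply Det' (b lam0 y0))"
definition Fll where "Fll = a2 lam0 y0 \<bullet> blinfun_apply Det (b lam0 y0)
  + 2 * (a1 lam0 y0 \<bullet> blinfun_apply Det (b1 lam0 y0)) + a lam0 y0 \<bullet> blinfun_apply Det (b2 lam0 y0)"

lemma Fl_eq: "Fl = st_u (a1 lam0 y0) * Vb y0 - st_v (a1 lam0 y0) * Ub y0"
  by (simp add: Fl_def inner_Det u_end)

lemma u_components: "x \<in> {0..ell} \<Longrightarrow> u x $ 1 = Ua (s0 * x)" "x \<in> {0..ell} \<Longrightarrow> u x $ 2 = Va (s0 * x)"
  by (simp_all add: u_eq)

lemma crossing_lam:
  assumes k: "Ua' y0 = \<kappa> * Vb y0" "Va' y0 = \<kappa> * Ub y0"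
  shows "- s0 * inner_L2 ell u (\<lambda>x. S_mat *v u x) = - (\<kappa> * Fl)"
proof -
  have "s0 * integral\<^sup>L (leb ell) (\<lambda>x. u x $ 1 * u x $ 2 + u x $ 2 * u x $ 1) = \<kappa> * Fl"
    unfolding Fl_eq
    by (rule pairing[OF sys_a1 _ _ _ _ k])
       (use ode_system_continuous[OF sys_a[of lam0]] initial u_components in auto)
  then show ?thesis by (simp add: inner_L2_S)
qed

lemma crossing_s:
  assumes k: "Ua' y0 = \<kappa> * Vb y0" "Va' y0 = \<kappa> * Ub y0"
    and g': "classical_deriv L g g'" "continuous_on {0..L} g'" and h': "classical_deriv L h h'" "continuous_on {0..L} h'"
  shows "(1 / s0) * inner_L2 ell (\<lambda>x. dBs_mat g h s0 x *v u x - (2 * s0 * lam0) *\<^sub>R u x) (\<lambda>x. S_mat *v u x)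
    = - (\<kappa> * Fs)"
proof -
  define \<Theta> where "\<Theta> = (\<lambda>y. y * ((Va' y)\<^sup>2 + h y * (Va y)\<^sup>2 - (Ua' y)\<^sup>2 - g y * (Ua y)\<^sup>2)
    - 2 * lam0 * (y * (Ua y * Va y)) + Ua y * Ua' y - Va y * Va' y)"
  define \<theta> where "\<theta> = (\<lambda>y. (2 * h y + y * h' y) * (Va y)\<^sup>2 - (2 * g y + y * g' y) * (Ua y)\<^sup>2 - 4 * lam0 * (Ua y * Va y))"
  have gh: "classical_deriv y0 g g'" "classical_deriv y0 h h'" "continuous_on {0..y0} g'" "continuous_on {0..y0} h'"
    using g' h' s0_L by (auto intro: classical_deriv_subset continuous_on_subset)
  have \<Theta>: "classical_deriv y0 \<Theta> \<theta>"
    using ode_system_virial[OF sys_a gh(1,2)] by (simp add: \<Theta>_def \<theta>_def)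
  have c\<theta>: "continuous_on {0..y0} \<theta>"
    unfolding \<theta>_def by (intro continuous_intros cont_y0 gh ode_system_continuous[OF sys_a])
  have "(dBs_mat g h s0 x *v u x - (2 * s0 * lam0) *\<^sub>R u x) $ 1 * u x $ 2
      + (dBs_mat g h s0 x *v u x - (2 * s0 * lam0) *\<^sub>R u x) $ 2 * u x $ 1 = s0 * \<theta> (s0 * x)"
    if x: "0 < x" "x < ell" for x
  proof -
    have y: "0 < s0 * x" "s0 * x < L"
      using x s0 order_less_trans[OF mult_strict_left_mono[OF x(2) s0] s0_L] by simp_all
    have d: "(g has_real_derivative g' (s0 * x)) (at (s0 * x))" "(h has_real_derivative h' (s0 * x)) (at (s0 * x))"
      using g'(1) h'(1) y at_within_Icc_at[of 0 "s0 * x" L] unfolding classical_deriv_def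
      by (metis atLeastAtMost_iff less_imp_le)+
    have xe: "x \<in> {0..ell}" using x by simp
    show ?thesis
      unfolding B_mat_derivative[OF d] using u_components[OF xe]
      by (simp add: \<theta>_def power2_eq_square algebra_simps)
  qed
  then have "inner_L2 ell (\<lambda>x. dBs_mat g h s0 x *v u x - (2 * s0 * lam0) *\<^sub>R u x) (\<lambda>x. S_mat *v u x)
    = (s0 * \<Theta> y0 - s0 * \<Theta> 0) / s0"
    unfolding inner_L2_S
    by (intro integral_leb_stretch[OF classical_deriv_cmult[OF \<Theta>] _ s0 ell] continuous_intros c\<theta>)
  also have "\<dots> = s0 * (ell * ((\<kappa> * Ub y0)\<^sup>2 - (\<kappa> * Vb y0)\<^sup>2))"
    using s0 u_end initial k by (simp add: \<Theta>_def)
  finally have eq: "inner_L2 ell (\<lambda>x. dBs_mat g h s0 x *v u x - (2 * s0 * lam0) *\<^sub>R u x) (\<lambda>x. S_mat *v u x)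
    = s0 * (ell * ((\<kappa> * Ub y0)\<^sup>2 - (\<kappa> * Vb y0)\<^sup>2))" .
  show ?thesis
    unfolding eq Fs_def inner_Det' u_end k using s0 by (simp add: power2_eq_square algebra_simps)
qed

text \<open>
  A vanishing derivative of the determinant means that the values at \<open>y0\<close> of \<open>b\<close> and of the
  derivative of \<open>a\<close> are parallel. Then \<open>a1 - c b\<close> satisfies Dirichlet conditions at both ends and is,
  up to the factor \<open>s0\<^sup>2\<close>, a generalized eigenfunction.
\<close>

lemma proportional_end:
  assumes "Fl = 0" shows "\<exists>c. st_u (a1 lam0 y0) = c * Ub y0 \<and> st_v (a1 lam0 y0) = c * Vb y0"
proof (cases "Vb y0 = 0")
  case True
  then have "Ub y0 \<noteq> 0" using b_end by simp
  then show ?thesis using assms True unfolding Fl_eq by (intro exI[of _ "st_u (a1 lam0 y0) / Ub y0"]) simp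
next
  case False
  then show ?thesis using assms unfolding Fl_eq
    by (intro exI[of _ "st_v (a1 lam0 y0) / Vb y0"]) (simp add: field_simps)
qed

lemma generalized_eigenfunction_exists:
  assumes "Fl = 0" shows "\<exists>v. solves_N g h ell s0 (s0\<^sup>2 * lam0) v u"
proof -
  obtain c where c: "st_u (a1 lam0 y0) = c * Ub y0" "st_v (a1 lam0 y0) = c * Vb y0"
    using proportional_end[OF assms] by blast
  let ?r = "1 / s0\<^sup>2"
  have "ode_system g h lam0 y0 (\<lambda>y. ?r * st_u (a1 lam0 y) + (- c * ?r) * Ub y) (\<lambda>y. ?r * st_u' (a1 lam0 y) + (- c * ?r) * Ub' y)
    (\<lambda>y. ?r * st_v (a1 lam0 y) + (- c * ?r) * Vb y) (\<lambda>y. ?r * st_v' (a1 lam0 y) + (- c * ?r) * Vb' y)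
    (\<lambda>y. ?r * Va y + (- c * ?r) * 0) (\<lambda>y. ?r * Ua y + (- c * ?r) * 0)"
    by (rule ode_system_lincomb[OF sys_a1 sys_b])
  from classical_solves_N[OF ell s0 cont_y0 this _ _ _ _ _ _ _ _ refl, of u]
  have "solves_N g h ell s0 (s0\<^sup>2 * lam0) (\<lambda>x. if x \<in> {0..ell} then vector
      [?r * st_u (a1 lam0 (s0 * x)) + (- c * ?r) * Ub (s0 * x), ?r * st_v (a1 lam0 (s0 * x)) + (- c * ?r) * Vb (s0 * x)] else 0) u"
    using initial c u_components s0 ode_system_continuous[OF sys_a[of lam0]]
    by (simp add: continuous_intros)
  then show ?thesis by blast
qed

text \<open>
  Replacing \<open>a\<close> by \<open>a - (lam - lam0) c b\<close> leaves the determinant unchanged and makes its first column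
  at \<open>y0\<close> vanish to second order in \<open>lam - lam0\<close>. So \<open>Fll\<close> is the determinant of \<open>a2 - 2 c b1\<close> and \<open>b\<close>, and
  \<open>pairing\<close> turns it into an integral over the generalized eigenfunction \<open>(X, Y) = a1 - c b\<close>.
\<close>

lemma second_crossing:
  assumes k: "Ua' y0 = \<kappa> * Vb y0" "Va' y0 = \<kappa> * Ub y0" and "Fl = 0"
    and v: "solves_N g h ell s0 (s0\<^sup>2 * lam0) v u"
  shows "- 2 * s0^3 * inner_L2 ell v (\<lambda>x. S_mat *v u x) = - (\<kappa> * Fll)"
proof -
  obtain c where c: "st_u (a1 lam0 y0) = c * Ub y0" "st_v (a1 lam0 y0) = c * Vb y0"
    using proportional_end[OF assms(3)] by blast
  note ca = ode_system_continuous[OF sys_a[of lam0]] and cb = ode_system_continuous[OF sys_b[of lam0]] and ca1 = ode_system_continuous[OF sys_a1[of lam0]]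
  have cu: "continuous_on {0..ell} (\<lambda>x. u x $ 1)" "continuous_on {0..ell} (\<lambda>x. u x $ 2)"
  proof -
    have "continuous_on {0..ell} (\<lambda>x. Ua (s0 * x))" "continuous_on {0..ell} (\<lambda>x. Va (s0 * x))"
      by (rule continuous_scaled[OF _ s0], rule ca)+
    then show "continuous_on {0..ell} (\<lambda>x. u x $ 1)" "continuous_on {0..ell} (\<lambda>x. u x $ 2)"
      by (simp_all add: u_components cong: continuous_on_cong_simp)
  qed
  obtain X' Y' where v_sys: "ode_system g h lam0 y0 (\<lambda>y. v (y / s0) $ 1) X' (\<lambda>y. v (y / s0) $ 2) Y'
      (\<lambda>y. u (y / s0) $ 2 / s0\<^sup>2) (\<lambda>y. u (y / s0) $ 1 / s0\<^sup>2)" and v_end: "v 0 = 0" "v ell = 0"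
    by (rule solves_N_classical[OF ell s0 cont_y0 cu v]) blast
  have rescale: "u (y / s0) $ 1 = Ua y" "u (y / s0) $ 2 = Va y" if "y \<in> {0..y0}" for y
  proof -
    have "y / s0 \<in> {0..ell}" using that s0 by (auto simp: field_simps)
    from u_components[OF this] show "u (y / s0) $ 1 = Ua y" "u (y / s0) $ 2 = Va y" using s0 by simp_all
  qed
  define X where "X = (\<lambda>y. st_u (a1 lam0 y) - c * Ub y)"
  define Y where "Y = (\<lambda>y. st_v (a1 lam0 y) - c * Vb y)"
  define I where "I = integral\<^sup>L (leb ell) (\<lambda>x. Ua (s0 * x) * Y (s0 * x) + Va (s0 * x) * X (s0 * x))"
  have XY_cont: "continuous_on {0..y0} X" "continuous_on {0..y0} Y"
    unfolding X_def Y_def by (intro continuous_intros ca1 cb)+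
  have XY_end: "X 0 = 0" "Y 0 = 0" "X y0 = 0" "Y y0 = 0" using initial c by (simp_all add: X_def Y_def)
  have 1: "2 * s0 * I = \<kappa> * Fll"
  proof -
    have "ode_system g h lam0 y0 (\<lambda>y. 1 * st_u (a2 lam0 y) + (- 2 * c) * st_u (b1 lam0 y)) (\<lambda>y. 1 * st_u' (a2 lam0 y) + (- 2 * c) * st_u' (b1 lam0 y))
      (\<lambda>y. 1 * st_v (a2 lam0 y) + (- 2 * c) * st_v (b1 lam0 y)) (\<lambda>y. 1 * st_v' (a2 lam0 y) + (- 2 * c) * st_v' (b1 lam0 y))
      (\<lambda>y. 1 * (2 * st_v (a1 lam0 y)) + (- 2 * c) * Vb y) (\<lambda>y. 1 * (2 * st_u (a1 lam0 y)) + (- 2 * c) * Ub y)"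
      by (rule ode_system_lincomb[OF sys_a2 sys_b1])
    from pairing[OF this _ _ _ _ k, of "\<lambda>x. 2 * (Ua (s0 * x) * Y (s0 * x) + Va (s0 * x) * X (s0 * x))"]
    have "s0 * integral\<^sup>L (leb ell) (\<lambda>x. 2 * (Ua (s0 * x) * Y (s0 * x) + Va (s0 * x) * X (s0 * x)))
      = \<kappa> * ((1 * st_u (a2 lam0 y0) + (- 2 * c) * st_u (b1 lam0 y0)) * Vb y0 - (1 * st_v (a2 lam0 y0) + (- 2 * c) * st_v (b1 lam0 y0)) * Ub y0)"
      using initial ca1 cb by (simp add: X_def Y_def algebra_simps continuous_intros)
    also have "\<dots> = \<kappa> * Fll"
      using u_end c by (simp add: Fll_def inner_Det algebra_simps)
    finally show ?thesis by (simp only: I_def integral_mult_right_zero mult_ac)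
  qed
  \<comment> \<open>The multiple \<open>s0\<^sup>2 v\<close>, rescaled, differs from \<open>(X, Y)\<close> by a solution \<open>(D, E)\<close> of the homogeneous
    problem. By the Lagrange identity for \<open>(D, E)\<close> and \<open>(X, Y)\<close> this does not change the integral.\<close>
  have 2: "s0\<^sup>2 * inner_L2 ell v (\<lambda>x. S_mat *v u x) = I"
  proof -
    define D where "D = (\<lambda>y. s0\<^sup>2 * v (y / s0) $ 1 - X y)"
    define E where "E = (\<lambda>y. s0\<^sup>2 * v (y / s0) $ 2 - Y y)"
    have "ode_system g h lam0 y0 (\<lambda>y. 1 * st_u (a1 lam0 y) + (- c) * Ub y) (\<lambda>y. 1 * st_u' (a1 lam0 y) + (- c) * Ub' y)
      (\<lambda>y. 1 * st_v (a1 lam0 y) + (- c) * Vb y) (\<lambda>y. 1 * st_v' (a1 lam0 y) + (- c) * Vb' y)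
      (\<lambda>y. 1 * Va y + (- c) * 0) (\<lambda>y. 1 * Ua y + (- c) * 0)"
      by (rule ode_system_lincomb[OF sys_a1 sys_b])
    then have XY_sys: "ode_system g h lam0 y0 X (\<lambda>y. st_u' (a1 lam0 y) - c * Ub' y) Y (\<lambda>y. st_v' (a1 lam0 y) - c * Vb' y) Va Ua"
      by (simp add: X_def[abs_def] Y_def[abs_def])
    define D' where "D' = (\<lambda>y. s0\<^sup>2 * X' y + (- 1) * (st_u' (a1 lam0 y) - c * Ub' y))"
    define E' where "E' = (\<lambda>y. s0\<^sup>2 * Y' y + (- 1) * (st_v' (a1 lam0 y) - c * Vb' y))"
    have "ode_system g h lam0 y0 D D' E E' (\<lambda>y. s0\<^sup>2 * (u (y / s0) $ 2 / s0\<^sup>2) + (- 1) * Va y) (\<lambda>y. s0\<^sup>2 * (u (y / s0) $ 1 / s0\<^sup>2) + (- 1) * Ua y)"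
      using ode_system_lincomb[OF v_sys XY_sys, of "s0\<^sup>2" "- 1"] by (simp add: D_def E_def D'_def E'_def)
    then have DE: "ode_system g h lam0 y0 D D' E E' (\<lambda>y. 0) (\<lambda>y. 0)"
      by (rule ode_system_cong) (use s0 in \<open>simp_all add: rescale\<close>)
    have DE_end: "D 0 = 0" "E 0 = 0" "D y0 = 0" "E y0 = 0"
      using v_end XY_end s0 by (simp_all add: D_def E_def)
    have "integral\<^sup>L (leb ell) (\<lambda>x. D (s0 * x) * Va (s0 * x) + E (s0 * x) * Ua (s0 * x))
      = ((D' y0 * X y0 - D y0 * (st_u' (a1 lam0 y0) - c * Ub' y0) - E' y0 * Y y0 + E y0 * (st_v' (a1 lam0 y0) - c * Vb' y0))
        - (D' 0 * X 0 - D 0 * (st_u' (a1 lam0 0) - c * Ub' 0) - E' 0 * Y 0 + E 0 * (st_v' (a1 lam0 0) - c * Vb' 0))) / s0"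
      by (rule integral_leb_stretch[OF ode_system_lagrange[OF DE XY_sys] _ s0 ell])
         (use ode_system_continuous[OF DE] ode_system_continuous[OF XY_sys] ca in \<open>auto intro!: continuous_intros\<close>)
    then have zero: "integral\<^sup>L (leb ell) (\<lambda>x. D (s0 * x) * Va (s0 * x) + E (s0 * x) * Ua (s0 * x)) = 0"
      using DE_end XY_end by simp
    have i1: "integrable (leb ell) (\<lambda>x. D (s0 * x) * Va (s0 * x) + E (s0 * x) * Ua (s0 * x))"
      "integrable (leb ell) (\<lambda>x. Ua (s0 * x) * Y (s0 * x) + Va (s0 * x) * X (s0 * x))"
      by (intro continuous_Icc_lebesgue(1) continuous_intros continuous_scaled[OF _ s0] ode_system_continuous[OF DE] ca XY_cont)+
    have "s0\<^sup>2 * inner_L2 ell v (\<lambda>x. S_mat *v u x) = integral\<^sup>L (leb ell) (\<lambda>x. s0\<^sup>2 * (v x $ 1 * u x $ 2 + v x $ 2 * u x $ 1))"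
      by (simp add: inner_L2_S)
    also have "\<dots> = integral\<^sup>L (leb ell) (\<lambda>x. (D (s0 * x) * Va (s0 * x) + E (s0 * x) * Ua (s0 * x))
        + (Ua (s0 * x) * Y (s0 * x) + Va (s0 * x) * X (s0 * x)))"
      by (rule Bochner_Integration.integral_cong[OF refl])
         (use s0 in \<open>auto simp: u_components D_def E_def algebra_simps\<close>)
    also have "\<dots> = I" using zero i1 by (simp add: I_def)
    finally show ?thesis .
  qed
  have "2 * s0^3 * inner_L2 ell v (\<lambda>x. S_mat *v u x) = 2 * s0 * (s0\<^sup>2 * inner_L2 ell v (\<lambda>x. S_mat *v u x))"
    by (simp add: power2_eq_square power3_eq_cube)
  also have "\<dots> = \<kappa> * Fll" unfolding 2 by (rule 1)
  finally show ?thesis by simp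
qed

end

section \<open>The eigenvalue curves\<close>

theorem corollary4p4:
  fixes g h :: "real \<Rightarrow> real" and ell lam0 s0 :: real
    and u :: "real \<Rightarrow> real^2" and q :: "real^8"
  assumes "0 < ell"
    and "C2_on {0..ell} g" and "C2_on {0..ell} h"
    and "0 < s0" and "s0 \<le> 1"
    and "s0 = 1 \<longrightarrow> (\<exists>ell'>ell. C2_on {0..ell'} g \<and> C2_on {0..ell'} h)"
    and "fun_space.dim (ker_N g h ell s0 (s0\<^sup>2 * lam0)) = 1"
    and "fun_space.span {u} = ker_N g h ell s0 (s0\<^sup>2 * lam0)"
    and "q = Tr ell s0 u"
  shows "((\<exists>p\<in>Tr ell s0 ` ker_N g h ell s0 (s0\<^sup>2 * lam0). m_lam g h ell lam0 s0 p \<noteq> 0) \<longrightarrow>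
           (\<exists>\<epsilon>>0. \<exists>lam. C2_on {s0 - \<epsilon><..<s0 + \<epsilon>} lam \<and> lam s0 = lam0 \<and>
              (\<forall>s\<in>{s0 - \<epsilon><..<s0 + \<epsilon>}. s\<^sup>2 * lam s \<in> Spec_N g h ell s) \<and>
              deriv lam s0 = - (m_s g h ell lam0 s0 q / m_lam g h ell lam0 s0 q)))
       \<and> ((\<exists>p\<in>Tr ell s0 ` ker_N g h ell s0 (s0\<^sup>2 * lam0). m_s g h ell lam0 s0 p \<noteq> 0) \<longrightarrow>
           (\<exists>\<epsilon>>0. \<exists>sc. C2_on {lam0 - \<epsilon><..<lam0 + \<epsilon>} sc \<and> sc lam0 = s0 \<and>
              (\<forall>l\<in>{lam0 - \<epsilon><..<lam0 + \<epsilon>}. (sc l)\<^sup>2 * l \<in> Spec_N g h ell (sc l)) \<and>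
              deriv sc lam0 = - (m_lam g h ell lam0 s0 q / m_s g h ell lam0 s0 q) \<and>
              (deriv sc lam0 = 0 \<longleftrightarrow> m_lam g h ell lam0 s0 q = 0) \<and>
              (m_lam g h ell lam0 s0 q = 0 \<longrightarrow>
                 deriv (deriv sc) lam0 = - (m2_lam g h ell lam0 s0 q / m_s g h ell lam0 s0 q))))"
proof -
  note ell = assms(1) and s0 = assms(4)
  \<comment> \<open>A number \<open>L > s0 ell\<close> up to which the coefficients are \<open>C\<^sup>2\<close>, so that the end point can move
    to both sides.\<close>
  obtain L where len: "s0 * ell < L" "C2_on {0..L} g" "C2_on {0..L} h"
  proof (cases "s0 = 1")
    case True
    then show ?thesis using assms(6) that by auto
  next
    case False
    then have "s0 * ell < ell" using assms(1,5) by simp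
    then show ?thesis using assms(2,3) that by blast
  qed
  obtain g' where g': "classical_deriv L g g'" "continuous_on {0..L} g'" using C2_on_classical_deriv[OF len(2)] .
  obtain h' where h': "classical_deriv L h h'" "continuous_on {0..L} h'" using C2_on_classical_deriv[OF len(3)] .
  have y0_pos: "0 < s0 * ell" using ell s0 by simp
  interpret shooting g h L
    by unfold_locales
       (use y0_pos len(1) classical_deriv_continuous[OF g'(1)] classical_deriv_continuous[OF h'(1)] in auto)
  have c0: "continuous_on {0..s0 * ell} g" "continuous_on {0..s0 * ell} h"
    using len(1) continuous_on_subset[OF g_cont, of "{0..s0 * ell}"] continuous_on_subset[OF h_cont, of "{0..s0 * ell}"]
    by simp_all
  interpret Y: shooting g h "s0 * ell" by unfold_locales (use y0_pos c0 in auto)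
  let ?ker = "ker_N g h ell s0 (s0\<^sup>2 * lam0)"
  have u_ker: "u \<in> ?ker" using fun_space.span_base[of u "{u}"] assms(8) by simp
  have ker_multiple: "\<exists>c. w = (\<lambda>x. c *\<^sub>R u x)" if "w \<in> ?ker" for w
    using that unfolding assms(8)[symmetric] fun_space.span_singleton by auto
  have u_nonzero: "u \<noteq> 0"
  proof
    assume "u = 0"
    then have "?ker = fun_space.span {}" using assms(8) fun_space.span_insert_0[of "{}"] by simp
    then show False using assms(7) by (simp only: fun_space.dim_span) (simp add: fun_space.dim_eq_card_independent fun_space.independent_empty)
  qed
  have sol: "solves_N g h ell s0 (s0\<^sup>2 * lam0) u (\<lambda>x. 0)" using u_ker by (simp add: ker_N_def)
  obtain U' V' where sysu: "ode_system g h lam0 (s0 * ell) (\<lambda>y. u (y / s0) $ 1) U' (\<lambda>y. u (y / s0) $ 2) V' (\<lambda>y. 0) (\<lambda>y. 0)"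
    and u_end: "u 0 = 0" "u ell = 0" and u_out: "\<And>x. x \<notin> {0..ell} \<Longrightarrow> u x = 0"
    by (rule solves_N_classical[OF ell s0 c0 _ _ sol]) auto
  \<comment> \<open>The slope of the rescaled eigenfunction at \<open>0\<close>.\<close>
  define \<alpha> where "\<alpha> = U' 0"
  define \<beta> where "\<beta> = V' 0"
  obtain a a1 a2 where a: "family a a1 a2" "\<And>l. a l 0 = (0, \<alpha>, 0, \<beta>)" using family_exists by blast
  obtain b b1 b2 where b: "family b b1 b2" "\<And>l. b l 0 = (0, - \<beta>, 0, \<alpha>)" using family_exists by blast
  note sysa = ode_system_subset[OF family_ode_system(1)[OF a(1)] less_imp_le[OF len(1)]]
  note sysb = ode_system_subset[OF family_ode_system(1)[OF b(1)] less_imp_le[OF len(1)]]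
  have au: "u (y / s0) $ 1 = st_u (a lam0 y)" "u (y / s0) $ 2 = st_v (a lam0 y)" if "y \<in> {0..s0 * ell}" for y
    by (rule Y.ode_system_unique[OF sysu sysa _ _ _ _ that]; simp add: u_end a(2) st_defs \<alpha>_def \<beta>_def)+
  have u_eq: "u x = vector [st_u (a lam0 (s0 * x)), st_v (a lam0 (s0 * x))]" if "x \<in> {0..ell}" for x
    using au[of "s0 * x"] that s0 by (simp add: vec_eq_iff forall_2)
  have \<alpha>\<beta>: "\<not> (\<alpha> = 0 \<and> \<beta> = 0)"
  proof
    assume 0: "\<alpha> = 0 \<and> \<beta> = 0"
    have zs: "ode_system g h lam0 (s0 * ell) (\<lambda>y. 0) (\<lambda>y. 0) (\<lambda>y. 0) (\<lambda>y. 0) (\<lambda>y. 0) (\<lambda>y. 0)"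
      by (simp add: ode_system_def classical_deriv_def)
    have "u x = 0" for x
    proof (cases "x \<in> {0..ell}")
      case True
      then have "s0 * x \<in> {0..s0 * ell}" using s0 by simp
      from Y.ode_system_unique(1,3)[OF sysu zs _ _ _ _ this] show ?thesis
        using 0 u_end s0 by (simp add: \<alpha>_def \<beta>_def vec_eq_iff forall_2)
    qed (rule u_out)
    then show False using u_nonzero by (auto simp: fun_eq_iff)
  qed
  have a_end: "st_u (a lam0 (s0 * ell)) = 0" "st_v (a lam0 (s0 * ell)) = 0"
    using au[of "s0 * ell"] u_end s0 ell by auto
  have b_end: "\<not> (st_u (b lam0 (s0 * ell)) = 0 \<and> st_v (b lam0 (s0 * ell)) = 0)"
  proof
    assume e: "st_u (b lam0 (s0 * ell)) = 0 \<and> st_v (b lam0 (s0 * ell)) = 0"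
    define w where "w = (\<lambda>x. if x \<in> {0..ell} then vector [st_u (b lam0 (s0 * x)), st_v (b lam0 (s0 * x))] else 0 :: real^2)"
    have "solves_N g h ell s0 (s0\<^sup>2 * lam0) w (\<lambda>x. 0)"
      by (rule classical_solves_N[OF ell s0 c0 sysb _ _ _ _ _ _ _ _ w_def]) (use e in \<open>auto simp: b(2) st_defs\<close>)
    then obtain c where c: "w = (\<lambda>x. c *\<^sub>R u x)" using ker_multiple by (auto simp: ker_N_def)
    have bc: "st_u (b lam0 y) = c * st_u (a lam0 y)" "st_v (b lam0 y) = c * st_v (a lam0 y)" if y: "y \<in> {0..s0 * ell}" for y
    proof -
      have x: "y / s0 \<in> {0..ell}" using y s0 by (auto simp: field_simps)
      have "w (y / s0) = c *\<^sub>R u (y / s0)" using c by simp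
      then show "st_u (b lam0 y) = c * st_u (a lam0 y)" "st_v (b lam0 y) = c * st_v (a lam0 y)"
        using x s0 u_eq[OF x] by (auto simp: w_def vec_eq_iff forall_2)
    qed
    have "1 * st_u' (b lam0 0) + (- c) * st_u' (a lam0 0) = 0" "1 * st_v' (b lam0 0) + (- c) * st_v' (a lam0 0) = 0"
      using ode_system_zero_initial[OF ode_system_lincomb[OF sysb[of lam0] sysa[of lam0], of 1 "- c"] y0_pos] bc by auto
    then have e: "\<beta> = - (c * \<alpha>)" "\<alpha> = c * \<beta>" by (auto simp: a(2) b(2) st_defs)
    have "\<alpha> * (1 + c\<^sup>2) = \<alpha> - c * (- (c * \<alpha>))" by (simp add: power2_eq_square algebra_simps)
    also have "\<dots> = 0" using e by simp
    finally have "\<alpha> = 0" using zero_le_power2[of c] by (auto simp del: zero_le_power2)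
    moreover from this have "\<beta> = 0" using e(1) by simp
    ultimately show False using \<alpha>\<beta> by simp
  qed
  interpret C: crossing g h L ell lam0 s0 u a a1 a2 b b1 b2 \<alpha> \<beta>
    by unfold_locales (use ell s0 len(1) a b u_eq a_end b_end in auto)
  obtain \<kappa> where \<kappa>: "st_u' (a lam0 (s0 * ell)) = \<kappa> * st_v (b lam0 (s0 * ell))"
    "st_v' (a lam0 (s0 * ell)) = \<kappa> * st_u (b lam0 (s0 * ell))"
    using C.kappa_exists by blast
  have trace: "kernel_of_trace g h ell lam0 s0 (Tr ell s0 w) = w" if "w \<in> ?ker" for w
    by (rule kernel_of_trace_eq[OF ell s0 c0 that])
  have ml: "m_lam g h ell lam0 s0 q = - (\<kappa> * C.Fl)"
    unfolding m_lam_def assms(9) trace[OF u_ker] Let_def by (rule C.crossing_lam[OF \<kappa>])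
  have ms: "m_s g h ell lam0 s0 q = - (\<kappa> * C.Fs)"
    unfolding m_s_def assms(9) trace[OF u_ker] Let_def by (rule C.crossing_s[OF \<kappa> g' h'])
  have m2: "m2_lam g h ell lam0 s0 q = - (\<kappa> * C.Fll)" if "C.Fl = 0"
    unfolding m2_lam_def assms(9) trace[OF u_ker] Let_def
    by (rule C.second_crossing[OF \<kappa> that someI_ex[OF C.generalized_eigenfunction_exists[OF that]]])
  \<comment> \<open>The hypotheses say that a form is nonzero somewhere on the one-dimensional space; by
    homogeneity it is then nonzero at \<open>q\<close>.\<close>
  have form_scale: "m_lam g h ell lam0 s0 (Tr ell s0 w) = c\<^sup>2 * m_lam g h ell lam0 s0 q"
    "m_s g h ell lam0 s0 (Tr ell s0 w) = c\<^sup>2 * m_s g h ell lam0 s0 q"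
    if w: "w \<in> ?ker" "w = (\<lambda>x. c *\<^sub>R u x)" for w c
  proof -
    have S: "S_mat *v (c *\<^sub>R z) = c *\<^sub>R (S_mat *v z)" for z by (simp add: S_mat_apply vec_eq_iff forall_2)
    have inner: "inner_L2 ell (\<lambda>x. c *\<^sub>R f x) (\<lambda>x. c *\<^sub>R k x) = c\<^sup>2 * inner_L2 ell f k" for f k :: "real \<Rightarrow> real^2"
      by (simp add: inner_L2_def power2_eq_square mult.assoc flip: integral_mult_right_zero)
    show "m_lam g h ell lam0 s0 (Tr ell s0 w) = c\<^sup>2 * m_lam g h ell lam0 s0 q"
      unfolding m_lam_def assms(9) trace[OF u_ker] trace[OF w(1)] Let_def
      unfolding w(2) S inner by simp
    have d: "dBs_mat g h s0 x *v (c *\<^sub>R u x) - (2 * s0 * lam0) *\<^sub>R (c *\<^sub>R u x)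
      = c *\<^sub>R (dBs_mat g h s0 x *v u x - (2 * s0 * lam0) *\<^sub>R u x)" for x
      by (simp add: matrix_vector_mult_scaleR scaleR_right_diff_distrib mult.commute)
    show "m_s g h ell lam0 s0 (Tr ell s0 w) = c\<^sup>2 * m_s g h ell lam0 s0 q"
      unfolding m_s_def assms(9) trace[OF u_ker] trace[OF w(1)] Let_def
      unfolding w(2) S d inner by simp
  qed
  define W where "W = {p :: real \<times> real. 0 < snd p * ell \<and> snd p * ell < L}"
  define F where "F = (\<lambda>p. a (fst p) (snd p * ell) \<bullet> blinfun_apply Det (b (fst p) (snd p * ell)))"
  obtain Fl Fs Fll Fls Fsl Fss where
    F: "\<And>p. p \<in> W \<Longrightarrow> has_partials F (Fl p) (Fs p) p" "\<And>p. p \<in> W \<Longrightarrow> has_partials Fl (Fll p) (Fls p) p" "\<And>p. p \<in> W \<Longrightarrow> has_partials Fs (Fsl p) (Fss p) p"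
    and Fcont: "continuous_on W Fll" "continuous_on W Fls" "continuous_on W Fsl" "continuous_on W Fss"
    and Feq: "Fl (lam0, s0) = C.Fl" "Fs (lam0, s0) = C.Fs" "Fll (lam0, s0) = C.Fll"
    using determinant_C2[OF a(1) b(1), of ell] unfolding W_def[symmetric] F_def[symmetric] C.Fl_def C.Fs_def C.Fll_def
    by blast
  have "open W"
    unfolding W_def by (intro open_Collect_conj open_Collect_less continuous_intros)
  have inW: "(lam0, s0) \<in> W" using y0_pos len(1) by (simp add: W_def)
  have F0: "F (lam0, s0) = 0" by (simp add: F_def inner_Det a_end)
  have Spec: "s\<^sup>2 * l \<in> Spec_N g h ell s" if "(l, s) \<in> W" "F (l, s) = 0" for l s
  proof (rule det_zero_Spec[OF a b \<alpha>\<beta> ell])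
    show "0 < s" "s * ell < L" using that(1) ell by (auto simp: W_def zero_less_mult_iff)
    show "a l (s * ell) \<bullet> blinfun_apply Det (b l (s * ell)) = 0" using that(2) by (simp add: F_def)
  qed
  show ?thesis
  proof (intro conjI impI)
    assume "\<exists>p\<in>Tr ell s0 ` ?ker. m_lam g h ell lam0 s0 p \<noteq> 0"
    then have "m_lam g h ell lam0 s0 q \<noteq> 0" using form_scale(1) ker_multiple by fastforce
    then have nz: "\<kappa> \<noteq> 0" "C.Fl \<noteq> 0" using ml by auto
    \<comment> \<open>Here \<open>lam\<close> is the dependent variable, so the arguments of \<open>F\<close> are exchanged.\<close>
    define sw where "sw = (\<lambda>p :: real \<times> real. (snd p, fst p))"
    have sw_cont: "continuous_on A sw" for A unfolding sw_def by (intro continuous_intros)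
    have "open (sw -` W)" using \<open>open W\<close> sw_cont by (simp add: continuous_on_open_vimage open_vimage)
    have c: "continuous_on (sw -` W) (\<lambda>p. K (sw p))" if "continuous_on W K" for K :: "real \<times> real \<Rightarrow> real"
      by (rule continuous_on_compose2[OF that sw_cont]) auto
    have d: "((\<lambda>p. K (sw p)) has_derivative (\<lambda>d. Ks (sw p) * fst d + Kl (sw p) * snd d)) (at p)"
      if "p \<in> sw -` W" "\<And>p. p \<in> W \<Longrightarrow> has_partials K (Kl p) (Ks p) p" for K Kl Ks p
      using has_partials_real[OF has_partials_swap[OF that(2)[of "sw p", unfolded sw_def]]] that(1) by (simp add: sw_def)
    obtain e f where f: "e > 0" "f s0 = lam0" "C2_on {s0 - e<..<s0 + e} f"
      "\<And>x. x \<in> {s0 - e<..<s0 + e} \<Longrightarrow> (x, f x) \<in> sw -` W \<and> F (sw (x, f x)) = 0"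
      "deriv f s0 = - (Fs (sw (s0, lam0)) / Fl (sw (s0, lam0)))"
      by (rule implicit_function_C2[OF \<open>open (sw -` W)\<close> _ d[OF _ F(1)] d[OF _ F(3)] d[OF _ F(2)]
            c[OF Fcont(4)] c[OF Fcont(3)] c[OF Fcont(2)] c[OF Fcont(1)], of s0 lam0])
         (use inW F0 Feq nz in \<open>auto simp: sw_def\<close>)
    have "deriv f s0 = - (m_s g h ell lam0 s0 q / m_lam g h ell lam0 s0 q)"
      using f(5) nz by (simp add: sw_def Feq ml ms)
    moreover have "s\<^sup>2 * f s \<in> Spec_N g h ell s" if "s \<in> {s0 - e<..<s0 + e}" for s
      using f(4)[OF that] by (intro Spec) (auto simp: sw_def)
    ultimately show "\<exists>\<epsilon>>0. \<exists>lam. C2_on {s0 - \<epsilon><..<s0 + \<epsilon>} lam \<and> lam s0 = lam0 \<and>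
              (\<forall>s\<in>{s0 - \<epsilon><..<s0 + \<epsilon>}. s\<^sup>2 * lam s \<in> Spec_N g h ell s) \<and>
              deriv lam s0 = - (m_s g h ell lam0 s0 q / m_lam g h ell lam0 s0 q)"
      using f(1-3) by blast
  next
    assume "\<exists>p\<in>Tr ell s0 ` ?ker. m_s g h ell lam0 s0 p \<noteq> 0"
    then have "m_s g h ell lam0 s0 q \<noteq> 0" using form_scale(2) ker_multiple by fastforce
    then have nz: "\<kappa> \<noteq> 0" "C.Fs \<noteq> 0" using ms by auto
    obtain e f where f: "e > 0" "f lam0 = s0" "C2_on {lam0 - e<..<lam0 + e} f"
      "\<And>x. x \<in> {lam0 - e<..<lam0 + e} \<Longrightarrow> (x, f x) \<in> W \<and> F (x, f x) = 0"
      "deriv f lam0 = - (Fl (lam0, s0) / Fs (lam0, s0))"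
      "Fl (lam0, s0) = 0 \<Longrightarrow> deriv (deriv f) lam0 = - (Fll (lam0, s0) / Fs (lam0, s0))"
      by (rule implicit_function_C2[OF \<open>open W\<close> inW has_partials_real[OF F(1)] has_partials_real[OF F(2)] has_partials_real[OF F(3)] Fcont F0])
         (use Feq nz in auto)
    have "deriv f lam0 = - (m_lam g h ell lam0 s0 q / m_s g h ell lam0 s0 q)"
      using f(5) nz by (simp add: Feq ml ms)
    moreover have "deriv f lam0 = 0 \<longleftrightarrow> m_lam g h ell lam0 s0 q = 0"
      using f(5) nz by (simp add: Feq ml)
    moreover have "deriv (deriv f) lam0 = - (m2_lam g h ell lam0 s0 q / m_s g h ell lam0 s0 q)" if "m_lam g h ell lam0 s0 q = 0"
    proof -
      have "C.Fl = 0" using that nz by (simp add: ml)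
      then show ?thesis using f(6) nz m2 by (simp add: Feq ms)
    qed
    moreover have "(f l)\<^sup>2 * l \<in> Spec_N g h ell (f l)" if "l \<in> {lam0 - e<..<lam0 + e}" for l
      using f(4)[OF that] by (intro Spec) auto
    ultimately show "\<exists>\<epsilon>>0. \<exists>sc. C2_on {lam0 - \<epsilon><..<lam0 + \<epsilon>} sc \<and> sc lam0 = s0 \<and>
              (\<forall>l\<in>{lam0 - \<epsilon><..<lam0 + \<epsilon>}. (sc l)\<^sup>2 * l \<in> Spec_N g h ell (sc l)) \<and>
              deriv sc lam0 = - (m_lam g h ell lam0 s0 q / m_s g h ell lam0 s0 q) \<and>
              (deriv sc lam0 = 0 \<longleftrightarrow> m_lam g h ell lam0 s0 q = 0) \<and>
              (m_lam g h ell lam0 s0 q = 0 \<longrightarrow>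
                 deriv (deriv sc) lam0 = - (m2_lam g h ell lam0 s0 q / m_s g h ell lam0 s0 q))"
      using f(1-3) by blast
  qed
qed

end
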